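(* Let $r>0$ and let $M\subset B_{\mathbb{R}^{3}}(r)$ be a complete bounded minimal surface in $\mathbb{R}^{3}$. Then $$\lambda^{\ast}(M)\;\geq\;\lambda_{1}(\mathbb{D}(r))=\frac{c}{r^{2}},$$ where $c>0$ is an absolute constant.
   Context: $B_{\mathbb{R}^3}(r)$ is a ball of radius $r$ in $\mathbb{R}^3$ and $\mathbb{D}(r)$ is the disc of radius $r$ in $\mathbb{R}^2$; $\lambda_1(\mathbb{D}(r))$ is its first Dirichlet eigenvalue of $-\triangle$. Minimal surfaces are smooth, connected and (isometrically) immersed. Fundamental tone: $\lambda^{\ast}(M)=\inf\left\{\frac{\int_{M}|\operatorname{grad} f|^{2}}{\int_{M}f^{2}} : f\in L^{2}_{1,0}(M)\setminus\{0\}\right\}$, where $L^{2}_{1,0}(M)$ is the completion of $C_{0}^{\infty}(M)$ with respect to the norm $\|\varphi\|^{2}=\int_{M}\varphi^{2}+\int_{M}|\nabla\varphi|^{2}$. *)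

theory Defs
  imports "HOL-Analysis.Analysis"
begin

section \<open>Differentiability classes on open sets\<close>

text \<open>Meant for open \<open>S\<close>, where the derivative \<open>frechet_derivative f (at x)\<close> is unique.\<close>

primrec Ck_on :: "nat \<Rightarrow> 'a::real_normed_vector set \<Rightarrow> ('a \<Rightarrow> 'b::real_normed_vector) \<Rightarrow> bool" where
  "Ck_on 0 S f \<longleftrightarrow> continuous_on S f"
| "Ck_on (Suc k) S f \<longleftrightarrow>
     (\<forall>x\<in>S. f differentiable (at x)) \<and>
     (\<forall>v. Ck_on k S (\<lambda>x. frechet_derivative f (at x) v))"

definition smooth_on :: "'a::real_normed_vector set \<Rightarrow> ('a \<Rightarrow> 'b::real_normed_vector) \<Rightarrow> bool" where
  "smooth_on S f \<longleftrightarrow> (\<forall>k. Ck_on k S f)"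

definition pd :: "2 \<Rightarrow> (real^2 \<Rightarrow> 'b::real_normed_vector) \<Rightarrow> real^2 \<Rightarrow> 'b" where
  "pd i u x = frechet_derivative u (at x) (axis i 1)"

section \<open>The first Dirichlet eigenvalue of a planar domain\<close>

definition laplacian :: "(real^2 \<Rightarrow> real) \<Rightarrow> real^2 \<Rightarrow> real" where
  "laplacian u x = (\<Sum>i\<in>UNIV. pd i (pd i u) x)"

definition dirichlet_eigenvalue :: "(real^2) set \<Rightarrow> real \<Rightarrow> bool" where
  "dirichlet_eigenvalue \<Omega> \<mu> \<longleftrightarrow>
     (\<exists>u. Ck_on 2 \<Omega> u \<and> continuous_on (closure \<Omega>) u \<and>
          (\<forall>x\<in>frontier \<Omega>. u x = 0) \<and> (\<exists>x\<in>\<Omega>. u x \<noteq> 0) \<and>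
          (\<forall>x\<in>\<Omega>. - laplacian u x = \<mu> * u x))"

definition first_dirichlet_eigenvalue :: "(real^2) set \<Rightarrow> real" where
  "first_dirichlet_eigenvalue \<Omega> = (LEAST \<mu>. dirichlet_eigenvalue \<Omega> \<mu>)"

section \<open>Smooth connected surfaces immersed in three-space\<close>

text \<open>
  An atlas consists of local parametrizations \<open>(V, \<phi>)\<close>, i.e. inverses of charts: \<open>V\<close> is open in
  the plane and \<open>\<phi>\<close> maps \<open>V\<close> homeomorphically onto an open subset of the surface.  The immersion
  need not be injective; the surface carries the metric induced by it.
\<close>

record 'a surface =
  surf_topology :: "'a topology"
  parametrizations :: "((real^2) set \<times> (real^2 \<Rightarrow> 'a)) set"
  immersion :: "'a \<Rightarrow> real^3"

abbreviation surf_points :: "'a surface \<Rightarrow> 'a set" where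
  "surf_points M \<equiv> topspace (surf_topology M)"

definition smooth_manifold2 :: "'a topology \<Rightarrow> ((real^2) set \<times> (real^2 \<Rightarrow> 'a)) set \<Rightarrow> bool" where
  "smooth_manifold2 X A \<longleftrightarrow>
     Hausdorff_space X \<and> second_countable X \<and>
     (\<forall>(V,\<phi>)\<in>A. open V \<and> openin X (\<phi> ` V) \<and>
        homeomorphic_map (top_of_set V) (subtopology X (\<phi> ` V)) \<phi>) \<and>
     (\<Union>(V,\<phi>)\<in>A. \<phi> ` V) = topspace X \<and>
     (\<forall>(V,\<phi>)\<in>A. \<forall>(W,\<psi>)\<in>A. smooth_on {x\<in>V. \<phi> x \<in> \<psi> ` W} (inv_into W \<psi> \<circ> \<phi>))"

definition immersed_surface :: "'a surface \<Rightarrow> bool" where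
  "immersed_surface M \<longleftrightarrow>
     smooth_manifold2 (surf_topology M) (parametrizations M) \<and>
     connected_space (surf_topology M) \<and> surf_points M \<noteq> {} \<and>
     (\<forall>(V,\<phi>)\<in>parametrizations M. smooth_on V (immersion M \<circ> \<phi>) \<and>
        (\<forall>x\<in>V. inj (frechet_derivative (immersion M \<circ> \<phi>) (at x))))"

section \<open>Minimality\<close>

definition fff :: "(real^2 \<Rightarrow> real^3) \<Rightarrow> 2 \<Rightarrow> 2 \<Rightarrow> real^2 \<Rightarrow> real" where
  "fff u i j x = pd i u x \<bullet> pd j u x"

definition unit_normal :: "(real^2 \<Rightarrow> real^3) \<Rightarrow> real^2 \<Rightarrow> real^3" where
  "unit_normal u x =
     (let n = cross3 (pd 1 u x) (pd 2 u x) in (1 / norm n) *\<^sub>R n)"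

definition sff :: "(real^2 \<Rightarrow> real^3) \<Rightarrow> 2 \<Rightarrow> 2 \<Rightarrow> real^2 \<Rightarrow> real" where
  "sff u i j x = pd i (pd j u) x \<bullet> unit_normal u x"

text \<open>Half the trace of the second fundamental form \<open>sff\<close> with respect to the first
  fundamental form \<open>fff\<close>.\<close>

definition mean_curvature :: "(real^2 \<Rightarrow> real^3) \<Rightarrow> real^2 \<Rightarrow> real" where
  "mean_curvature u x =
     (sff u 1 1 x * fff u 2 2 x - 2 * sff u 1 2 x * fff u 1 2 x + sff u 2 2 x * fff u 1 1 x) /
     (2 * (fff u 1 1 x * fff u 2 2 x - (fff u 1 2 x)\<^sup>2))"

definition minimal_surface :: "'a surface \<Rightarrow> bool" where
  "minimal_surface M \<longleftrightarrow> immersed_surface M \<and>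
     (\<forall>(V,\<phi>)\<in>parametrizations M. \<forall>x\<in>V. mean_curvature (immersion M \<circ> \<phi>) x = 0)"

section \<open>Intrinsic distance and completeness\<close>

text \<open>
  Since the immersion is a local embedding, a continuous path in the surface is piecewise
  \<open>C\<^sup>1\<close> iff its image in three-space is, and both have the same length.  The library's
  \<open>piecewise_C1_differentiable_on\<close> imposes no bound on the derivative near the exceptional
  points; integrability of the speed excludes paths of infinite length, whose
  \<open>integral\<close> would be the default value 0.
\<close>

definition admissible_path :: "'a surface \<Rightarrow> (real \<Rightarrow> 'a) \<Rightarrow> bool" where
  "admissible_path M \<gamma> \<longleftrightarrow>
     pathin (surf_topology M) \<gamma> \<and>
     (immersion M \<circ> \<gamma>) piecewise_C1_differentiable_on {0..1} \<and>
     (\<lambda>t. norm (vector_derivative (immersion M \<circ> \<gamma>) (at t))) integrable_on {0..1}"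

definition surf_length :: "'a surface \<Rightarrow> (real \<Rightarrow> 'a) \<Rightarrow> real" where
  "surf_length M \<gamma> =
     integral {0..1} (\<lambda>t. norm (vector_derivative (immersion M \<circ> \<gamma>) (at t)))"

definition surf_dist :: "'a surface \<Rightarrow> 'a \<Rightarrow> 'a \<Rightarrow> real" where
  "surf_dist M p q = Inf {surf_length M \<gamma> |\<gamma>. admissible_path M \<gamma> \<and> \<gamma> 0 = p \<and> \<gamma> 1 = q}"

definition complete_surface :: "'a surface \<Rightarrow> bool" where
  "complete_surface M \<longleftrightarrow> Metric_space.mcomplete (surf_points M) (surf_dist M)"

section \<open>Riemannian area and gradient\<close>

definition area_density :: "(real^2 \<Rightarrow> real^3) \<Rightarrow> real^2 \<Rightarrow> real" where
  "area_density u x = sqrt (fff u 1 1 x * fff u 2 2 x - (fff u 1 2 x)\<^sup>2)"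

text \<open>The unique Borel measure that has density \<open>area_density\<close> in every local parametrization.\<close>

definition area_measure :: "'a surface \<Rightarrow> 'a measure" where
  "area_measure M = (THE \<mu>.
     space \<mu> = surf_points M \<and>
     sets \<mu> = sigma_sets (surf_points M) {U. openin (surf_topology M) U} \<and>
     (\<forall>(V,\<phi>)\<in>parametrizations M. \<forall>B\<in>sets borel. B \<subseteq> V \<longrightarrow>
        emeasure \<mu> (\<phi> ` B) =
          (\<integral>\<^sup>+x\<in>B. ennreal (area_density (immersion M \<circ> \<phi>) x) \<partial>lborel)))"

text \<open>
  Tangent vectors are represented by their images under the differential of the immersion,
  which is isometric; the gradient is thus a vector of three-space tangent to the surface.
\<close>

definition surf_grad :: "'a surface \<Rightarrow> ('a \<Rightarrow> real) \<Rightarrow> 'a \<Rightarrow> real^3" where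
  "surf_grad M f p = (THE w.
     \<forall>(V,\<phi>)\<in>parametrizations M. \<forall>x\<in>V. \<phi> x = p \<longrightarrow>
       w \<in> range (frechet_derivative (immersion M \<circ> \<phi>) (at x)) \<and>
       (\<forall>v. w \<bullet> frechet_derivative (immersion M \<circ> \<phi>) (at x) v =
            frechet_derivative (f \<circ> \<phi>) (at x) v))"

section \<open>The fundamental tone\<close>

definition test_functions :: "'a surface \<Rightarrow> ('a \<Rightarrow> real) set" where
  "test_functions M = {f.
     (\<forall>(V,\<phi>)\<in>parametrizations M. smooth_on V (f \<circ> \<phi>)) \<and>
     (\<exists>K. compactin (surf_topology M) K \<and> (\<forall>p\<in>surf_points M - K. f p = 0))}"

text \<open>
  The completion of the test functions for the norm
  \<open>\<parallel>\<phi>\<parallel>\<^sup>2 = \<integral>\<phi>\<^sup>2 + \<integral>\<bar>grad \<phi>\<bar>\<^sup>2\<close>, realized as the closure of the pairs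
  \<open>(\<phi>, grad \<phi>)\<close> among pairs of square integrable functions and vector fields.  Up to null sets
  the second component is determined by the first, of which it is the weak gradient.
\<close>

definition L2_1_0 :: "'a surface \<Rightarrow> (('a \<Rightarrow> real) \<times> ('a \<Rightarrow> real^3)) set" where
  "L2_1_0 M = {(f, G).
     f \<in> borel_measurable (area_measure M) \<and> G \<in> borel_measurable (area_measure M) \<and>
     integrable (area_measure M) (\<lambda>p. (f p)\<^sup>2) \<and>
     integrable (area_measure M) (\<lambda>p. (norm (G p))\<^sup>2) \<and>
     (\<exists>\<phi> :: nat \<Rightarrow> 'a \<Rightarrow> real. (\<forall>n. \<phi> n \<in> test_functions M) \<and>
        (\<lambda>n. (\<integral>p. (\<phi> n p - f p)\<^sup>2 \<partial>area_measure M) +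
             (\<integral>p. (norm (surf_grad M (\<phi> n) p - G p))\<^sup>2 \<partial>area_measure M)) \<longlonglongrightarrow> 0)}"

definition fundamental_tone :: "'a surface \<Rightarrow> real" where
  "fundamental_tone M = Inf
     {(\<integral>p. (norm (G p))\<^sup>2 \<partial>area_measure M) / (\<integral>p. (f p)\<^sup>2 \<partial>area_measure M) |f G.
        (f, G) \<in> L2_1_0 M \<and> \<not> (AE p in area_measure M. f p = 0)}"

end

theory Submission
  imports Defs
begin

text \<open>
  Let \<open>\<phi>(|x - a|\<^sup>2) = J\<^sub>0(k |x - a|)\<close>, where \<open>k r\<close> is the first zero of \<open>J\<^sub>0\<close>.  In the plane this
  is the ground state of the disc of radius \<open>r\<close>, so \<open>4 (s \<phi>'' + \<phi>') = - k\<^sup>2 \<phi>\<close>.  On a minimal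
  surface \<open>\<Delta> |x - a|\<^sup>2 = 4\<close> and \<open>|grad |x - a|\<^sup>2|\<^sup>2 \<le> 4 |x - a|\<^sup>2\<close>; since \<open>\<phi>'' \<ge> 0\<close> up to the first
  zero, the restriction \<open>h\<close> of this function to the surface is positive and satisfies
  \<open>\<Delta> h \<le> 4 (s \<phi>'' + \<phi>') = - k\<^sup>2 h\<close>.  Barta's argument, i.e. testing this inequality with
  \<open>f\<^sup>2 / h\<close>, gives \<open>k\<^sup>2 \<integral>f\<^sup>2 \<le> \<integral>|grad f|\<^sup>2\<close> for all test functions \<open>f\<close>.
\<close>

section \<open>Differentiability classes\<close>

text \<open>The sign of \<phi>'' is where the size of the first zero matters. In the variable t =
  k^2 |x - a|^2 / 4 the profile is \<open>bes 0\<close> and its second derivative is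
  \<open>bes 2\<close>. An alternating series bound makes \<open>bes 2\<close> nonnegative on
  [0, 2], and the first zero of \<open>bes 0\<close> lies in this interval because
  \<open>bes 0 2 < 0\<close>.

  \<open>first_dirichlet_eigenvalue\<close> is a least value over classical eigenfunctions, so the
  disc needs a lower bound for arbitrary, possibly sign-changing ones. A maximum principle gives it
  without spectral theory.

  On the surface the obstacle is integration by parts. \<open>area_measure\<close> and
  \<open>surf_grad\<close> are definite descriptions, so existence and uniqueness have to be shown
  across all charts. A partition of unity reduces the integral of the weak Laplacian to a single
  chart. There minimality makes the conormals divergence free, and what remains are partial
  derivatives of compactly supported functions in the plane, whose integrals vanish.\<close>

lemma frechet_derivative_cong_open:
  assumes "open S" "\<And>x. x \<in> S \<Longrightarrow> f x = g x" "x \<in> S"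
  shows "frechet_derivative f (at x) = frechet_derivative g (at x)"
    and "f differentiable (at x) \<longleftrightarrow> g differentiable (at x)"
proof -
  have "(f has_derivative D) (at x) \<longleftrightarrow> (g has_derivative D) (at x)" for D
    using has_derivative_transform_within_open[of f D x UNIV S g]
      has_derivative_transform_within_open[of g D x UNIV S f] assms by auto
  then show "frechet_derivative f (at x) = frechet_derivative g (at x)"
    and "f differentiable (at x) \<longleftrightarrow> g differentiable (at x)"
    by (auto simp: frechet_derivative_def differentiable_def)
qed

lemma Ck_on_cong:
  assumes "open S" "\<And>x. x \<in> S \<Longrightarrow> f x = g x"
  shows "Ck_on k S f \<longleftrightarrow> Ck_on k S g"
  using assms(2)
proof (induction k arbitrary: f g)
  case 0
  then show ?case by (simp cong: continuous_on_cong)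
next
  case (Suc k)
  have "Ck_on k S (\<lambda>x. frechet_derivative f (at x) v) \<longleftrightarrow> Ck_on k S (\<lambda>x. frechet_derivative g (at x) v)" for v
    by (rule Suc.IH) (use frechet_derivative_cong_open(1)[OF assms(1) Suc.prems] in simp)
  then show ?case
    using frechet_derivative_cong_open(2)[OF assms(1) Suc.prems] by auto
qed

lemma Ck_on_SucD:
  "Ck_on (Suc k) S f \<Longrightarrow> x \<in> S \<Longrightarrow> (f has_derivative frechet_derivative f (at x)) (at x)"
  by (simp add: frechet_derivative_works)

text \<open>Lets an induction step work with an explicit derivative \<open>f'\<close> in place of
  the chosen \<open>frechet_derivative\<close>; most closure rules below rest on it.\<close>

lemma Ck_on_SucI:
  assumes "open S" "\<And>x. x \<in> S \<Longrightarrow> (f has_derivative f' x) (at x)"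
    "\<And>v. Ck_on k S (\<lambda>x. f' x v)"
  shows "Ck_on (Suc k) S f"
proof -
  have "Ck_on k S (\<lambda>x. frechet_derivative f (at x) v)" for v
  proof (subst Ck_on_cong[OF assms(1)])
    show "frechet_derivative f (at x) v = f' x v" if "x \<in> S" for x
      using frechet_derivative_at[OF assms(2)[OF that]] by metis
  qed (rule assms(3))
  then show ?thesis using assms(2) by (auto simp: differentiable_def)
qed

lemma Ck_on_Suc_imp: "Ck_on (Suc k) S f \<Longrightarrow> Ck_on k S f"
proof (induction k arbitrary: f)
  case 0
  then show ?case
    by (auto simp: differentiable_imp_continuous_within continuous_at_imp_continuous_on)
next
  case (Suc k)
  then show ?case by auto
qed

lemma Ck_on_le: "Ck_on k S f \<Longrightarrow> l \<le> k \<Longrightarrow> Ck_on l S f"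
  using Ck_on_Suc_imp by (induction k) (auto simp: le_Suc_eq simp del: Ck_on.simps)

lemma Ck_on_imp_continuous_on: "Ck_on k S f \<Longrightarrow> continuous_on S f"
  using Ck_on_le[of k S f 0] by simp

lemma Ck_on_subset: "Ck_on k S f \<Longrightarrow> T \<subseteq> S \<Longrightarrow> Ck_on k T f"
  by (induction k arbitrary: f) (auto intro: continuous_on_subset)

text \<open>Permits gluing: zero extensions, bumps and quotients on the surface are given by
  different formulas near different points.\<close>

lemma Ck_on_local:
  assumes "\<And>x. x \<in> S \<Longrightarrow> \<exists>T. open T \<and> x \<in> T \<and> Ck_on k T f"
  shows "Ck_on k S f"
  using assms
proof (induction k arbitrary: f)
  case 0
  then have "isCont f x" if "x \<in> S" for x
    using that by (force simp: continuous_on_eq_continuous_at)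
  then show ?case by (simp add: continuous_at_imp_continuous_on)
next
  case (Suc k)
  have "Ck_on k S (\<lambda>x. frechet_derivative f (at x) v)" for v
    by (rule Suc.IH) (use Suc.prems in fastforce)
  then show ?case using Suc.prems by fastforce
qed

lemma has_vector_derivative_along_line:
  assumes "(u has_derivative D) (at (x + t *\<^sub>R v))"
  shows "((\<lambda>t. u (x + t *\<^sub>R v)) has_vector_derivative D v) (at t)"
proof -
  have "((\<lambda>t. x + t *\<^sub>R v) has_vector_derivative v) (at t)"
    by (auto intro!: derivative_eq_intros)
  from vector_derivative_diff_chain_within[OF this, of u D] assms
  show ?thesis by (simp add: o_def has_derivative_at_withinI)
qed

section \<open>Closure of the classes C^k under algebra and composition\<close>

lemma Ck_on_const: "Ck_on k S (\<lambda>x. c)"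
  by (induction k arbitrary: c) auto

lemma Ck_on_bounded_linear:
  assumes "bounded_linear f" "open S"
  shows "Ck_on k S f"
proof (cases k)
  case 0
  then show ?thesis using assms linear_continuous_on by auto
next
  case (Suc l)
  show ?thesis unfolding Suc
    by (rule Ck_on_SucI[OF assms(2), of _ "\<lambda>_. f"])
      (auto intro: bounded_linear_imp_has_derivative assms Ck_on_const)
qed

lemma Ck_on_ident: "open S \<Longrightarrow> Ck_on k S (\<lambda>x. x)"
  by (rule Ck_on_bounded_linear[OF bounded_linear_ident])

lemma Ck_on_add:
  assumes "open S" "Ck_on k S f" "Ck_on k S g"
  shows "Ck_on k S (\<lambda>x. f x + g x)"
  using assms(2,3)
proof (induction k arbitrary: f g)
  case 0
  then show ?case by (auto intro: continuous_intros)
next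
  case (Suc k)
  show ?case
  proof (rule Ck_on_SucI[OF assms(1)])
    show "((\<lambda>x. f x + g x) has_derivative
        (\<lambda>v. frechet_derivative f (at x) v + frechet_derivative g (at x) v)) (at x)"
      if "x \<in> S" for x
      using Ck_on_SucD[OF Suc.prems(1) that] Ck_on_SucD[OF Suc.prems(2) that]
      by (rule has_derivative_add)
    show "Ck_on k S (\<lambda>x. frechet_derivative f (at x) v + frechet_derivative g (at x) v)" for v
      by (rule Suc.IH) (use Suc.prems in auto)
  qed
qed

lemma Ck_on_sum:
  assumes "open S" "\<And>i. i \<in> I \<Longrightarrow> Ck_on k S (f i)"
  shows "Ck_on k S (\<lambda>x. \<Sum>i\<in>I. f i x)"
  using assms by (induction I rule: infinite_finite_induct) (auto intro: Ck_on_const Ck_on_add)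

text \<open>One Leibniz rule serves products, scalar multiples, inner products and cross
  products.\<close>

lemma Ck_on_bilinear:
  assumes "bounded_bilinear bop" "open S" "Ck_on k S f" "Ck_on k S g"
  shows "Ck_on k S (\<lambda>x. bop (f x) (g x))"
  using assms(3,4)
proof (induction k arbitrary: f g)
  case 0
  then show ?case using bounded_bilinear.continuous_on[OF assms(1)] by auto
next
  case (Suc k)
  show ?case
  proof (rule Ck_on_SucI[OF assms(2)])
    show "((\<lambda>x. bop (f x) (g x)) has_derivative
        (\<lambda>v. bop (f x) (frechet_derivative g (at x) v) + bop (frechet_derivative f (at x) v) (g x))) (at x)"
      if "x \<in> S" for x
      using bounded_bilinear.FDERIV[OF assms(1) Ck_on_SucD[OF Suc.prems(1) that] Ck_on_SucD[OF Suc.prems(2) that]] .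
    show "Ck_on k S (\<lambda>x. bop (f x) (frechet_derivative g (at x) v) + bop (frechet_derivative f (at x) v) (g x))" for v
      by (intro Ck_on_add Suc.IH assms(2)) (use Suc.prems Ck_on_Suc_imp in auto)
  qed
qed

lemmas Ck_on_mult = Ck_on_bilinear[OF bounded_bilinear_mult]
lemmas Ck_on_scaleR = Ck_on_bilinear[OF bounded_bilinear_scaleR]
lemmas Ck_on_inner = Ck_on_bilinear[OF bounded_bilinear_inner]

lemma Ck_on_diff:
  assumes "open S" "Ck_on k S f" "Ck_on k S g"
  shows "Ck_on k S (\<lambda>x. f x - g x)"
  using Ck_on_add[OF assms(1,2) Ck_on_scaleR[OF assms(1) Ck_on_const assms(3), of "-1"]] by simp

lemma bounded_bilinear_cross3: "bounded_bilinear cross3"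
  using bilinear_conv_bounded_bilinear bilinear_cross by auto

lemmas Ck_on_cross3 = Ck_on_bilinear[OF bounded_bilinear_cross3]

text \<open>The chain rule applies the derivative of \<open>f\<close> to a direction that moves with
  x. Expanding this direction in \<open>Basis\<close> leaves derivatives of \<open>f\<close> in
  fixed directions, to which the induction hypothesis applies; hence the Euclidean middle
  space.\<close>

lemma Ck_on_compose:
  fixes g :: "'a::real_normed_vector \<Rightarrow> 'b::euclidean_space"
    and f :: "'b \<Rightarrow> 'c::real_normed_vector"
  assumes "open S" "open T" "g ` S \<subseteq> T" "Ck_on k S g" "Ck_on k T f"
  shows "Ck_on k S (\<lambda>x. f (g x))"
  using assms(4,5)
proof (induction k arbitrary: f)
  case 0
  then show ?case using assms(3) by (auto intro: continuous_on_compose2)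
next
  case (Suc k)
  have gk: "Ck_on k S g" using Suc.prems Ck_on_Suc_imp by blast
  show ?case
  proof (rule Ck_on_SucI[OF assms(1)])
    fix x assume x: "x \<in> S"
    let ?F = "frechet_derivative f (at (g x))" and ?G = "frechet_derivative g (at x)"
    have F: "(f has_derivative ?F) (at (g x))"
      using Ck_on_SucD[OF Suc.prems(2)] x assms(3) by blast
    have "((\<lambda>x. f (g x)) has_derivative (\<lambda>v. ?F (?G v))) (at x)"
      by (rule has_derivative_compose[OF Ck_on_SucD[OF Suc.prems(1) x] F])
    moreover have "?F (?G v) = (\<Sum>b\<in>Basis. (?G v \<bullet> b) *\<^sub>R ?F b)" for v
    proof -
      have lin: "linear ?F" using F has_derivative_linear by blast
      have "?F (?G v) = ?F (\<Sum>b\<in>Basis. (?G v \<bullet> b) *\<^sub>R b)" by (simp add: euclidean_representation)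
      then show ?thesis by (simp only: linear_sum[OF lin] linear_cmul[OF lin])
    qed
    ultimately show "((\<lambda>x. f (g x)) has_derivative (\<lambda>v. \<Sum>b\<in>Basis. (?G v \<bullet> b) *\<^sub>R ?F b)) (at x)"
      by simp
  next
    fix v
    show "Ck_on k S (\<lambda>x. \<Sum>b\<in>Basis. (frechet_derivative g (at x) v \<bullet> b) *\<^sub>R frechet_derivative f (at (g x)) b)"
    proof (intro Ck_on_sum Ck_on_scaleR Ck_on_inner Ck_on_const assms(1))
      show "Ck_on k S (\<lambda>x. frechet_derivative g (at x) v)" using Suc.prems(1) by simp
      show "Ck_on k S (\<lambda>x. frechet_derivative f (at (g x)) b)" if "b \<in> Basis" for b
        by (rule Suc.IH[OF gk]) (use Suc.prems(2) in simp)
    qed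
  qed
qed

text \<open>Induction on k for all members at once. The last assumption only asks that each
  derivative be built from members by operations preserving C^k, so powers, flat exponentials and
  Bessel functions become smooth without any formula for higher derivatives.\<close>

lemma Ck_on_real_family:
  fixes f :: "'i \<Rightarrow> real \<Rightarrow> real"
  assumes "open S" "\<And>i x. x \<in> S \<Longrightarrow> (f i has_real_derivative f' i x) (at x)"
    and "\<And>k i. (\<And>j. Ck_on k S (f j)) \<Longrightarrow> Ck_on k S (f' i)"
  shows "Ck_on k S (f i)"
proof (induction k arbitrary: i)
  case 0
  have "isCont (f i) x" if "x \<in> S" for x using assms(2)[OF that] DERIV_isCont by blast
  then show ?case by (simp add: continuous_at_imp_continuous_on)
next
  case (Suc k)
  show ?case
  proof (rule Ck_on_SucI[OF assms(1)])
    show "(f i has_derivative (\<lambda>v. f' i x * v)) (at x)" if "x \<in> S" for x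
      using assms(2)[OF that] by (simp add: has_field_derivative_def)
    show "Ck_on k S (\<lambda>x. f' i x * v)" for v
      by (intro Ck_on_mult Ck_on_const assms(1) assms(3) Suc.IH)
  qed
qed

lemma Ck_on_powr: "Ck_on k {0<..} (\<lambda>t::real. t powr a)"
proof (rule Ck_on_real_family[where f="\<lambda>a t. t powr a" and f'="\<lambda>a t. a * t powr (a - 1)"])
  show "((\<lambda>t. t powr a) has_real_derivative a * x powr (a - 1)) (at x)" if "x \<in> {0<..}" for a x
    using that by (auto intro!: has_real_derivative_powr)
qed (auto intro!: Ck_on_mult Ck_on_const)

lemma Ck_on_inverse_pos:
  fixes f :: "'a::real_normed_vector \<Rightarrow> real"
  assumes "open S" "Ck_on k S f" "\<And>x. x \<in> S \<Longrightarrow> 0 < f x"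
  shows "Ck_on k S (\<lambda>x. 1 / f x)"
proof -
  have "Ck_on k S (\<lambda>x. f x powr -1)"
    using assms by (intro Ck_on_compose[OF _ _ _ _ Ck_on_powr]) auto
  then show ?thesis
    by (subst Ck_on_cong[OF assms(1), where g="\<lambda>x. f x powr -1"]) (use assms(3) in \<open>auto simp: powr_minus_divide abs_of_pos\<close>)
qed

text \<open>Closing the family under differentiation makes \<open>exp (-1/t)\<close> smooth at 0.\<close>

definition flat_exp :: "nat \<Rightarrow> real \<Rightarrow> real" where
  "flat_exp n t = (if 0 < t then exp (- (1 / t)) / t ^ n else 0)"

lemma flat_exp_tendsto: "(flat_exp n \<longlongrightarrow> 0) (at 0)"
proof -
  have "((\<lambda>t. (1/t) ^ n / exp (1/t)) \<longlongrightarrow> 0) (at_right (0::real))"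
    by (rule filterlim_compose[OF tendsto_power_div_exp_0])
      (simp add: filterlim_inverse_at_top_right divide_inverse)
  then have "(flat_exp n \<longlongrightarrow> 0) (at_right 0)"
    by (rule Lim_transform_eventually)
      (auto simp: eventually_at_filter flat_exp_def exp_minus field_simps)
  moreover have "(flat_exp n \<longlongrightarrow> 0) (at_left 0)"
    by (rule Lim_transform_eventually[OF tendsto_const])
      (auto simp: eventually_at_filter flat_exp_def)
  ultimately show ?thesis by (simp add: filterlim_split_at)
qed

lemma flat_exp_deriv:
  "(flat_exp n has_real_derivative flat_exp (n + 2) t - of_nat n * flat_exp (n + 1) t) (at t)"
proof -
  consider "t < 0" | "t = 0" | "t > 0" by linarith
  then show ?thesis
  proof cases
    case 1
    have "((\<lambda>_. 0) has_real_derivative 0) (at t)" by simp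
    then have "(flat_exp n has_real_derivative 0) (at t)"
      by (rule has_field_derivative_transform_within_open[where S="{..<0}"]) (use 1 in \<open>auto simp: flat_exp_def\<close>)
    then show ?thesis using 1 by (simp add: flat_exp_def)
  next
    case 2
    \<comment> \<open>The difference quotient at 0 is itself a member of the family,
      \<open>flat_exp (Suc n) h\<close>.\<close>
    have "((\<lambda>h. (flat_exp n (0 + h) - flat_exp n 0) / h) \<longlongrightarrow> 0) (at 0)"
      by (rule Lim_transform_eventually[OF flat_exp_tendsto[of "Suc n"]])
        (simp add: flat_exp_def)
    then have "(flat_exp n has_real_derivative 0) (at 0)"
      by (simp only: DERIV_def)
    then show ?thesis using 2 by (simp add: flat_exp_def)
  next
    case 3
    \<comment> \<open>The product rule for exp(-r) r^n with r = 1/t, whose derivative is -r^2. For n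
      = 0 the truncated exponent \<open>n - 1\<close> is harmless because of the factor n.\<close>
    have *: "exp (- r) * (- (- r\<^sup>2)) * r ^ n + exp (- r) * (of_nat n * r ^ (n - 1) * (- r\<^sup>2))
        = exp (- r) * r ^ (n + 2) - of_nat n * (exp (- r) * r ^ (n + 1))" for r :: real
      by (cases n) (simp_all add: algebra_simps power2_eq_square)
    have inv: "(inverse has_real_derivative - (inverse t)\<^sup>2) (at t)"
      using DERIV_inverse[of t UNIV] 3 by (simp add: numeral_2_eq_2)
    have "((\<lambda>t. exp (- inverse t)) has_real_derivative exp (- inverse t) * (- (- (inverse t)\<^sup>2))) (at t)"
      by (rule DERIV_chain2[where f=exp, OF DERIV_exp DERIV_minus[OF inv]])
    moreover have "((\<lambda>t. inverse t ^ n) has_real_derivative of_nat n * inverse t ^ (n - 1) * (- (inverse t)\<^sup>2)) (at t)"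
      using DERIV_power[OF inv, of n] by (simp add: algebra_simps)
    ultimately have "((\<lambda>t. exp (- inverse t) * inverse t ^ n) has_real_derivative
        exp (- inverse t) * (- (- (inverse t)\<^sup>2)) * inverse t ^ n +
        exp (- inverse t) * (of_nat n * inverse t ^ (n - 1) * (- (inverse t)\<^sup>2))) (at t)"
      using DERIV_mult by (fastforce simp: algebra_simps)
    then have "((\<lambda>t. exp (- inverse t) * inverse t ^ n) has_real_derivative
        flat_exp (n + 2) t - of_nat n * flat_exp (n + 1) t) (at t)"
      unfolding * using 3 by (simp add: flat_exp_def divide_inverse flip: power_inverse)
    then show ?thesis
      by (rule has_field_derivative_transform_within_open[where S="{0<..}"]) (use 3 in \<open>auto simp: flat_exp_def divide_inverse power_inverse\<close>)
  qed
qed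

lemma Ck_on_flat_exp: "Ck_on k UNIV (flat_exp n)"
proof (rule Ck_on_real_family[where f="flat_exp"])
  show "(flat_exp i has_real_derivative flat_exp (i + 2) x - of_nat i * flat_exp (i + 1) x) (at x)" for i x
    by (rule flat_exp_deriv)
qed (auto intro!: Ck_on_diff Ck_on_mult Ck_on_const)

text \<open>The argument is positive exactly on the open ball, and as a polynomial in y it is smooth
  at the centre too.\<close>

definition bump :: "'a::euclidean_space \<Rightarrow> real \<Rightarrow> 'a \<Rightarrow> real" where
  "bump x e y = flat_exp 0 (e\<^sup>2 - (y - x) \<bullet> (y - x))"

lemma Ck_on_bump: "Ck_on k UNIV (bump x e)"
  unfolding bump_def
  by (rule Ck_on_compose[OF _ _ _ _ Ck_on_flat_exp])
    (auto intro!: Ck_on_diff Ck_on_inner Ck_on_const Ck_on_ident)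

lemma bump_nonneg: "0 \<le> bump x e y"
  by (simp add: bump_def flat_exp_def)

lemma bump_pos_iff: "0 < e \<Longrightarrow> 0 < bump x e y \<longleftrightarrow> y \<in> ball x e"
proof -
  assume "0 < e"
  then have "norm (y - x) < e \<longleftrightarrow> (norm (y - x))\<^sup>2 < e\<^sup>2"
    using power_strict_mono[of "norm (y - x)" e 2] power2_less_imp_less[of "norm (y - x)" e] by auto
  then show ?thesis
    by (simp add: bump_def flat_exp_def dist_norm norm_minus_commute flip: power2_norm_eq_inner)
qed

lemma bump_eq_0: "0 < e \<Longrightarrow> y \<notin> ball x e \<Longrightarrow> bump x e y = 0"
  using bump_pos_iff[of e x y] bump_nonneg[of x e y] by linarith

section \<open>Bessel functions and the Dirichlet problem on the disc\<close>

text \<open>\<open>bes k\<close> is the entire function with \<open>J\<^sub>k(x) = (x/2)\<^sup>k bes k (x\<^sup>2/4)\<close>.\<close>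

definition bes_coeff :: "nat \<Rightarrow> nat \<Rightarrow> real" where
  "bes_coeff k n = (-1) ^ n / (fact n * fact (n + k))"

definition bes :: "nat \<Rightarrow> real \<Rightarrow> real" where
  "bes k t = (\<Sum>n. bes_coeff k n * t ^ n)"

lemma summable_bes: "summable (\<lambda>n. bes_coeff k n * t ^ n)"
proof (rule summable_comparison_test)
  show "summable (\<lambda>n. inverse (fact n) * \<bar>t\<bar> ^ n)" by (rule summable_exp)
  have "1 \<le> (fact (n + k) :: real)" for n by (rule fact_ge_1)
  then have "\<bar>t\<bar> ^ n / (fact n * fact (n + k)) \<le> \<bar>t\<bar> ^ n / fact n" for n
    by (intro divide_left_mono) (auto simp: mult_le_cancel_left1)
  then show "\<exists>N. \<forall>n\<ge>N. norm (bes_coeff k n * t ^ n) \<le> inverse (fact n) * \<bar>t\<bar> ^ n"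
    by (auto simp: bes_coeff_def abs_mult power_abs field_simps)
qed

lemma bes_0: "bes 0 0 = 1"
  using powser_zero[of "bes_coeff 0"] by (simp add: bes_def bes_coeff_def)

text \<open>The classical recurrence (x^(-k) J_k)' = - x^(-k) J_(k+1) in the variable t = x^2/4. It
  closes the family under differentiation, as \<open>Ck_on_real_family\<close> requires.\<close>

lemma bes_deriv: "(bes k has_real_derivative - bes (Suc k) t) (at t)"
proof -
  have "diffs (bes_coeff k) n = - bes_coeff (Suc k) n" for n
    by (simp add: diffs_def bes_coeff_def field_simps del: of_nat_Suc)
  then have "((\<lambda>t. \<Sum>n. bes_coeff k n * t ^ n) has_real_derivative (\<Sum>n. - bes_coeff (Suc k) n * t ^ n)) (at t)"
    using termdiffs_strong_converges_everywhere[of "bes_coeff k" t, OF summable_bes] by simp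
  moreover have "(\<Sum>n. - bes_coeff (Suc k) n * t ^ n) = - bes (Suc k) t"
    unfolding bes_def using suminf_minus[OF summable_bes[of "Suc k" t]] by simp
  ultimately show ?thesis unfolding bes_def by (simp cong: bes_def)
qed

lemma Ck_on_bes: "Ck_on m UNIV (bes k)"
proof (rule Ck_on_real_family[OF open_UNIV bes_deriv])
  show "Ck_on k UNIV (\<lambda>x. - bes (Suc i) x)" if "\<And>j. Ck_on k UNIV (bes j)" for k i
    using Ck_on_mult[OF open_UNIV Ck_on_const[where c="-1"] that] by simp
qed

text \<open>Bessel's equation t y'' + y' + y = 0 for y = \<open>bes 0\<close>, since y' = -
  \<open>bes 1\<close> and y'' = \<open>bes 2\<close>. It follows by comparing coefficients; those
  of \<open>bes 0\<close> and \<open>bes 1\<close> agree at n = 0, which leaves a factor t.\<close>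

lemma bes_ode: "bes 0 t = bes 1 t - t * bes 2 t"
proof -
  let ?d = "\<lambda>n. bes_coeff 0 n * t ^ n - bes_coeff 1 n * t ^ n"
  have "?d (Suc n) = - (t * (bes_coeff 2 n * t ^ n))" for n
  proof -
    have "bes_coeff 0 (Suc n) - bes_coeff 1 (Suc n) = - bes_coeff 2 n"
      by (simp add: bes_coeff_def divide_simps del: of_nat_Suc) (simp add: algebra_simps)
    then have "?d (Suc n) = - bes_coeff 2 n * t ^ Suc n"
      by (metis left_diff_distrib)
    then show ?thesis by simp
  qed
  then have "(\<Sum>n. ?d (Suc n)) = - (t * bes 2 t)"
    unfolding bes_def using summable_bes[of 2 t]
    by (simp add: suminf_minus suminf_mult summable_mult)
  moreover have "summable ?d" by (intro summable_diff summable_bes)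
  moreover have "?d 0 = 0" by (simp add: bes_coeff_def)
  ultimately have "(\<Sum>n. ?d n) = - (t * bes 2 t)"
    using suminf_split_head[of ?d] by simp
  then show ?thesis
    unfolding bes_def using suminf_diff[OF summable_bes[of 0 t] summable_bes[of 1 t]] by simp
qed

text \<open>Consecutive terms have absolute ratio t / ((n+1)(n+1+k)), so
  \<open>t \<le> Suc k\<close> makes the alternating series decrease from its very first
  term.\<close>

lemma bes_Leibniz:
  fixes t :: real
  assumes "0 \<le> t" "t \<le> Suc k"
  shows "(\<Sum>n<2*m. bes_coeff k n * t ^ n) \<le> bes k t"
    and "bes k t \<le> (\<Sum>n<2*m+1. bes_coeff k n * t ^ n)"
proof -
  let ?a = "\<lambda>n. t ^ n / (fact n * fact (n + k))"
  have eq: "(-1) ^ n * ?a n = bes_coeff k n * t ^ n" for n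
    by (simp add: bes_coeff_def)
  have "norm (bes_coeff k n * t ^ n) = ?a n" for n
    using assms by (simp add: bes_coeff_def abs_mult power_abs)
  then have lim: "?a \<longlonglongrightarrow> 0"
    using tendsto_norm_zero[OF summable_LIMSEQ_zero[OF summable_bes[of k t]]] by simp
  have pos: "0 \<le> ?a n" for n using assms by simp
  have mono: "?a (Suc n) \<le> ?a n" for n
  proof -
    have "t \<le> 1 * real (Suc n + k)" using assms by simp
    also have "\<dots> \<le> real (Suc n) * real (Suc n + k)" by (intro mult_right_mono) auto
    finally have "t / (real (Suc n) * real (Suc n + k)) \<le> 1" by simp
    moreover have "?a (Suc n) = ?a n * (t / (real (Suc n) * real (Suc n + k)))"
      by (simp add: field_simps del: of_nat_Suc of_nat_add)
    ultimately show ?thesis using pos[of n] mult_left_le by metis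
  qed
  show "(\<Sum>n<2*m. bes_coeff k n * t ^ n) \<le> bes k t"
    using summable_Leibniz'(2)[OF lim pos mono, of m] by (simp only: eq bes_def)
  show "bes k t \<le> (\<Sum>n<2*m+1. bes_coeff k n * t ^ n)"
    using summable_Leibniz'(4)[OF lim pos mono, of m] by (simp only: eq bes_def)
qed

text \<open>Two terms of the series suffice: 1/2 - t/6. This is the convexity of the radial
  profile.\<close>

lemma bes_2_nonneg: "0 \<le> t \<Longrightarrow> t \<le> 2 \<Longrightarrow> 0 \<le> bes 2 t"
  using bes_Leibniz(1)[of t 2 1] by (simp add: bes_coeff_def fact_numeral numeral_2_eq_2)

text \<open>The point 2 is outside the range of \<open>bes_Leibniz\<close> for k = 0, so the value
  is taken from Bessel's equation: \<open>bes 1 2 - 2 * bes 2 2\<close> is at most 1/3 - 43/90 =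
  -13/90.\<close>

lemma bes_0_2_neg: "bes 0 2 < 0"
proof -
  have "bes 1 2 \<le> 1 / 3"
    using bes_Leibniz(2)[of 2 1 1] by (simp add: bes_coeff_def fact_numeral eval_nat_numeral)
  moreover have "43 / 180 \<le> bes 2 2"
    using bes_Leibniz(1)[of 2 2 2] by (simp add: bes_coeff_def fact_numeral eval_nat_numeral)
  ultimately show ?thesis using bes_ode[of 2] by simp
qed

text \<open>T is the minimum of the compact zero set in [0, 2]. A nonpositive value before T would
  force an earlier zero because \<open>bes 0 0 = 1\<close>. In terms of the first zero j of J_0, T
  is j^2/4.\<close>

lemma bes_0_first_zero:
  obtains T where "0 < T" "T \<le> 2" "bes 0 T = 0" "\<And>t. 0 \<le> t \<Longrightarrow> t < T \<Longrightarrow> 0 < bes 0 t"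
proof -
  have cont: "continuous_on A (bes 0)" for A
    using Ck_on_imp_continuous_on[OF Ck_on_bes] continuous_on_subset by blast
  have zero: "\<exists>t\<ge>0. t \<le> b \<and> bes 0 t = 0" if "0 \<le> b" "bes 0 b \<le> 0" for b
    using IVT2'[of "bes 0" b 0 0] that cont by (auto simp: bes_0)
  let ?Z = "{0..2} \<inter> bes 0 -` {0}"
  have "closed ?Z" using cont by (intro continuous_closed_preimage) auto
  then have "compact ?Z" using compact_Int_closed[of "{0..2}" ?Z] by (simp add: Int_absorb1 flip: Int_assoc)
  moreover have "?Z \<noteq> {}" using zero[of 2] bes_0_2_neg by fastforce
  ultimately obtain T where T: "T \<in> ?Z" "\<And>t. t \<in> ?Z \<Longrightarrow> T \<le> t"
    using compact_attains_inf[of ?Z] by meson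
  show ?thesis
  proof
    show "0 < T" using T bes_0 by (cases "T = 0") auto
    show "T \<le> 2" "bes 0 T = 0" using T by auto
    show "0 < bes 0 t" if t: "0 \<le> t" "t < T" for t
    proof (rule ccontr)
      assume "\<not> 0 < bes 0 t"
      then obtain s where "0 \<le> s" "s \<le> t" "bes 0 s = 0" using zero[of t] t by auto
      then have "s \<in> ?Z" using t T(1) by auto
      then show False using T(2)[of s] \<open>s \<le> t\<close> t by auto
    qed
  qed
qed

section \<open>Radial eigenfunctions and the first eigenvalue of the disc\<close>

lemma pd_line:
  assumes "u differentiable (at (x + t *\<^sub>R axis i 1))"
  shows "((\<lambda>t. u (x + t *\<^sub>R axis i 1)) has_vector_derivative pd i u (x + t *\<^sub>R axis i 1)) (at t)"
  unfolding pd_def by (rule has_vector_derivative_along_line) (use assms frechet_derivative_works in blast)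

lemma pd_eqI: "(u has_derivative D) (at x) \<Longrightarrow> pd i u x = D (axis i 1)"
  unfolding pd_def using frechet_derivative_at by metis

lemma Ck_on_pd: "Ck_on (Suc k) S u \<Longrightarrow> Ck_on k S (pd i u)"
  unfolding pd_def[abs_def] by simp

text \<open>For \<open>l \<ge> 0\<close> this is J_0(sqrt l |x|); written in
  \<open>x \<bullet> x\<close> it is smooth at the origin.\<close>

definition radial_bes :: "real \<Rightarrow> real^2 \<Rightarrow> real" where
  "radial_bes l x = bes 0 (l / 4 * (x \<bullet> x))"

lemma Ck_on_radial_bes: "Ck_on k S (radial_bes l)"
proof -
  have "Ck_on k UNIV (radial_bes l)"
    unfolding radial_bes_def[abs_def]
    by (rule Ck_on_compose[OF _ _ _ _ Ck_on_bes]) (intro Ck_on_mult Ck_on_inner Ck_on_const Ck_on_ident | simp)+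
  then show ?thesis using Ck_on_subset by blast
qed

text \<open>The plane Laplacian of y(l |x|^2 / 4) is l (t y'' + y') at t = l |x|^2 / 4, and Bessel's
  equation turns this into -l y.\<close>

lemma laplacian_radial_bes: "laplacian (radial_bes l) x = - l * radial_bes l x"
proof -
  have D: "((\<lambda>x. bes k (l / 4 * (x \<bullet> x))) has_derivative (\<lambda>v. - bes (Suc k) (l / 4 * (x \<bullet> x)) * (l / 2 * (x \<bullet> v)))) (at x)"
    for k and x :: "real^2"
  proof -
    have "((\<lambda>x. l / 4 * (x \<bullet> x)) has_derivative (\<lambda>v. l / 2 * (x \<bullet> v))) (at x)"
      by (auto intro!: derivative_eq_intros simp: inner_commute)
    from has_derivative_compose[OF this bes_deriv[unfolded has_field_derivative_def]]
    show ?thesis by simp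
  qed
  have 1: "pd i (radial_bes l) = (\<lambda>x. - (bes 1 (l / 4 * (x \<bullet> x)) * (l / 2 * x $ i)))" for i
    unfolding radial_bes_def[abs_def] by (rule ext, subst pd_eqI[OF D]) (simp add: inner_axis)
  have pd2: "pd i (pd i (radial_bes l)) x = bes 2 (l / 4 * (x \<bullet> x)) * (l / 2 * x $ i)\<^sup>2 - bes 1 (l / 4 * (x \<bullet> x)) * (l / 2)" for i
  proof -
    have "((\<lambda>x::real^2. l / 2 * x $ i) has_derivative (\<lambda>v. l / 2 * v $ i)) (at x)"
      by (intro bounded_linear_imp_has_derivative bounded_linear_const_mult bounded_linear_vec_nth)
    note d = has_derivative_minus[OF has_derivative_mult[OF D[of 1 x] this]]
    have "axis i (1::real) $ i = 1" by (simp add: axis_def)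
    then show ?thesis unfolding 1 pd_eqI[OF d]
      by (simp add: inner_axis power2_eq_square numeral_2_eq_2 algebra_simps)
  qed
  define s where "s = l / 4 * (x \<bullet> x)"
  have "x \<bullet> x = (x $ 1)\<^sup>2 + (x $ 2)\<^sup>2" by (simp add: inner_vec_def sum_2 power2_eq_square)
  then have s: "l\<^sup>2 / 4 * ((x $ 1)\<^sup>2 + (x $ 2)\<^sup>2) = l * s" by (simp add: s_def power2_eq_square)
  have "laplacian (radial_bes l) x = bes 2 s * (l\<^sup>2 / 4 * ((x $ 1)\<^sup>2 + (x $ 2)\<^sup>2)) - bes 1 s * l"
    unfolding laplacian_def pd2 sum_2 s_def[symmetric] by (simp add: algebra_simps power2_eq_square)
  also have "\<dots> = - l * bes 0 s" unfolding s bes_ode[of s] by (simp add: algebra_simps)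
  finally show ?thesis by (simp add: radial_bes_def s_def)
qed

text \<open>The derivative vanishes at 0. If D were positive, it would be positive just to the right
  of 0, and f would rise above its maximum.\<close>

lemma second_derivative_local_max:
  fixes f f' :: "real \<Rightarrow> real"
  assumes "0 < d" "\<And>t. \<bar>t\<bar> < d \<Longrightarrow> (f has_real_derivative f' t) (at t)"
    "(f' has_real_derivative D) (at 0)" "\<And>t. \<bar>t\<bar> < d \<Longrightarrow> f t \<le> f 0"
  shows "D \<le> 0"
proof (rule ccontr)
  assume "\<not> D \<le> 0"
  then obtain e where e: "0 < e" "\<And>h. 0 < h \<Longrightarrow> h < e \<Longrightarrow> f' 0 < f' h"
    using has_real_derivative_pos_inc_right[OF assms(3)] by force
  have "f' 0 = 0"
    using DERIV_local_max[OF assms(2)[of 0] assms(1)] assms(1,4) by simp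
  define b where "b = min d e / 2"
  have b: "0 < b" "b < d" "b < e" using assms(1) e by (auto simp: b_def)
  have "\<exists>y. DERIV f x :> y \<and> 0 < y" if "0 < x" "x < b" for x
    using assms(2)[of x] e(2)[of x] that b \<open>f' 0 = 0\<close> by auto
  moreover have "continuous_on {0..b} f"
    using b by (intro continuous_at_imp_continuous_on) (auto intro!: DERIV_isCont[OF assms(2)])
  ultimately have "f 0 < f b"
    using DERIV_pos_imp_increasing_open[OF b(1), of f] by blast
  then show False using assms(4)[of b] b by auto
qed

lemma dirichlet_eigenvalue_disc:
  assumes "0 < r" "bes 0 T = 0"
  shows "dirichlet_eigenvalue (ball 0 r) (4 * T / r\<^sup>2)"
  unfolding dirichlet_eigenvalue_def
proof (intro exI conjI ballI)
  \<comment> \<open>This value of \<open>l\<close> places the zero \<open>T\<close> of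
    \<open>bes 0\<close> on the boundary circle: \<open>l / 4 * r\<^sup>2 = T\<close>.\<close>
  let ?u = "radial_bes (4 * T / r\<^sup>2)"
  show "Ck_on 2 (ball 0 r) ?u" by (rule Ck_on_radial_bes)
  show "continuous_on (closure (ball 0 r)) ?u"
    using Ck_on_radial_bes Ck_on_imp_continuous_on by blast
  show "?u x = 0" if "x \<in> frontier (ball 0 r)" for x
  proof -
    have "x \<bullet> x = r\<^sup>2" using that assms(1) by (auto simp: dot_square_norm)
    then show ?thesis using assms by (simp add: radial_bes_def)
  qed
  show "\<exists>x\<in>ball 0 r. ?u x \<noteq> 0"
    using assms(1) by (intro bexI[where x=0]) (auto simp: radial_bes_def bes_0)
  show "- laplacian ?u x = 4 * T / r\<^sup>2 * ?u x" for x by (simp add: laplacian_radial_bes)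
qed

text \<open>Maximum principle for the quotient of the eigenfunction by a slightly slower oscillating
  radial Bessel function, which is positive up to the boundary.\<close>

lemma dirichlet_eigenvalue_disc_ge:
  assumes "0 < r" "\<And>t. 0 \<le> t \<Longrightarrow> t < T \<Longrightarrow> 0 < bes 0 t" "0 < T"
    and "dirichlet_eigenvalue (ball 0 r) \<mu>"
  shows "4 * T / r\<^sup>2 \<le> \<mu>"
proof (rule ccontr)
  assume "\<not> 4 * T / r\<^sup>2 \<le> \<mu>"
  then have "max \<mu> 0 < 4 * T / r\<^sup>2" using assms(1,3) by auto
  \<comment> \<open>The upper bound makes the comparison function positive on the closed disc,
    \<open>l > \<mu>\<close> yields the final contradiction, and \<open>l > 0\<close> keeps the
    argument of \<open>bes 0\<close> nonnegative.\<close>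
  then obtain l where l: "max \<mu> 0 < l" "l < 4 * T / r\<^sup>2" using dense by blast
  obtain u where u: "Ck_on 2 (ball 0 r) u" "continuous_on (cball 0 r) u"
      "\<forall>x\<in>sphere 0 r. u x = 0" "\<exists>x\<in>ball 0 r. u x \<noteq> 0"
      "\<forall>x\<in>ball 0 r. - laplacian u x = \<mu> * u x"
    using assms(4,1) unfolding dirichlet_eigenvalue_def by (metis closure_ball frontier_ball)
  let ?h = "radial_bes l"
  have h: "0 < ?h x" if "x \<in> cball 0 r" for x
    unfolding radial_bes_def
  proof (rule assms(2))
    have "x \<bullet> x \<le> r\<^sup>2" using that by (simp add: dot_square_norm power_mono)
    then have "l / 4 * (x \<bullet> x) \<le> l / 4 * r\<^sup>2" using l by (intro mult_left_mono) auto
    also have "\<dots> < T" using l assms(1) by (simp add: field_simps)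
    finally show "l / 4 * (x \<bullet> x) < T" .
    show "0 \<le> l / 4 * (x \<bullet> x)" using l by simp
  qed
  obtain x1 where x1: "x1 \<in> ball 0 r" "u x1 \<noteq> 0" using u(4) by blast
  \<comment> \<open>The sign makes the quotient positive somewhere. Its maximum is then positive
    and, as \<open>u\<close> vanishes on the circle, attained inside.\<close>
  define \<sigma> where "\<sigma> = sgn (u x1)"
  let ?w = "\<lambda>x. \<sigma> * u x / ?h x"
  have "continuous_on (cball 0 r) ?w"
    using h u(2) Ck_on_imp_continuous_on[OF Ck_on_radial_bes]
    by (intro continuous_intros) force+
  then obtain x0 where x0: "x0 \<in> cball 0 r" "\<And>x. x \<in> cball 0 r \<Longrightarrow> ?w x \<le> ?w x0"
    using continuous_attains_sup[of "cball 0 r" ?w] assms(1) by auto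
  define m where "m = ?w x0"
  have "0 < \<sigma> * u x1" using x1 by (simp add: \<sigma>_def sgn_if) 
  then have "0 < ?w x1" using h[of x1] x1 by auto
  then have m: "0 < m" using x0(2)[of x1] x1 unfolding m_def by auto
  then have "norm x0 \<noteq> r" using u(3) by (auto simp: m_def)
  then have x0': "x0 \<in> ball 0 r" using x0(1) by auto
  \<comment> \<open>Maximality of the quotient is restated linearly: \<sigma> u - m h has maximum 0
    at \<open>x0\<close>. Thus no quotient has to be differentiated, and the two eigenvalue
    equations can be inserted directly.\<close>
  have max: "\<sigma> * u x - m * ?h x \<le> 0" if "x \<in> cball 0 r" for x
    using x0(2)[OF that] h[OF that] by (simp add: m_def[symmetric] pos_divide_le_eq)
  have eq: "\<sigma> * u x0 - m * ?h x0 = 0" using h[OF x0(1)] by (simp add: m_def)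
  have le: "\<sigma> * pd i (pd i u) x0 - m * pd i (pd i ?h) x0 \<le> 0" for i
  proof -
    obtain d where d: "0 < d" "ball x0 d \<subseteq> ball 0 r"
      using openE[OF open_ball x0'] by blast
    let ?p = "\<lambda>t. x0 + t *\<^sub>R axis i 1"
    have p: "?p t \<in> ball 0 r" if "\<bar>t\<bar> < d" for t
    proof -
      have "?p t \<in> ball x0 d" using that by (simp add: dist_norm)
      then show ?thesis using d(2) by blast
    qed
    have pdu: "((\<lambda>t. u (?p t)) has_real_derivative pd i u (?p t)) (at t)"
       "((\<lambda>t. pd i u (?p t)) has_real_derivative pd i (pd i u) (?p t)) (at t)" if "\<bar>t\<bar> < d" for t
      unfolding has_real_derivative_iff_has_vector_derivative
      using u(1) Ck_on_pd[of 1 _ u i] p[OF that] by (auto intro!: pd_line simp: numeral_2_eq_2)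
    have pdh: "((\<lambda>t. ?h (?p t)) has_real_derivative pd i ?h (?p t)) (at t)"
       "((\<lambda>t. pd i ?h (?p t)) has_real_derivative pd i (pd i ?h) (?p t)) (at t)" for t
      unfolding has_real_derivative_iff_has_vector_derivative
      using Ck_on_radial_bes[of 2 UNIV l] Ck_on_pd[of 1 UNIV ?h i] by (auto intro!: pd_line simp: numeral_2_eq_2)
    show ?thesis
    proof (rule second_derivative_local_max[OF d(1), where f="\<lambda>t. \<sigma> * u (?p t) - m * ?h (?p t)"])
      show "((\<lambda>t. \<sigma> * u (?p t) - m * ?h (?p t)) has_real_derivative \<sigma> * pd i u (?p t) - m * pd i ?h (?p t)) (at t)"
        if "\<bar>t\<bar> < d" for t
        by (intro DERIV_diff DERIV_cmult pdu pdh that)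
      show "((\<lambda>t. \<sigma> * pd i u (?p t) - m * pd i ?h (?p t)) has_real_derivative \<sigma> * pd i (pd i u) x0 - m * pd i (pd i ?h) x0) (at 0)"
        using pdu(2)[of 0] pdh(2)[of 0] d(1) by (auto intro!: DERIV_diff DERIV_cmult)
      show "\<sigma> * u (?p t) - m * ?h (?p t) \<le> \<sigma> * u (?p 0) - m * ?h (?p 0)" if "\<bar>t\<bar> < d" for t
        using max[of "?p t"] p[OF that] eq by auto
    qed
  qed
  have "\<sigma> * laplacian u x0 - m * laplacian ?h x0 \<le> 0"
    using add_mono[OF le[of 1] le[of 2]] by (simp add: laplacian_def sum_2 algebra_simps)
  moreover have "laplacian u x0 = - \<mu> * u x0" using u(5) x0' by fastforce
  ultimately have "m * l * ?h x0 \<le> \<mu> * (\<sigma> * u x0)" by (simp add: laplacian_radial_bes algebra_simps)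
  also have "\<sigma> * u x0 = m * ?h x0" using eq by simp
  finally have "(l - \<mu>) * (m * ?h x0) \<le> 0" by (simp add: algebra_simps)
  moreover have "0 < (l - \<mu>) * (m * ?h x0)" using l m h[OF x0(1)] by auto
  ultimately show False by simp
qed

lemma first_dirichlet_eigenvalue_disc:
  assumes "0 < r" "bes 0 T = 0" "\<And>t. 0 \<le> t \<Longrightarrow> t < T \<Longrightarrow> 0 < bes 0 t" "0 < T"
  shows "first_dirichlet_eigenvalue (ball 0 r) = 4 * T / r\<^sup>2"
  unfolding first_dirichlet_eigenvalue_def
  by (rule Least_equality) (use dirichlet_eigenvalue_disc dirichlet_eigenvalue_disc_ge assms in auto)

section \<open>Integration in Euclidean space\<close>

lemma integrable_compact_support:
  fixes f :: "'a::euclidean_space \<Rightarrow> real"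
  assumes "compact K" "continuous_on UNIV f" "\<And>x. x \<notin> K \<Longrightarrow> f x = 0"
  shows "integrable lborel f"
proof -
  have "integrable lborel (\<lambda>x. indicator K x *\<^sub>R f x)"
    by (rule borel_integrable_compact[OF assms(1) continuous_on_subset[OF assms(2)]]) simp
  moreover have "(\<lambda>x. indicator K x *\<^sub>R f x) = f"
    using assms(3) by (auto simp: indicator_def fun_eq_iff)
  ultimately show ?thesis by simp
qed

lemma lborel_integral_translation:
  fixes f :: "'a::euclidean_space \<Rightarrow> real"
  assumes "f \<in> borel_measurable borel"
  shows "integrable lborel (\<lambda>x. f (c + x)) \<longleftrightarrow> integrable lborel f"
    and "(\<integral>x. f (c + x) \<partial>lborel) = (\<integral>x. f x \<partial>lborel)"
proof -
  have m: "(+) c \<in> measurable lborel borel" by simp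
  show "integrable lborel (\<lambda>x. f (c + x)) \<longleftrightarrow> integrable lborel f"
    using integrable_distr_eq[OF m assms] by (simp only: lborel_distr_plus)
  show "(\<integral>x. f (c + x) \<partial>lborel) = (\<integral>x. f x \<partial>lborel)"
    using integral_distr[OF m assms] by (simp only: lborel_distr_plus)
qed

text \<open>Difference quotients integrate to 0 by translation invariance; no iterated integral is needed.\<close>

lemma integral_directional_derivative_eq_0:
  fixes f :: "'a::euclidean_space \<Rightarrow> real"
  assumes der: "\<And>x. (f has_derivative f' x) (at x)"
    and cont: "continuous_on UNIV (\<lambda>x. f' x v)"
    and K: "compact K" "\<And>x. x \<notin> K \<Longrightarrow> f x = 0"
  shows "integrable lborel (\<lambda>x. f' x v)" and "(\<integral>x. f' x v \<partial>lborel) = 0"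
proof -
  have fc: "continuous_on UNIV f"
    by (intro continuous_at_imp_continuous_on ballI has_derivative_continuous[OF der])
  then have fm: "f \<in> borel_measurable borel" by (rule borel_measurable_continuous_onI)
  have f'0: "f' x v = 0" if "x \<notin> K" for x
  proof -
    have "((\<lambda>_. 0) has_derivative f' x) (at x)"
      by (rule has_derivative_transform_within_open[OF der[of x], of "- K"])
        (use that K compact_imp_closed in auto)
    then have "f' x = (\<lambda>_. 0)" using has_derivative_unique has_derivative_const by blast
    then show ?thesis by simp
  qed
  show int: "integrable lborel (\<lambda>x. f' x v)"
    by (rule integrable_compact_support[OF K(1) cont f'0])
  have "bounded ((\<lambda>x. f' x v) ` K)"
    using compact_continuous_image[OF continuous_on_subset[OF cont] K(1)] compact_imp_bounded by blast
  then obtain B0 where "\<And>x. x \<in> K \<Longrightarrow> \<bar>f' x v\<bar> \<le> B0" by (auto simp: bounded_iff)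
  then have B: "\<bar>f' x v\<bar> \<le> max B0 0" for x using f'0[of x] by (cases "x \<in> K") force+
  define h where "h n = 1 / real (Suc n)" for n
  have h: "0 < h n" "h n \<le> 1" for n by (auto simp: h_def)
  define g where "g n x = (f (h n *\<^sub>R v + x) - f x) / h n" for n x
  have intf: "integrable lborel f" by (rule integrable_compact_support[OF K(1) fc K(2)])
  have g0: "(\<integral>x. g n x \<partial>lborel) = 0" for n
    using lborel_integral_translation[OF fm, of "h n *\<^sub>R v"] intf by (simp add: g_def)
  \<comment> \<open>The compact set swept out by K under the shifts by - t v with 0 \<le> t \<le> 1.
    Since \<open>h n \<le> 1\<close>, all difference quotients vanish outside it, which supplies the
    dominating function.\<close>
  define K' where "K' = (\<lambda>(x, t). x - t *\<^sub>R v) ` (K \<times> {0..1})"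
  have K': "compact K'"
    unfolding K'_def case_prod_unfold
    by (intro compact_continuous_image compact_Times K(1) compact_Icc) (auto intro!: continuous_intros)
  have bound: "norm (g n x) \<le> indicator K' x *\<^sub>R max B0 0" for n x
  proof (cases "x \<in> K'")
    case True
    have d: "((\<lambda>t. f (x + t *\<^sub>R v)) has_real_derivative f' (x + t *\<^sub>R v) v) (at t)" for t
      unfolding has_real_derivative_iff_has_vector_derivative
      by (rule has_vector_derivative_along_line[OF der])
    obtain t where "f (x + h n *\<^sub>R v) - f (x + 0 *\<^sub>R v) = (h n - 0) * f' (x + t *\<^sub>R v) v"
      using MVT2[OF h(1)[of n], of "\<lambda>t. f (x + t *\<^sub>R v)" "\<lambda>t. f' (x + t *\<^sub>R v) v"] d by blast
    then have "g n x = f' (x + t *\<^sub>R v) v" using h(1)[of n] by (simp add: g_def add.commute)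
    then show ?thesis using B True by simp
  next
    case False
    have "h n *\<^sub>R v + x \<notin> K"
    proof
      assume "h n *\<^sub>R v + x \<in> K"
      then have "(h n *\<^sub>R v + x) - h n *\<^sub>R v \<in> K'" unfolding K'_def using h[of n] by force
      then show False using False by simp
    qed
    moreover have "x \<notin> K"
    proof
      assume "x \<in> K"
      then have "x - 0 *\<^sub>R v \<in> K'" unfolding K'_def by force
      then show False using False by simp
    qed
    ultimately show ?thesis using K(2) False by (simp add: g_def)
  qed
  have "(\<lambda>n. \<integral>x. g n x \<partial>lborel) \<longlonglongrightarrow> (\<integral>x. f' x v \<partial>lborel)"
  proof (rule integral_dominated_convergence)
    show "integrable lborel (\<lambda>x. indicator K' x *\<^sub>R max B0 0)"
      by (rule borel_integrable_compact[OF K']) simp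
    show "(\<lambda>x. f' x v) \<in> borel_measurable lborel"
      using borel_measurable_continuous_onI[OF cont] by simp
    show "g n \<in> borel_measurable lborel" for n
      unfolding g_def using fm by measurable
    have "(\<lambda>n. g n x) \<longlonglongrightarrow> f' x v" for x
    proof -
      have "((\<lambda>t. f (x + t *\<^sub>R v)) has_real_derivative f' x v) (at 0)"
        unfolding has_real_derivative_iff_has_vector_derivative
        by (rule has_vector_derivative_along_line) (simp add: der)
      then have "((\<lambda>t. (f (x + t *\<^sub>R v) - f x) / t) \<longlongrightarrow> f' x v) (at 0)"
        by (simp add: DERIV_def)
      moreover have "filterlim h (at 0) sequentially"
        using h(1) LIMSEQ_Suc[OF lim_const_over_n[of "1::real"]]
        by (auto simp: filterlim_at h_def[abs_def] less_le)
      ultimately have "((\<lambda>n. (f (x + h n *\<^sub>R v) - f x) / h n) \<longlongrightarrow> f' x v) sequentially"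
        by (rule filterlim_compose)
      then show ?thesis by (simp add: g_def add.commute)
    qed
    then show "AE x in lborel. (\<lambda>n. g n x) \<longlonglongrightarrow> f' x v" by simp
    show "AE x in lborel. norm (g n x) \<le> indicator K' x *\<^sub>R max B0 0" for n using bound by simp
  qed
  then show "(\<integral>x. f' x v \<partial>lborel) = 0" by (simp only: g0 LIMSEQ_const_iff)
qed

text \<open>The change of variables formula speaks of absolutely integrable functions, the area
  measure of nonnegative integrals. This translates between them, with \<infinity> standing for
  failure of integrability.\<close>

lemma nn_integral_eq_absolutely_integrable:
  fixes F :: "'a::euclidean_space \<Rightarrow> real"
  assumes "(\<lambda>x. indicator S x * F x) \<in> borel_measurable borel" "\<And>x. x \<in> S \<Longrightarrow> 0 \<le> F x"
  shows "(\<integral>\<^sup>+x\<in>S. ennreal (F x) \<partial>lborel) =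
    (if F absolutely_integrable_on S then ennreal (integral S F) else \<infinity>)"
proof -
  let ?F = "\<lambda>x. indicator S x * F x"
  have eq: "(\<integral>\<^sup>+x\<in>S. ennreal (F x) \<partial>lborel) = (\<integral>\<^sup>+x. ennreal (?F x) \<partial>lborel)"
    by (rule nn_integral_cong) (auto simp: indicator_def)
  have nn: "0 \<le> ?F x" for x using assms(2) by (auto simp: indicator_def)
  have ab: "F absolutely_integrable_on S \<longleftrightarrow> integrable lborel ?F"
    using integrable_completion[of ?F lborel] assms(1) by (simp add: set_integrable_def)
  show ?thesis
  proof (cases "integrable lborel ?F")
    case True
    then have "(\<integral>\<^sup>+x. ennreal (?F x) \<partial>lborel) = ennreal (\<integral>x. ?F x \<partial>lborel)"
      using nn by (intro nn_integral_eq_integral) auto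
    also have "(\<integral>x. ?F x \<partial>lborel) = integral S F"
      using set_lebesgue_integral_eq_integral(2)[of S F] True ab integral_completion[of ?F lborel] assms(1)
      by (simp add: set_lebesgue_integral_def)
    finally show ?thesis using True eq ab by simp
  next
    case False
    then have "(\<integral>\<^sup>+x. ennreal (?F x) \<partial>lborel) = \<infinity>"
      using integrableI_nonneg[of ?F lborel] assms(1) nn by (auto simp: less_top[symmetric])
    then show ?thesis using False eq ab by simp
  qed
qed

lemma nn_integral_change_of_variables:
  fixes g :: "real^'n::{finite,wellorder} \<Rightarrow> real^'n::_" and f :: "real^'n::_ \<Rightarrow> real"
  assumes S: "S \<in> sets borel"
    and der: "\<And>x. x \<in> S \<Longrightarrow> (g has_derivative g' x) (at x within S)"
    and inj: "inj_on g S"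
    and mf: "(\<lambda>y. indicator (g ` S) y * f y) \<in> borel_measurable borel"
    and mg: "(\<lambda>x. indicator S x * (\<bar>det (matrix (g' x))\<bar> * f (g x))) \<in> borel_measurable borel"
    and nn: "\<And>y. y \<in> g ` S \<Longrightarrow> 0 \<le> f y"
  shows "(\<integral>\<^sup>+y\<in>g ` S. ennreal (f y) \<partial>lborel) = (\<integral>\<^sup>+x\<in>S. ennreal (\<bar>det (matrix (g' x))\<bar> * f (g x)) \<partial>lborel)"
proof -
  let ?h = "\<lambda>x. \<bar>det (matrix (g' x))\<bar> * f (g x)"
  \<comment> \<open>The change of variables theorem concerns functions into a space of vectors; a
    real function enters as one with a single component.\<close>
  let ?v = "vec :: real \<Rightarrow> real^1"
  have ab: "(\<lambda>x. ?v (F x)) absolutely_integrable_on A \<longleftrightarrow> F absolutely_integrable_on A"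
    "integral A (\<lambda>x. ?v (F x)) = ?v (integral A F)" for F and A :: "(real^'n::_) set"
    using absolutely_integrable_on_1_iff[of A "\<lambda>x. ?v (F x)"] integral_on_1_eq[of A "\<lambda>x. ?v (F x)"]
    by simp_all
  have sc: "c *\<^sub>R ?v a = ?v (c * a)" for c a by (simp add: vec_eq_iff)
  \<comment> \<open>The value \<open>b\<close> is left free: instantiating it with either of the two
    integrals gives both that integrability is equivalent and that the values agree.\<close>
  have *: "?h absolutely_integrable_on S \<and> integral S ?h = b \<longleftrightarrow>
      f absolutely_integrable_on (g ` S) \<and> integral (g ` S) f = b" for b
  proof -
    have "S \<in> sets lebesgue" using S by simp
    from has_absolute_integral_change_of_variables[OF this der inj, of "\<lambda>x. ?v (f x)" "?v b"]
    have "(\<lambda>x. ?v (?h x)) absolutely_integrable_on S \<and> integral S (\<lambda>x. ?v (?h x)) = ?v b \<longleftrightarrow>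
        (\<lambda>x. ?v (f x)) absolutely_integrable_on (g ` S) \<and> integral (g ` S) (\<lambda>x. ?v (f x)) = ?v b"
      by (simp add: sc)
    then show ?thesis by (simp add: ab)
  qed
  have "(\<integral>\<^sup>+y\<in>g ` S. ennreal (f y) \<partial>lborel) =
      (if f absolutely_integrable_on (g ` S) then ennreal (integral (g ` S) f) else \<infinity>)"
    by (rule nn_integral_eq_absolutely_integrable[OF mf nn])
  also have "\<dots> = (if ?h absolutely_integrable_on S then ennreal (integral S ?h) else \<infinity>)"
    using *[of "integral S ?h"] *[of "integral (g ` S) f"] by auto
  also have "\<dots> = (\<integral>\<^sup>+x\<in>S. ennreal (?h x) \<partial>lborel)"
    by (rule nn_integral_eq_absolutely_integrable[symmetric, OF mg]) (simp add: nn)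
  finally show ?thesis .
qed

section \<open>Regular surface patches\<close>

text \<open>The mean value theorem is applied along v and then, to the derivative, along w. Since
  the second difference is symmetric in v and w, shrinking h gives the symmetry of second
  derivatives.\<close>

lemma second_difference_MVT:
  fixes u :: "'a::real_normed_vector \<Rightarrow> real"
  assumes "Ck_on 2 S u" "0 < h"
    and S: "\<And>s t. 0 \<le> s \<Longrightarrow> s \<le> h \<Longrightarrow> 0 \<le> t \<Longrightarrow> t \<le> h \<Longrightarrow> x + s *\<^sub>R v + t *\<^sub>R w \<in> S"
  obtains s t where "0 < s" "s < h" "0 < t" "t < h"
    "u (x + h *\<^sub>R v + h *\<^sub>R w) - u (x + h *\<^sub>R v) - u (x + h *\<^sub>R w) + u x =
      h\<^sup>2 * frechet_derivative (\<lambda>y. frechet_derivative u (at y) v) (at (x + s *\<^sub>R v + t *\<^sub>R w)) w"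
proof -
  let ?Dv = "\<lambda>y. frechet_derivative u (at y) v"
  have du: "(u has_derivative frechet_derivative u (at y)) (at y)"
    "(?Dv has_derivative frechet_derivative ?Dv (at y)) (at y)" if "y \<in> S" for y
    using assms(1) that by (auto simp: numeral_2_eq_2 frechet_derivative_works)
  let ?f = "\<lambda>s. u (x + h *\<^sub>R w + s *\<^sub>R v) - u (x + s *\<^sub>R v)"
  have "(?f has_real_derivative ?Dv (x + h *\<^sub>R w + s *\<^sub>R v) - ?Dv (x + s *\<^sub>R v)) (at s)"
    if "0 \<le> s" "s \<le> h" for s
    unfolding has_real_derivative_iff_has_vector_derivative
    using S[of s h] S[of s 0] that
    by (intro has_vector_derivative_diff has_vector_derivative_along_line du) (auto simp: algebra_simps)
  from MVT2[OF assms(2) this] obtain s where s: "0 < s" "s < h"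
    "?f h - ?f 0 = (h - 0) * (?Dv (x + h *\<^sub>R w + s *\<^sub>R v) - ?Dv (x + s *\<^sub>R v))"
    by blast
  let ?g = "\<lambda>t. ?Dv (x + s *\<^sub>R v + t *\<^sub>R w)"
  have "(?g has_real_derivative frechet_derivative ?Dv (at (x + s *\<^sub>R v + t *\<^sub>R w)) w) (at t)"
    if "0 \<le> t" "t \<le> h" for t
    unfolding has_real_derivative_iff_has_vector_derivative
    using S[of s t] s that by (intro has_vector_derivative_along_line du) auto
  from MVT2[OF assms(2) this] obtain t where t: "0 < t" "t < h"
    "?g h - ?g 0 = (h - 0) * frechet_derivative ?Dv (at (x + s *\<^sub>R v + t *\<^sub>R w)) w"
    by blast
  show ?thesis
  proof (rule that[OF s(1,2) t(1,2)])
    have "u (x + h *\<^sub>R v + h *\<^sub>R w) - u (x + h *\<^sub>R v) - u (x + h *\<^sub>R w) + u x = ?f h - ?f 0"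
      by (simp add: add.commute add.left_commute)
    also have "\<dots> = h * (?g h - ?g 0)"
      unfolding s(3) by (simp add: add.commute add.left_commute)
    finally show "u (x + h *\<^sub>R v + h *\<^sub>R w) - u (x + h *\<^sub>R v) - u (x + h *\<^sub>R w) + u x =
      h\<^sup>2 * frechet_derivative ?Dv (at (x + s *\<^sub>R v + t *\<^sub>R w)) w"
      unfolding t(3) by (simp add: power2_eq_square)
  qed
qed

lemma second_derivative_symmetric_real:
  fixes u :: "'a::real_normed_vector \<Rightarrow> real"
  assumes "open S" "Ck_on 2 S u" "x \<in> S"
  shows "frechet_derivative (\<lambda>y. frechet_derivative u (at y) v) (at x) w =
    frechet_derivative (\<lambda>y. frechet_derivative u (at y) w) (at x) v"
proof -
  define A where "A y = frechet_derivative (\<lambda>y. frechet_derivative u (at y) v) (at y) w" for y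
  define B where "B y = frechet_derivative (\<lambda>y. frechet_derivative u (at y) w) (at y) v" for y
  have "continuous_on S A" "continuous_on S B"
    unfolding A_def[abs_def] B_def[abs_def] using assms(2) by (auto simp: numeral_2_eq_2)
  then have cont: "isCont (\<lambda>y. A y) x" "isCont (\<lambda>y. B y) x"
    using assms(1,3) by (auto simp: continuous_on_eq_continuous_at)
  have "\<bar>A x - B x\<bar> < e" if e: "0 < e" for e
  proof -
    obtain d1 where d1: "0 < d1" "\<And>y. dist y x < d1 \<Longrightarrow> dist (A y) (A x) < e / 2"
      using cont(1)[unfolded continuous_at_eps_delta, THEN spec, of "e / 2"] e by auto
    obtain d2 where d2: "0 < d2" "\<And>y. dist y x < d2 \<Longrightarrow> dist (B y) (B x) < e / 2"
      using cont(2)[unfolded continuous_at_eps_delta, THEN spec, of "e / 2"] e by auto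
    obtain d3 where d3: "0 < d3" "ball x d3 \<subseteq> S" using assms(1,3) openE by blast
    define d where "d = min d1 (min d2 d3)"
    \<comment> \<open>Chosen so that the whole parallelogram with sides h v and h w at x lies within
      distance d of x; the summand 1 covers the case v = w = 0.\<close>
    define h where "h = d / (2 * (norm v + norm w + 1))"
    have d: "0 < d" using d1 d2 d3 by (simp add: d_def)
    have nz: "0 < norm v + norm w + 1" by (smt (verit) norm_ge_zero)
    then have h: "0 < h" using d by (simp add: h_def)
    have near: "dist (x + s *\<^sub>R v + t *\<^sub>R w) x < d" if "0 \<le> s" "s \<le> h" "0 \<le> t" "t \<le> h" for s t
    proof -
      have "norm (s *\<^sub>R v + t *\<^sub>R w) \<le> s * norm v + t * norm w"
        using that norm_triangle_ineq[of "s *\<^sub>R v" "t *\<^sub>R w"] by simp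
      also have "\<dots> \<le> h * norm v + h * norm w"
        using that by (intro add_mono mult_right_mono) auto
      also have "\<dots> < 2 * (h * (norm v + norm w + 1))"
      proof -
        have "0 \<le> h * norm v" "0 \<le> h * norm w" using h by auto
        then show ?thesis using h unfolding distrib_left mult_1_right by linarith
      qed
      also have "\<dots> = d"
      proof -
        have "2 * (d / (2 * c) * c) = d" if "0 < c" for c :: real using that by simp
        then show ?thesis unfolding h_def using nz by blast
      qed
      finally show ?thesis by (simp add: dist_norm add.assoc)
    qed
    have S: "x + s *\<^sub>R v + t *\<^sub>R w \<in> S" "x + t *\<^sub>R w + s *\<^sub>R v \<in> S"
      if "0 \<le> s" "s \<le> h" "0 \<le> t" "t \<le> h" for s t
    proof -
      have "x + s *\<^sub>R v + t *\<^sub>R w \<in> ball x d3" using near[OF that] by (simp add: d_def dist_commute)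
      then show "x + s *\<^sub>R v + t *\<^sub>R w \<in> S" using d3(2) by blast
      then show "x + t *\<^sub>R w + s *\<^sub>R v \<in> S" by (simp add: algebra_simps)
    qed
    obtain s t where st: "0 < s" "s < h" "0 < t" "t < h"
      "u (x + h *\<^sub>R v + h *\<^sub>R w) - u (x + h *\<^sub>R v) - u (x + h *\<^sub>R w) + u x = h\<^sup>2 * A (x + s *\<^sub>R v + t *\<^sub>R w)"
      unfolding A_def using second_difference_MVT[OF assms(2) h, of x v w] S(1) by blast
    obtain s' t' where st': "0 < s'" "s' < h" "0 < t'" "t' < h"
      "u (x + h *\<^sub>R w + h *\<^sub>R v) - u (x + h *\<^sub>R w) - u (x + h *\<^sub>R v) + u x = h\<^sup>2 * B (x + s' *\<^sub>R w + t' *\<^sub>R v)"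
      unfolding B_def using second_difference_MVT[OF assms(2) h, of x w v] S(2) by blast
    have "h\<^sup>2 * A (x + s *\<^sub>R v + t *\<^sub>R w) = h\<^sup>2 * B (x + s' *\<^sub>R w + t' *\<^sub>R v)"
      using st(5) st'(5) by (simp add: algebra_simps)
    then have "A (x + s *\<^sub>R v + t *\<^sub>R w) = B (x + s' *\<^sub>R w + t' *\<^sub>R v)" using h by simp
    moreover have "dist (A (x + s *\<^sub>R v + t *\<^sub>R w)) (A x) < e / 2"
      using near[of s t] st by (intro d1(2)) (simp add: d_def)
    moreover have "dist (B (x + s' *\<^sub>R w + t' *\<^sub>R v)) (B x) < e / 2"
      using near[of t' s'] st' by (intro d2(2)) (simp add: d_def algebra_simps)
    ultimately show ?thesis unfolding dist_real_def by linarith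
  qed
  from this[of "\<bar>A x - B x\<bar>"] have "A x = B x" by auto
  then show ?thesis by (simp add: A_def B_def)
qed

lemma second_derivative_symmetric:
  fixes u :: "'a::real_normed_vector \<Rightarrow> 'b::euclidean_space"
  assumes "open S" "Ck_on 2 S u" "x \<in> S"
  shows "frechet_derivative (\<lambda>y. frechet_derivative u (at y) v) (at x) w =
    frechet_derivative (\<lambda>y. frechet_derivative u (at y) w) (at x) v"
proof (rule euclidean_eqI)
  fix b :: 'b assume "b \<in> Basis"
  have inner: "frechet_derivative (\<lambda>y. f y \<bullet> b) (at y) v = frechet_derivative f (at y) v \<bullet> b"
    if "f differentiable (at y)" for f :: "'a \<Rightarrow> 'b" and y v
  proof -
    have "((\<lambda>y. f y \<bullet> b) has_derivative (\<lambda>v. frechet_derivative f (at y) v \<bullet> b)) (at y)"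
      using that frechet_derivative_works by (intro has_derivative_inner_left) blast
    then show ?thesis using frechet_derivative_at by metis
  qed
  have d: "u differentiable (at y)" "(\<lambda>y. frechet_derivative u (at y) v) differentiable (at y)"
    if "y \<in> S" for y v
    using assms(2) that by (auto simp: numeral_2_eq_2)
  have "frechet_derivative (\<lambda>y. frechet_derivative (\<lambda>y. u y \<bullet> b) (at y) v) (at x) w
      = frechet_derivative (\<lambda>y. frechet_derivative u (at y) v) (at x) w \<bullet> b" for v w
    using frechet_derivative_cong_open(1)[OF assms(1) inner[OF d(1)] assms(3)] inner[OF d(2)[OF assms(3)]]
    by simp
  moreover have "Ck_on 2 S (\<lambda>y. u y \<bullet> b)" by (intro Ck_on_inner assms Ck_on_const)
  ultimately show "frechet_derivative (\<lambda>y. frechet_derivative u (at y) v) (at x) w \<bullet> b =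
    frechet_derivative (\<lambda>y. frechet_derivative u (at y) w) (at x) v \<bullet> b"
    using second_derivative_symmetric_real[OF assms(1) _ assms(3)] by metis
qed

lemma pd_commute:
  fixes u :: "real^2 \<Rightarrow> 'b::euclidean_space"
  assumes "open S" "Ck_on 2 S u" "x \<in> S"
  shows "pd i (pd j u) x = pd j (pd i u) x"
  unfolding pd_def[abs_def] by (rule second_derivative_symmetric[OF assms])

lemma pd_cong_open:
  assumes "open S" "\<And>x. x \<in> S \<Longrightarrow> f x = g x" "x \<in> S"
  shows "pd i f x = pd i g x"
  unfolding pd_def by (simp add: frechet_derivative_cong_open(1)[OF assms])

lemma Ck_on_1_has_derivative:
  "Ck_on 1 S u \<Longrightarrow> x \<in> S \<Longrightarrow> (u has_derivative frechet_derivative u (at x)) (at x)"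
  using Ck_on_SucD[of 0 S u x] by simp

lemma pd_bilinear:
  assumes "bounded_bilinear bop" "Ck_on 1 S f" "Ck_on 1 S g" "x \<in> S"
  shows "pd i (\<lambda>x. bop (f x) (g x)) x = bop (f x) (pd i g x) + bop (pd i f x) (g x)"
  using pd_eqI[OF bounded_bilinear.FDERIV[OF assms(1) Ck_on_1_has_derivative[OF assms(2,4)]
    Ck_on_1_has_derivative[OF assms(3,4)]]] by (simp add: pd_def)

lemmas pd_inner = pd_bilinear[OF bounded_bilinear_inner]
lemmas pd_scaleR = pd_bilinear[OF bounded_bilinear_scaleR]
lemmas pd_mult = pd_bilinear[OF bounded_bilinear_mult]
lemmas pd_cross3 = pd_bilinear[OF bounded_bilinear_cross3]

lemma pd_real_compose:
  assumes "Ck_on 1 S f" "x \<in> S" "(F has_real_derivative F') (at (f x))"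
  shows "pd i (\<lambda>x. F (f x)) x = F' * pd i f x"
  using pd_eqI[OF has_derivative_compose[OF Ck_on_1_has_derivative[OF assms(1,2)]
    assms(3)[unfolded has_field_derivative_def]]] by (simp add: pd_def)

section \<open>Regular patches, unit normal and conormals\<close>

definition regular_on :: "(real^2) set \<Rightarrow> (real^2 \<Rightarrow> real^3) \<Rightarrow> bool" where
  "regular_on V u \<longleftrightarrow> open V \<and> Ck_on 2 V u \<and> (\<forall>x\<in>V. cross3 (pd 1 u x) (pd 2 u x) \<noteq> 0)"

lemma area_density_eq_norm_cross3: "area_density u x = norm (cross3 (pd 1 u x) (pd 2 u x))"
proof -
  have "fff u 1 1 x * fff u 2 2 x - (fff u 1 2 x)\<^sup>2 = (norm (cross3 (pd 1 u x) (pd 2 u x)))\<^sup>2"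
    using norm_cross_dot[of "pd 1 u x" "pd 2 u x"]
    by (simp add: fff_def power_mult_distrib dot_square_norm)
  then show ?thesis by (simp add: area_density_def)
qed

lemma regular_on_pos: "regular_on V u \<Longrightarrow> x \<in> V \<Longrightarrow> 0 < area_density u x"
  by (simp add: area_density_eq_norm_cross3 regular_on_def)

lemma regular_on_Ck_pd: "regular_on V u \<Longrightarrow> Ck_on 1 V (pd i u)"
  using Ck_on_pd[of 1 V u i] by (simp add: regular_on_def numeral_2_eq_2)

lemma regular_on_Ck_on_1: "regular_on V u \<Longrightarrow> Ck_on 1 V u"
  using Ck_on_le[of 2 V u 1] by (simp add: regular_on_def)

lemma regular_on_continuous_area_density:
  assumes "regular_on V u" shows "continuous_on V (area_density u)"
  unfolding area_density_eq_norm_cross3[abs_def]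
  by (intro continuous_on_norm continuous_on_cross Ck_on_imp_continuous_on[OF regular_on_Ck_pd[OF assms]])

lemma unit_normal_scaleR: "area_density u x *\<^sub>R unit_normal u x = cross3 (pd 1 u x) (pd 2 u x)"
  by (simp add: unit_normal_def area_density_eq_norm_cross3 Let_def)

lemma Ck_on_unit_normal:
  assumes "regular_on V u" shows "Ck_on 1 V (unit_normal u)"
proof -
  let ?N = "\<lambda>x. cross3 (pd 1 u x) (pd 2 u x)"
  have V: "open V" using assms by (simp add: regular_on_def)
  have N: "Ck_on 1 V ?N" by (intro Ck_on_cross3 V regular_on_Ck_pd assms)
  have nz: "0 < ?N x \<bullet> ?N x" if "x \<in> V" for x using assms that by (simp add: regular_on_def)
  \<comment> \<open>The normalising factor is taken as a power of the positive C^1 function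
    \<open>?N x \<bullet> ?N x\<close>, so that only composition with a smooth real function is
    involved.\<close>
  have "Ck_on 1 V (\<lambda>x. (?N x \<bullet> ?N x) powr - (1 / 2))"
    by (rule Ck_on_compose[OF V _ _ Ck_on_inner[OF V N N] Ck_on_powr]) (use nz in auto)
  from Ck_on_scaleR[OF V this N]
  have "Ck_on 1 V (\<lambda>x. ((?N x \<bullet> ?N x) powr - (1 / 2)) *\<^sub>R ?N x)" .
  moreover have "((?N x \<bullet> ?N x) powr - (1 / 2)) *\<^sub>R ?N x = unit_normal u x" if "x \<in> V" for x
  proof -
    have "(?N x \<bullet> ?N x) powr - (1 / 2) = 1 / norm (?N x)"
      using nz[OF that] by (simp only: powr_minus powr_half_sqrt[OF less_imp_le] norm_eq_sqrt_inner inverse_eq_divide)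
    then show ?thesis by (simp only: unit_normal_def Let_def)
  qed
  ultimately show ?thesis by (subst Ck_on_cong[OF V, symmetric])
qed

text \<open>The cofields are the area density times the gradients of the two coordinate functions; they are
  the conormals that make the first variation of area a pure divergence.\<close>

definition cofield :: "(real^2 \<Rightarrow> real^3) \<Rightarrow> 2 \<Rightarrow> real^2 \<Rightarrow> real^3" where
  "cofield u i x = (if i = 1 then cross3 (pd 2 u x) (unit_normal u x) else cross3 (unit_normal u x) (pd 1 u x))"

lemma Ck_on_cofield: "regular_on V u \<Longrightarrow> Ck_on 1 V (cofield u i)"
proof -
  assume reg: "regular_on V u"
  then have V: "open V" by (simp add: regular_on_def)
  show "Ck_on 1 V (cofield u i)"
    unfolding cofield_def[abs_def]
    using Ck_on_cross3[OF V regular_on_Ck_pd[OF reg] Ck_on_unit_normal[OF reg]]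
      Ck_on_cross3[OF V Ck_on_unit_normal[OF reg] regular_on_Ck_pd[OF reg]]
    by (cases "i = 1") (simp_all only: simp_thms if_True if_False)
qed

lemma inner_cross3_cross3:
  "cross3 w x \<bullet> cross3 y z = (w \<bullet> y) * (x \<bullet> z) - (w \<bullet> z) * (x \<bullet> y)"
  by (simp add: cross3_simps)

lemma inner_cross3_cyclic: "cross3 x y \<bullet> z = cross3 y z \<bullet> x"
  by (simp add: cross3_simps)

text \<open>Orthogonality to a and b gives d \<times> (a \<times> b) = 0, so d is parallel to a
  \<times> b; being also orthogonal to it, d vanishes.\<close>

lemma orthogonal_basis_cross3_eq_0:
  assumes "d \<bullet> a = 0" "d \<bullet> b = 0" "d \<bullet> cross3 a b = 0" "cross3 a b \<noteq> 0"
  shows "d = 0"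
proof -
  have "cross3 d (cross3 a b) = (d \<bullet> b) *\<^sub>R a - (d \<bullet> a) *\<^sub>R b"
    by (simp add: cross3_simps vec_eq_iff forall_3)
  then show ?thesis using assms norm_and_cross_eq_0[of d "cross3 a b"] by auto
qed

text \<open>Scalar triple products: the off-diagonal ones repeat a vector, the diagonal ones are
  cyclic permutations of n . (a \<times> b).\<close>

lemma inner_cofield:
  assumes "regular_on V u" "x \<in> V"
  shows "cofield u i x \<bullet> pd j u x = (if i = j then area_density u x else 0)"
proof -
  let ?n = "unit_normal u x"
  have "area_density u x = area_density u x * (?n \<bullet> ?n)"
    using assms by (simp add: unit_normal_def regular_on_def Let_def dot_square_norm power_divide)
  also have "\<dots> = ?n \<bullet> cross3 (pd 1 u x) (pd 2 u x)" by (simp flip: unit_normal_scaleR)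
  finally have n: "?n \<bullet> cross3 (pd 1 u x) (pd 2 u x) = area_density u x" by simp
  have "i = 1 \<or> i = 2" "j = 1 \<or> j = 2" using exhaust_2 by auto
  then show ?thesis
    using n inner_cross3_cyclic[of "pd 1 u x" "pd 2 u x" ?n] inner_cross3_cyclic[of "pd 2 u x" ?n "pd 1 u x"]
    by (auto simp: cofield_def dot_cross_self inner_commute)
qed

text \<open>The mixed second derivatives of \<open>u\<close> cancel, leaving b \<times> n_1 + n_2
  \<times> a, with a, b the tangent vectors and n_i the derivatives of the normal. Its tangential
  components vanish because each n_i is tangent; its inner product with a \<times> b is the
  numerator of \<open>mean_curvature\<close>.\<close>

lemma divergence_cofield_eq_0:
  assumes "regular_on V u" "x \<in> V" "mean_curvature u x = 0"
  shows "pd 1 (cofield u 1) x + pd 2 (cofield u 2) x = 0"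
proof -
  let ?n = "unit_normal u"
  let ?a = "pd 1 u x" and ?b = "pd 2 u x" and ?n1 = "pd 1 ?n x" and ?n2 = "pd 2 ?n x"
  have V: "open V" "Ck_on 2 V u" and reg: "cross3 ?a ?b \<noteq> 0" using assms by (auto simp: regular_on_def)
  note C = Ck_on_unit_normal[OF assms(1)] regular_on_Ck_pd[OF assms(1)]
  have nn: "?n y \<bullet> ?n y = 1" if "y \<in> V" for y
    using assms(1) that by (simp add: unit_normal_def regular_on_def Let_def dot_square_norm power_divide)
  have np: "?n y \<bullet> pd j u y = 0" for y j
    using exhaust_2[of j] by (auto simp: unit_normal_def Let_def dot_cross_self inner_commute)
  have "pd i (\<lambda>y. ?n y \<bullet> ?n y) x = 0" for i
    using pd_cong_open[OF V(1) nn assms(2)] by (simp add: pd_def)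
  then have nni: "pd i ?n x \<bullet> ?n x = 0" for i
    using pd_inner[OF C(1) C(1) assms(2), of i] by (simp add: inner_commute)
  have "pd i (\<lambda>y. ?n y \<bullet> pd j u y) x = 0" for i j
    unfolding np by (simp add: pd_def)
  \<comment> \<open>Weingarten's equations, obtained by differentiating the orthogonality of the
    normal and the tangent vectors.\<close>
  then have w: "pd i ?n x \<bullet> pd j u x = - sff u i j x" for i j
    using pd_inner[OF C(1) C(2)[of j] assms(2), of i] by (simp add: sff_def inner_commute)
  let ?D = "cross3 ?b ?n1 + cross3 ?n2 ?a"
  have cof: "cofield u 1 = (\<lambda>x. cross3 (pd 2 u x) (?n x))" "cofield u 2 = (\<lambda>x. cross3 (?n x) (pd 1 u x))"
    by (auto simp: cofield_def)
  have comm: "pd 1 (pd 2 u) x = pd 2 (pd 1 u) x" by (rule pd_commute[OF V assms(2)])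
  have "pd 1 (cofield u 1) x + pd 2 (cofield u 2) x = ?D"
    unfolding cof pd_cross3[OF C(2)[of 2] C(1) assms(2)] pd_cross3[OF C(1) C(2)[of 1] assms(2)] comm
    using cross_skew[of "pd 2 (pd 1 u) x" "?n x"] by simp
  moreover have "?D = 0"
  proof (rule orthogonal_basis_cross3_eq_0[OF _ _ _ reg])
    have N: "pd i ?n x \<bullet> cross3 ?a ?b = 0" for i
      using nni[of i] by (simp flip: unit_normal_scaleR)
    show "?D \<bullet> ?a = 0"
      using N[of 1] inner_cross3_cyclic[of ?b ?n1 ?a] inner_cross3_cyclic[of ?n1 ?a ?b]
      by (simp add: inner_add_left dot_cross_self inner_commute[of ?n1])
    show "?D \<bullet> ?b = 0"
      using N[of 2] inner_cross3_cyclic[of ?n2 ?a ?b]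
      by (simp add: inner_add_left dot_cross_self inner_commute[of ?n2])
    have "0 < fff u 1 1 x * fff u 2 2 x - (fff u 1 2 x)\<^sup>2"
      using regular_on_pos[OF assms(1,2)] by (simp add: area_density_def)
    then have H: "sff u 1 1 x * fff u 2 2 x - 2 * sff u 1 2 x * fff u 1 2 x + sff u 2 2 x * fff u 1 1 x = 0"
      using assms(3) by (simp add: mean_curvature_def)
    have "sff u 2 1 x = sff u 1 2 x" using comm by (simp add: sff_def)
    then show "?D \<bullet> cross3 ?a ?b = 0"
      using H w[of 1 1] w[of 1 2] w[of 2 1] w[of 2 2]
      by (simp add: inner_add_left inner_cross3_cross3 fff_def inner_commute[of ?a ?b]
          inner_commute[of ?a ?n1] inner_commute[of ?b ?n1] inner_commute[of ?a ?n2] inner_commute[of ?b ?n2] algebra_simps)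
  qed
  ultimately show ?thesis by simp
qed

text \<open>The open sets \<open>V\<close> and \<open>- K\<close> cover the plane, and on each of
  them the extension is visibly C^k.\<close>

lemma Ck_on_extend_0:
  assumes "open V" "closed K" "K \<subseteq> V" "Ck_on k V f" "\<And>x. x \<in> V - K \<Longrightarrow> f x = 0"
  shows "Ck_on k UNIV (\<lambda>x. if x \<in> V then f x else 0)"
proof (rule Ck_on_local)
  fix x
  show "\<exists>T. open T \<and> x \<in> T \<and> Ck_on k T (\<lambda>x. if x \<in> V then f x else 0)"
  proof (cases "x \<in> V")
    case True
    then show ?thesis using assms(1,4) Ck_on_cong[OF assms(1), of f "\<lambda>x. if x \<in> V then f x else 0" k] by auto
  next
    case False
    have "Ck_on k (- K) (\<lambda>x. if x \<in> V then f x else 0)"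
      by (subst Ck_on_cong[where g="\<lambda>_. 0"]) (use assms Ck_on_const in auto)
    then show ?thesis using False assms(2,3) by (intro exI[of _ "- K"]) auto
  qed
qed

text \<open>The integral of the surface divergence of Y. As the conormals are divergence free, the
  integrand is the plane divergence of the compactly supported functions
  \<open>cofield u i x \<bullet> Y x\<close>, extended by 0.\<close>

lemma chart_first_variation:
  assumes reg: "regular_on V u" and H: "\<And>x. x \<in> V \<Longrightarrow> mean_curvature u x = 0"
    and Y: "Ck_on 1 V Y" and K: "compact K" "K \<subseteq> V" "\<And>x. x \<in> V - K \<Longrightarrow> Y x = 0"
  shows "(\<integral>x. indicator V x * (cofield u 1 x \<bullet> pd 1 Y x + cofield u 2 x \<bullet> pd 2 Y x) \<partial>lborel) = 0"
proof -
  have V: "open V" using reg by (simp add: regular_on_def)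
  define f where "f i x = (if x \<in> V then cofield u i x \<bullet> Y x else 0)" for i x
  have Cf: "Ck_on 1 UNIV (f i)" for i
    unfolding f_def
    by (rule Ck_on_extend_0[OF V compact_imp_closed[OF K(1)] K(2)])
      (auto intro!: Ck_on_inner[OF V] Ck_on_cofield[OF reg] Y simp: K(3) simp del: One_nat_def)
  have f0: "f i x = 0" if "x \<notin> K" for i x using that K(3) by (auto simp: f_def)
  have d: "(f i has_derivative frechet_derivative (f i) (at x)) (at x)" for i x
    using Ck_on_1_has_derivative[OF Cf] by simp
  have c: "continuous_on UNIV (\<lambda>x. frechet_derivative (f i) (at x) v)" for i v
    using Cf[of i] by simp
  have int: "integrable lborel (pd j (f i))" "(\<integral>x. pd j (f i) x \<partial>lborel) = 0" for i j
    unfolding pd_def[abs_def] by (rule integral_directional_derivative_eq_0[OF d c K(1) f0]; assumption)+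
  have "indicator V x * (cofield u 1 x \<bullet> pd 1 Y x + cofield u 2 x \<bullet> pd 2 Y x) = pd 1 (f 1) x + pd 2 (f 2) x" for x
  proof (cases "x \<in> V")
    case True
    have "pd i (f i) x = cofield u i x \<bullet> pd i Y x + pd i (cofield u i) x \<bullet> Y x" for i
      using pd_cong_open[OF V _ True, of "f i" "\<lambda>x. cofield u i x \<bullet> Y x" i]
        pd_inner[OF Ck_on_cofield[OF reg] Y True, of i i] by (simp add: f_def)
    then have "pd 1 (f 1) x + pd 2 (f 2) x = cofield u 1 x \<bullet> pd 1 Y x + cofield u 2 x \<bullet> pd 2 Y x
        + (pd 1 (cofield u 1) x + pd 2 (cofield u 2) x) \<bullet> Y x"
      by (simp add: inner_add_left)
    then show ?thesis using divergence_cofield_eq_0[OF reg True H[OF True]] True by simp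
  next
    case False
    have "pd i (f j) x = 0" for i j
      using pd_cong_open[of "- K" "f j" "\<lambda>_. 0" x i] f0 False K
      by (auto simp: compact_imp_closed open_Compl pd_def)
    then show ?thesis using False by simp
  qed
  then show ?thesis
    using Bochner_Integration.integral_add[OF int(1)[of 1 1] int(1)[of 2 2]] int(2) by simp
qed

text \<open>The Riemannian gradient g^(ij) p_i u_j: the cofields divided by the area density are the
  vectors g^(ij) u_j, the tangent basis dual to \<open>pd 1 u x\<close> and
  \<open>pd 2 u x\<close>.\<close>

definition chart_grad :: "(real^2 \<Rightarrow> real^3) \<Rightarrow> (real^2 \<Rightarrow> real) \<Rightarrow> real^2 \<Rightarrow> real^3" where
  "chart_grad u p x = (1 / area_density u x) *\<^sub>R (pd 1 p x *\<^sub>R cofield u 1 x + pd 2 p x *\<^sub>R cofield u 2 x)"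

lemma chart_grad_inner_pd:
  assumes "regular_on V u" "x \<in> V"
  shows "chart_grad u p x \<bullet> pd i u x = pd i p x"
  using exhaust_2[of i] regular_on_pos[OF assms]
  by (auto simp: chart_grad_def inner_add_left inner_cofield[OF assms])

lemma chart_grad_linear_combination:
  assumes "\<And>i. pd i p x = A * pd i f x - B * pd i g x"
  shows "chart_grad u p x = A *\<^sub>R chart_grad u f x - B *\<^sub>R chart_grad u g x"
  unfolding chart_grad_def assms by (simp add: algebra_simps)

lemma continuous_on_chart_grad:
  assumes "regular_on V u" "Ck_on 1 V p"
  shows "continuous_on V (chart_grad u p)"
proof -
  have "continuous_on V (pd i p)" for i using assms(2) by (simp add: pd_def[abs_def])
  moreover have "continuous_on V (cofield u i)" for i
    using Ck_on_cofield[OF assms(1)] Ck_on_imp_continuous_on by blast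
  ultimately show ?thesis
    unfolding chart_grad_def
    using regular_on_continuous_area_density[OF assms(1)] regular_on_pos[OF assms(1)]
    by (intro continuous_intros) force+
qed

text \<open>The first variation formula for \<open>Y = p \<phi>'(s) grad s\<close>, \<open>s\<close> the squared distance from \<open>a\<close>:
  the weak form of \<open>\<Delta>(\<phi> \<circ> s) = \<phi>'' |grad s|\<^sup>2 + 4 \<phi>'\<close>.\<close>

lemma chart_weak_laplacian:
  fixes a :: "real^3" and \<phi>' \<phi>'' :: "real \<Rightarrow> real"
  assumes reg: "regular_on V u" and H: "\<And>x. x \<in> V \<Longrightarrow> mean_curvature u x = 0"
    and p: "Ck_on 1 V p" and K: "compact K" "K \<subseteq> V" "\<And>x. x \<in> V - K \<Longrightarrow> p x = 0"
    and \<phi>: "\<And>t. (\<phi>' has_real_derivative \<phi>'' t) (at t)" "Ck_on 1 UNIV \<phi>'"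
  defines "s \<equiv> \<lambda>x. (u x - a) \<bullet> (u x - a)"
  shows "(\<integral>x. indicator V x * (area_density u x *
    (\<phi>' (s x) * (chart_grad u p x \<bullet> (2 *\<^sub>R (u x - a))) +
      p x * (\<phi>'' (s x) * (chart_grad u s x \<bullet> (2 *\<^sub>R (u x - a))) + 4 * \<phi>' (s x)))) \<partial>lborel) = 0"
proof -
  have V: "open V" using reg by (simp add: regular_on_def)
  define q where "q x = u x - a" for x
  have q: "Ck_on 1 V q" unfolding q_def by (intro Ck_on_diff V regular_on_Ck_on_1[OF reg] Ck_on_const)
  have s_eq: "s = (\<lambda>x. q x \<bullet> q x)" by (simp add: s_def q_def)
  have s: "Ck_on 1 V s" unfolding s_eq by (intro Ck_on_inner V q)
  have ps: "Ck_on 1 V (\<lambda>x. \<phi>' (s x))"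
    by (rule Ck_on_compose[OF V open_UNIV _ s \<phi>(2)]) simp
  have m: "Ck_on 1 V (\<lambda>x. p x * \<phi>' (s x))" by (intro Ck_on_mult V p ps)
  have q2: "Ck_on 1 V (\<lambda>x. 2 *\<^sub>R q x)" by (intro Ck_on_scaleR V q Ck_on_const)
  define Y where "Y x = (p x * \<phi>' (s x)) *\<^sub>R (2 *\<^sub>R q x)" for x
  have Y: "Ck_on 1 V Y" unfolding Y_def by (intro Ck_on_scaleR V m q2)
  have pdq: "pd i q x = pd i u x" if "x \<in> V" for i x
    unfolding q_def using has_derivative_diff[OF Ck_on_1_has_derivative[OF regular_on_Ck_on_1[OF reg] that] has_derivative_const]
    by (subst pd_eqI, assumption) (simp add: pd_def)
  \<comment> \<open>The term \<open>4 * \<phi>' (s x)\<close> collects 2 from each tangent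
    direction: \<open>cofield u i x \<bullet> (2 *\<^sub>R pd i u x)\<close> is twice the area
    density.\<close>
  have "area_density u x * (\<phi>' (s x) * (chart_grad u p x \<bullet> (2 *\<^sub>R (u x - a))) +
      p x * (\<phi>'' (s x) * (chart_grad u s x \<bullet> (2 *\<^sub>R (u x - a))) + 4 * \<phi>' (s x)))
      = cofield u 1 x \<bullet> pd 1 Y x + cofield u 2 x \<bullet> pd 2 Y x" if x: "x \<in> V" for x
  proof -
    let ?W = "area_density u x"
    have W: "0 < ?W" by (rule regular_on_pos[OF reg x])
    have "pd i Y x = (p x * \<phi>' (s x)) *\<^sub>R (2 *\<^sub>R pd i u x) +
        (p x * (\<phi>'' (s x) * pd i s x) + pd i p x * \<phi>' (s x)) *\<^sub>R (2 *\<^sub>R q x)" for i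
      unfolding Y_def pd_scaleR[OF m q2 x] pd_mult[OF p ps x] pd_real_compose[OF s x \<phi>(1)]
        pd_scaleR[OF Ck_on_const q x] pdq[OF x] by (simp add: pd_def)
    moreover have cg: "?W * (chart_grad u f x \<bullet> z) = pd 1 f x * (cofield u 1 x \<bullet> z) + pd 2 f x * (cofield u 2 x \<bullet> z)" for f z
      using W by (simp add: chart_grad_def inner_add_left)
    moreover have "?W * (\<phi>' (s x) * (chart_grad u p x \<bullet> (2 *\<^sub>R q x)) +
        p x * (\<phi>'' (s x) * (chart_grad u s x \<bullet> (2 *\<^sub>R q x)) + 4 * \<phi>' (s x)))
      = \<phi>' (s x) * (?W * (chart_grad u p x \<bullet> (2 *\<^sub>R q x))) +
        p x * (\<phi>'' (s x) * (?W * (chart_grad u s x \<bullet> (2 *\<^sub>R q x))) + 4 * \<phi>' (s x) * ?W)"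
      by (simp add: algebra_simps)
    ultimately show ?thesis
      using inner_cofield[OF reg x, of 1 1] inner_cofield[OF reg x, of 2 2]
      unfolding cg by (simp add: q_def[symmetric] inner_add_right algebra_simps)
  qed
  then have "(\<integral>x. indicator V x * (area_density u x * (\<phi>' (s x) * (chart_grad u p x \<bullet> (2 *\<^sub>R (u x - a))) +
      p x * (\<phi>'' (s x) * (chart_grad u s x \<bullet> (2 *\<^sub>R (u x - a))) + 4 * \<phi>' (s x)))) \<partial>lborel)
     = (\<integral>x. indicator V x * (cofield u 1 x \<bullet> pd 1 Y x + cofield u 2 x \<bullet> pd 2 Y x) \<partial>lborel)"
    by (intro Bochner_Integration.integral_cong) (auto simp: indicator_def)
  also have "\<dots> = 0"
    by (rule chart_first_variation[OF reg H Y K(1,2)]) (auto simp: Y_def K(3))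
  finally show ?thesis .
qed

section \<open>The area measure of an immersed surface\<close>

lemma linear_real2_eq:
  fixes L :: "real^2 \<Rightarrow> 'b::real_vector"
  assumes "linear L"
  shows "L v = v $ 1 *\<^sub>R L (axis 1 1) + v $ 2 *\<^sub>R L (axis 2 1)"
proof -
  have "v = v $ 1 *\<^sub>R axis 1 1 + v $ 2 *\<^sub>R axis 2 1"
    by (simp add: vec_eq_iff forall_2 axis_def)
  then show ?thesis using linear_add[OF assms] linear_cmul[OF assms] by metis
qed

text \<open>If a \<times> b = 0, then (a . b) a - (a . a) b = 0 is a linear relation between the
  images of the axes. Injectivity forces a . a = 0, hence a = 0, and then it fails on the first
  axis.\<close>

lemma regular_onI:
  assumes "open V" "smooth_on V u" "\<And>x. x \<in> V \<Longrightarrow> inj (frechet_derivative u (at x))"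
  shows "regular_on V u"
  unfolding regular_on_def
proof (intro conjI ballI notI)
  show "open V" "Ck_on 2 V u" using assms by (auto simp: smooth_on_def)
  fix x assume x: "x \<in> V" and 0: "cross3 (pd 1 u x) (pd 2 u x) = 0"
  let ?L = "frechet_derivative u (at x)" and ?a = "pd 1 u x" and ?b = "pd 2 u x"
  have "u differentiable (at x)" using \<open>Ck_on 2 V u\<close> x by (auto simp: numeral_2_eq_2)
  then have lin: "linear ?L" by (rule linear_frechet_derivative)
  have L0: "v = 0" if "?L v = 0" for v
    using assms(3)[OF x] that linear_0[OF lin] by (metis injD)
  have "cross3 ?a (cross3 ?a ?b) = (?a \<bullet> ?b) *\<^sub>R ?a - (?a \<bullet> ?a) *\<^sub>R ?b"
    by (simp add: cross3_simps vec_eq_iff forall_3)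
  then have "?L ((?a \<bullet> ?b) *\<^sub>R axis 1 1 - (?a \<bullet> ?a) *\<^sub>R axis 2 1) = 0"
    using 0 by (simp add: linear_diff[OF lin] linear_cmul[OF lin] pd_def)
  then have "(?a \<bullet> ?b) *\<^sub>R axis 1 1 - (?a \<bullet> ?a) *\<^sub>R (axis 2 1 :: real^2) = 0" by (rule L0)
  then have "((?a \<bullet> ?b) *\<^sub>R axis 1 1 - (?a \<bullet> ?a) *\<^sub>R (axis 2 1 :: real^2)) $ 2 = 0" by simp
  then have "?a = 0" by (simp add: axis_def)
  then have "axis 1 1 = (0 :: real^2)" by (intro L0) (simp add: pd_def)
  then show False by (simp add: axis_eq_0_iff)
qed

locale immersed =
  fixes M :: "'a surface"
  assumes immersed: "immersed_surface M"
begin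

abbreviation X where "X \<equiv> surf_topology M"
abbreviation atlas where "atlas \<equiv> parametrizations M"
abbreviation im where "im \<equiv> immersion M"

lemma atlas_cover: "(\<Union>(V,\<phi>)\<in>atlas. \<phi> ` V) = topspace X"
  using immersed by (simp add: immersed_surface_def smooth_manifold2_def)

lemma Hausdorff: "Hausdorff_space X"
  using immersed by (simp add: immersed_surface_def smooth_manifold2_def)

context
  fixes V \<phi> assumes chart: "(V, \<phi>) \<in> atlas"
begin

lemma chart_open: "open V"
  and chart_image_openin: "openin X (\<phi> ` V)"
  and chart_homeomorphic: "homeomorphic_map (top_of_set V) (subtopology X (\<phi> ` V)) \<phi>"
  using immersed chart by (auto simp: immersed_surface_def smooth_manifold2_def)

lemma chart_inj: "inj_on \<phi> V"
  using homeomorphic_imp_injective_map[OF chart_homeomorphic] by simp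

lemma chart_regular: "regular_on V (im \<circ> \<phi>)"
  using immersed chart chart_open by (intro regular_onI) (auto simp: immersed_surface_def)

lemma chart_in_topspace: "x \<in> V \<Longrightarrow> \<phi> x \<in> topspace X"
  using chart atlas_cover by blast

lemma chart_continuous_map: "continuous_map (top_of_set V) X \<phi>"
  using homeomorphic_imp_continuous_map[OF chart_homeomorphic] continuous_map_into_fulltopology by blast

lemma chart_openin_image:
  assumes "open U" "U \<subseteq> V" shows "openin X (\<phi> ` U)"
proof -
  have "openin (top_of_set V) U" using assms by (simp add: openin_open_eq[OF chart_open])
  then have "openin (subtopology X (\<phi> ` V)) (\<phi> ` U)"
    using homeomorphic_imp_open_map[OF chart_homeomorphic] by (simp add: open_map_def)
  then show ?thesis using chart_image_openin openin_open_subtopology by blast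
qed

lemma chart_open_preimage:
  assumes "openin X U" shows "open {x\<in>V. \<phi> x \<in> U}"
  using openin_continuous_map_preimage[OF chart_continuous_map assms] openin_open_trans[OF _ chart_open]
  by simp

lemma chart_image_vimage: "S \<subseteq> \<phi> ` V \<Longrightarrow> \<phi> ` {x\<in>V. \<phi> x \<in> S} = S"
  by auto

lemma chart_vimage_image: "B \<subseteq> V \<Longrightarrow> {x\<in>V. \<phi> x \<in> \<phi> ` B} = B"
  using inj_on_image_mem_iff[OF chart_inj] by auto

end

section \<open>Transition maps between charts\<close>

definition overlap :: "(real^2) set \<Rightarrow> (real^2 \<Rightarrow> 'a) \<Rightarrow> (real^2) set \<Rightarrow> (real^2 \<Rightarrow> 'a) \<Rightarrow> (real^2) set" where
  "overlap V \<phi> W \<psi> = {x\<in>V. \<phi> x \<in> \<psi> ` W}"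

definition transition :: "(real^2 \<Rightarrow> 'a) \<Rightarrow> (real^2) set \<Rightarrow> (real^2 \<Rightarrow> 'a) \<Rightarrow> real^2 \<Rightarrow> real^2" where
  "transition \<phi> W \<psi> = inv_into W \<psi> \<circ> \<phi>"

lemma open_overlap: "(V, \<phi>) \<in> atlas \<Longrightarrow> (W, \<psi>) \<in> atlas \<Longrightarrow> open (overlap V \<phi> W \<psi>)"
  unfolding overlap_def by (rule chart_open_preimage[OF _ chart_image_openin])

lemma transition_mem: "x \<in> overlap V \<phi> W \<psi> \<Longrightarrow> transition \<phi> W \<psi> x \<in> W"
  and chart_transition: "x \<in> overlap V \<phi> W \<psi> \<Longrightarrow> \<psi> (transition \<phi> W \<psi> x) = \<phi> x"
  by (auto simp: overlap_def transition_def inv_into_into f_inv_into_f)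

lemma transition_eq:
  "(W, \<psi>) \<in> atlas \<Longrightarrow> y \<in> W \<Longrightarrow> \<psi> y = \<phi> x \<Longrightarrow> transition \<phi> W \<psi> x = y"
  using chart_inj by (fastforce simp: transition_def dest: inv_into_f_f)

lemma Ck_on_transition:
  assumes "(V, \<phi>) \<in> atlas" "(W, \<psi>) \<in> atlas"
  shows "Ck_on k (overlap V \<phi> W \<psi>) (transition \<phi> W \<psi>)"
  using immersed assms by (force simp: immersed_surface_def smooth_manifold2_def smooth_on_def overlap_def transition_def)

lemma inj_on_transition:
  assumes "(V, \<phi>) \<in> atlas" shows "inj_on (transition \<phi> W \<psi>) (overlap V \<phi> W \<psi>)"
proof (rule inj_onI)
  fix x y assume xy: "x \<in> overlap V \<phi> W \<psi>" "y \<in> overlap V \<phi> W \<psi>" "transition \<phi> W \<psi> x = transition \<phi> W \<psi> y"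
  then have "\<phi> x = \<phi> y" by (metis chart_transition)
  then show "x = y" using xy chart_inj[OF assms] by (auto simp: overlap_def dest: inj_onD)
qed

lemma frechet_derivative_transition:
  assumes "(V, \<phi>) \<in> atlas" "(W, \<psi>) \<in> atlas" "x \<in> overlap V \<phi> W \<psi>"
    and "(f \<circ> \<psi>) differentiable (at (transition \<phi> W \<psi> x))"
  shows "frechet_derivative (f \<circ> \<phi>) (at x) =
    frechet_derivative (f \<circ> \<psi>) (at (transition \<phi> W \<psi> x)) \<circ> frechet_derivative (transition \<phi> W \<psi>) (at x)"
proof -
  let ?\<tau> = "transition \<phi> W \<psi>"
  have "frechet_derivative (f \<circ> \<phi>) (at x) = frechet_derivative ((f \<circ> \<psi>) \<circ> ?\<tau>) (at x)"
    by (rule frechet_derivative_cong_open(1)[OF open_overlap[OF assms(1,2)] _ assms(3)])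
      (simp add: chart_transition)
  also have "\<dots> = frechet_derivative (f \<circ> \<psi>) (at (?\<tau> x)) \<circ> frechet_derivative ?\<tau> (at x)"
    using Ck_on_1_has_derivative[OF Ck_on_transition[OF assms(1,2)] assms(3)] assms(4)
    by (intro frechet_derivative_compose) (auto simp: differentiable_def)
  finally show ?thesis .
qed

text \<open>The chain rule writes the tangent vectors of one chart in those of the other, and their
  cross product picks up the Jacobian determinant of the transition.\<close>

lemma area_density_transition:
  assumes "(V, \<phi>) \<in> atlas" "(W, \<psi>) \<in> atlas" "x \<in> overlap V \<phi> W \<psi>"
  shows "area_density (im \<circ> \<phi>) x =
    \<bar>det (matrix (frechet_derivative (transition \<phi> W \<psi>) (at x)))\<bar> * area_density (im \<circ> \<psi>) (transition \<phi> W \<psi> x)"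
proof -
  let ?\<tau> = "transition \<phi> W \<psi>"
  let ?y = "?\<tau> x" and ?T = "frechet_derivative ?\<tau> (at x)"
  let ?L = "frechet_derivative (im \<circ> \<psi>) (at ?y)"
  have d: "(im \<circ> \<psi>) differentiable (at ?y)"
    using Ck_on_1_has_derivative[OF regular_on_Ck_on_1[OF chart_regular[OF assms(2)]] transition_mem[OF assms(3)]]
    by (auto simp: differentiable_def)
  let ?m = "matrix ?T"
  have pd: "pd i (im \<circ> \<phi>) x = ?m $ 1 $ i *\<^sub>R pd 1 (im \<circ> \<psi>) ?y + ?m $ 2 $ i *\<^sub>R pd 2 (im \<circ> \<psi>) ?y" for i
    using linear_real2_eq[OF linear_frechet_derivative[OF d], of "?T (axis i 1)"]
    by (simp add: pd_def frechet_derivative_transition[OF assms d] matrix_def)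
  have "cross3 (pd 1 (im \<circ> \<phi>) x) (pd 2 (im \<circ> \<phi>) x) = det ?m *\<^sub>R cross3 (pd 1 (im \<circ> \<psi>) ?y) (pd 2 (im \<circ> \<psi>) ?y)"
    unfolding pd[of 1] pd[of 2] det_2
    by (simp add: cross_add_left cross_add_right cross_mult_left cross_mult_right algebra_simps
        cross_skew[of "pd 2 (im \<circ> \<psi>) ?y" "pd 1 (im \<circ> \<psi>) ?y"])
  then show ?thesis by (simp add: area_density_eq_norm_cross3)
qed

text \<open>Names the sigma-algebra of \<open>area_measure\<close>, so that measurability can be
  discussed before the measure is known to exist.\<close>

definition surf_borel :: "'a measure" where
  "surf_borel = sigma (topspace X) {U. openin X U}"

lemma space_surf_borel [simp]: "space surf_borel = topspace X"
  and sets_surf_borel: "sets surf_borel = sigma_sets (topspace X) {U. openin X U}"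
proof -
  have "{U. openin X U} \<subseteq> Pow (topspace X)" using openin_subset by auto
  then show "space surf_borel = topspace X" "sets surf_borel = sigma_sets (topspace X) {U. openin X U}"
    by (simp_all add: surf_borel_def)
qed

lemma openin_sets_surf_borel: "openin X U \<Longrightarrow> U \<in> sets surf_borel"
  by (auto simp: sets_surf_borel)

lemma chart_measurable:
  assumes "(V, \<phi>) \<in> atlas" "S \<in> sets surf_borel"
  shows "{x\<in>V. \<phi> x \<in> S} \<in> sets borel"
proof -
  have V: "V \<in> sets borel" using chart_open[OF assms(1)] by simp
  have eq: "\<phi> -` S \<inter> V = {x\<in>V. \<phi> x \<in> S}" for S by auto
  have "\<phi> \<in> measurable (restrict_space borel V) surf_borel"
    unfolding surf_borel_def
  proof (rule measurable_measure_of)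
    show "{U. openin X U} \<subseteq> Pow (topspace X)" using openin_subset by auto
    show "\<phi> \<in> space (restrict_space borel V) \<rightarrow> topspace X"
      using chart_in_topspace[OF assms(1)] by (auto simp: space_restrict_space)
    show "\<phi> -` U \<inter> space (restrict_space borel V) \<in> sets (restrict_space borel V)" if "U \<in> {U. openin X U}" for U
      using chart_open_preimage[OF assms(1)] that V by (auto simp: eq sets_restrict_space_iff)
  qed
  from measurable_sets[OF this assms(2)] show ?thesis
    using V by (simp add: eq sets_restrict_space_iff)
qed

text \<open>The image is a preimage under the inverse chart, which is measurable because charts map
  open sets to open sets.\<close>

lemma chart_image_sets:
  assumes "(V, \<phi>) \<in> atlas" "B \<in> sets borel" "B \<subseteq> V"
  shows "\<phi> ` B \<in> sets surf_borel"
proof -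
  let ?N = "restrict_space surf_borel (\<phi> ` V)"
  have im: "\<phi> ` V \<in> sets surf_borel"
    by (rule openin_sets_surf_borel[OF chart_image_openin[OF assms(1)]])
  have sp: "space ?N = \<phi> ` V" using chart_in_topspace[OF assms(1)] by (auto simp: space_restrict_space)
  have img: "\<phi> ` V \<inter> space surf_borel = \<phi> ` V" using chart_in_topspace[OF assms(1)] by auto
  have inv: "inv_into V \<phi> -` U \<inter> \<phi> ` V = \<phi> ` (U \<inter> V)" for U
    using chart_inj[OF assms(1)] by (auto simp: inv_into_f_f)
  have "inv_into V \<phi> \<in> borel_measurable ?N"
  proof (rule borel_measurableI)
    fix U :: "(real^2) set" assume "open U"
    then have "openin X (\<phi> ` (U \<inter> V))"
      using chart_open[OF assms(1)] by (intro chart_openin_image[OF assms(1)]) auto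
    then have "\<phi> ` (U \<inter> V) \<in> sets surf_borel" by (rule openin_sets_surf_borel)
    then show "inv_into V \<phi> -` U \<inter> space ?N \<in> sets ?N"
      unfolding sp inv using im img by (subst sets_restrict_space_iff) auto
  qed
  from measurable_sets[OF this assms(2)] have "\<phi> ` (B \<inter> V) \<in> sets ?N" unfolding sp inv .
  then show ?thesis
    using im img assms(3) by (subst (asm) sets_restrict_space_iff) (auto simp: Int_absorb2)
qed

definition chart_measure :: "(real^2) set \<times> (real^2 \<Rightarrow> 'a) \<Rightarrow> (real^2) measure" where
  "chart_measure = (\<lambda>(V, \<phi>). density lborel (\<lambda>x. ennreal (indicator V x * area_density (im \<circ> \<phi>) x)))"

text \<open>The area of the part of \<open>S\<close> inside one chart. It is defined on all of the
  surface so that areas of pieces from different charts can be summed.\<close>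

definition chart_area :: "(real^2) set \<times> (real^2 \<Rightarrow> 'a) \<Rightarrow> 'a set \<Rightarrow> ennreal" where
  "chart_area = (\<lambda>(V, \<phi>) S. emeasure (chart_measure (V, \<phi>)) {x\<in>V. \<phi> x \<in> S})"

lemma sets_chart_measure [simp]: "sets (chart_measure c) = sets borel"
  by (cases c) (simp add: chart_measure_def)

lemma area_density_measurable:
  assumes "(V, \<phi>) \<in> atlas" "B \<in> sets borel" "B \<subseteq> V"
  shows "(\<lambda>x. indicator B x * area_density (im \<circ> \<phi>) x) \<in> borel_measurable borel"
  using borel_measurable_continuous_on_indicator[OF assms(2) continuous_on_subset[OF
      regular_on_continuous_area_density[OF chart_regular[OF assms(1)]] assms(3)]] by simp

lemma chart_area_eq:
  assumes "(V, \<phi>) \<in> atlas" "B \<in> sets borel" "B \<subseteq> V"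
  shows "emeasure (chart_measure (V, \<phi>)) B = (\<integral>\<^sup>+x\<in>B. ennreal (area_density (im \<circ> \<phi>) x) \<partial>lborel)"
proof -
  have "V \<in> sets borel" using chart_open[OF assms(1)] by simp
  then have "emeasure (chart_measure (V, \<phi>)) B =
      (\<integral>\<^sup>+x\<in>B. ennreal (indicator V x * area_density (im \<circ> \<phi>) x) \<partial>lborel)"
    using area_density_measurable[OF assms(1) _ order_refl] assms(2)
    by (simp add: chart_measure_def emeasure_density)
  also have "\<dots> = (\<integral>\<^sup>+x\<in>B. ennreal (area_density (im \<circ> \<phi>) x) \<partial>lborel)"
    using assms(3) by (intro nn_integral_cong) (auto simp: indicator_def)
  finally show ?thesis .
qed

lemma chart_area_suminf:
  assumes "(V, \<phi>) \<in> atlas" "range S \<subseteq> sets surf_borel" "disjoint_family S"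
  shows "(\<Sum>i. chart_area (V, \<phi>) (S i)) = chart_area (V, \<phi>) (\<Union>i. S i)"
proof -
  have "{x\<in>V. \<phi> x \<in> (\<Union>i. S i)} = (\<Union>i. {x\<in>V. \<phi> x \<in> S i})" by auto
  moreover have "disjoint_family (\<lambda>i. {x\<in>V. \<phi> x \<in> S i})"
    using assms(3) by (fastforce simp: disjoint_family_on_def)
  ultimately show ?thesis
    using assms(2) chart_measurable[OF assms(1)]
    by (simp add: chart_area_def) (intro suminf_emeasure, auto)
qed

text \<open>Change of variables along the transition map; its Jacobian factor is exactly the one by
  which the area densities differ.\<close>

lemma chart_area_compatible:
  assumes "(V, \<phi>) \<in> atlas" "(W, \<psi>) \<in> atlas" "S \<in> sets surf_borel" "S \<subseteq> \<phi> ` V" "S \<subseteq> \<psi> ` W"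
  shows "chart_area (V, \<phi>) S = chart_area (W, \<psi>) S"
proof -
  let ?\<tau> = "transition \<phi> W \<psi>"
  let ?B = "{x\<in>V. \<phi> x \<in> S}" and ?C = "{y\<in>W. \<psi> y \<in> S}"
  have B: "?B \<in> sets borel" "?C \<in> sets borel" using assms chart_measurable by blast+
  have sub: "?B \<subseteq> overlap V \<phi> W \<psi>" using assms(5) by (auto simp: overlap_def)
  have img: "?\<tau> ` ?B = ?C"
  proof
    show "?\<tau> ` ?B \<subseteq> ?C"
    proof (rule image_subsetI)
      fix x assume x: "x \<in> ?B"
      then show "?\<tau> x \<in> ?C"
        using transition_mem[OF subsetD[OF sub x]] chart_transition[OF subsetD[OF sub x]] by simp
    qed
    show "?C \<subseteq> ?\<tau> ` ?B"
    proof
      fix y assume y: "y \<in> ?C"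
      then have "\<psi> y \<in> \<phi> ` V" using assms(4) by blast
      then obtain x where x: "x \<in> V" "\<psi> y = \<phi> x" by blast
      have "?\<tau> x = y" using transition_eq[OF assms(2), of y \<phi> x] x(2) y by blast
      moreover have "x \<in> ?B" using x y by auto
      ultimately show "y \<in> ?\<tau> ` ?B" by blast
    qed
  qed
  let ?d = "\<lambda>x. \<bar>det (matrix (frechet_derivative ?\<tau> (at x)))\<bar> * area_density (im \<circ> \<psi>) (?\<tau> x)"
  have d: "?d x = area_density (im \<circ> \<phi>) x" if "x \<in> ?B" for x
    using area_density_transition[OF assms(1,2) subsetD[OF sub that]] by simp
  have "chart_area (W, \<psi>) S = (\<integral>\<^sup>+y\<in>?\<tau> ` ?B. ennreal (area_density (im \<circ> \<psi>) y) \<partial>lborel)"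
    unfolding img chart_area_def prod.case by (rule chart_area_eq[OF assms(2) B(2)]) auto
  also have "\<dots> = (\<integral>\<^sup>+x\<in>?B. ennreal (?d x) \<partial>lborel)"
  proof (rule nn_integral_change_of_variables[OF B(1)])
    show "(?\<tau> has_derivative frechet_derivative ?\<tau> (at x)) (at x within ?B)" if "x \<in> ?B" for x
      by (rule has_derivative_at_withinI[OF Ck_on_1_has_derivative[OF Ck_on_transition[OF assms(1,2)] subsetD[OF sub that]]])
    show "inj_on ?\<tau> ?B" using inj_on_transition[OF assms(1)] sub inj_on_subset by blast
    show "(\<lambda>y. indicator (?\<tau> ` ?B) y * area_density (im \<circ> \<psi>) y) \<in> borel_measurable borel"
      unfolding img by (rule area_density_measurable[OF assms(2) B(2)]) auto
    have "(\<lambda>x. indicator ?B x * ?d x) = (\<lambda>x. indicator ?B x * area_density (im \<circ> \<phi>) x)"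
      using d by (auto simp: indicator_def fun_eq_iff)
    then show "(\<lambda>x. indicator ?B x * ?d x) \<in> borel_measurable borel"
      using area_density_measurable[OF assms(1) B(1)] by simp
    show "0 \<le> area_density (im \<circ> \<psi>) y" for y by (simp add: area_density_eq_norm_cross3)
  qed
  also have "\<dots> = (\<integral>\<^sup>+x\<in>?B. ennreal (area_density (im \<circ> \<phi>) x) \<partial>lborel)"
    using d by (intro nn_integral_cong) (auto simp: indicator_def)
  also have "\<dots> = chart_area (V, \<phi>) S"
    unfolding chart_area_def prod.case by (rule chart_area_eq[OF assms(1) B(1), symmetric]) auto
  finally show ?thesis by simp
qed

text \<open>Second countability makes the surface a Lindelof space. Countability matters because
  area is assembled as a series over charts.\<close>

lemma countable_atlas:
  "\<exists>c :: nat \<Rightarrow> (real^2) set \<times> (real^2 \<Rightarrow> 'a). range c \<subseteq> atlas \<and> (\<Union>n. snd (c n) ` fst (c n)) = topspace X"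
proof -
  have "Lindelof_space X"
    using immersed second_countable_imp_Lindelof_space by (auto simp: immersed_surface_def smooth_manifold2_def)
  moreover have "\<forall>U\<in>(\<lambda>c. snd c ` fst c) ` atlas. openin X U" using chart_image_openin by auto
  moreover have un: "\<Union>((\<lambda>c. snd c ` fst c) ` atlas) = topspace X" using atlas_cover by (simp add: case_prod_unfold)
  ultimately obtain \<V> where \<V>: "countable \<V>" "\<V> \<subseteq> (\<lambda>c. snd c ` fst c) ` atlas" "\<Union>\<V> = topspace X"
    unfolding Lindelof_space_def by meson
  then obtain C where C: "countable C" "C \<subseteq> atlas" "\<V> = (\<lambda>c. snd c ` fst c) ` C"
    using countable_subset_image[of \<V> "\<lambda>c. snd c ` fst c" atlas] by blast
  have "topspace X \<noteq> {}" using immersed unfolding immersed_surface_def by blast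
  then have "C \<noteq> {}" using C(3) \<V>(3) by blast
  then have rg: "range (from_nat_into C) = C" using C(1) by (rule range_from_nat_into)
  have "(\<Union>n. snd (from_nat_into C n) ` fst (from_nat_into C n)) = \<Union>((\<lambda>c. snd c ` fst c) ` range (from_nat_into C))"
    by (simp add: image_image)
  then show ?thesis using C \<V>(3) rg by (intro exI[of _ "from_nat_into C"]) simp_all
qed

text \<open>The predicate under the definite description in \<open>area_measure\<close>, repeated so
  that \<open>theI'\<close> applies to it.\<close>

definition is_area_measure :: "'a measure \<Rightarrow> bool" where
  "is_area_measure \<mu> \<longleftrightarrow> space \<mu> = surf_points M \<and>
     sets \<mu> = sigma_sets (surf_points M) {U. openin (surf_topology M) U} \<and>
     (\<forall>(V,\<phi>)\<in>parametrizations M. \<forall>B\<in>sets borel. B \<subseteq> V \<longrightarrow>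
        emeasure \<mu> (\<phi> ` B) =
          (\<integral>\<^sup>+x\<in>B. ennreal (area_density (immersion M \<circ> \<phi>) x) \<partial>lborel))"

lemma is_area_measure_emeasure:
  assumes "is_area_measure \<mu>" "c \<in> atlas" "S \<in> sets surf_borel" "S \<subseteq> snd c ` fst c"
  shows "emeasure \<mu> S = chart_area c S"
proof -
  obtain V \<phi> where c: "c = (V, \<phi>)" by (cases c)
  let ?B = "{x\<in>V. \<phi> x \<in> S}"
  have V: "(V, \<phi>) \<in> atlas" and S: "S \<subseteq> \<phi> ` V" using assms(2,4) c by auto
  have B: "?B \<in> sets borel" by (rule chart_measurable[OF V assms(3)])
  have "emeasure \<mu> (\<phi> ` ?B) = (\<integral>\<^sup>+x\<in>?B. ennreal (area_density (im \<circ> \<phi>) x) \<partial>lborel)"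
    using assms(1) V B unfolding is_area_measure_def by fastforce
  then show ?thesis
    unfolding chart_image_vimage[OF V S] using chart_area_eq[OF V B] by (auto simp: chart_area_def c)
qed

text \<open>A countable atlas is made disjoint; every area measure is the sum of the chart areas of the
  resulting pieces, which gives existence and uniqueness at once.\<close>

lemma is_area_measure_ex1: "\<exists>!\<mu>. is_area_measure \<mu>"
proof -
  obtain c :: "nat \<Rightarrow> (real^2) set \<times> (real^2 \<Rightarrow> 'a)"
    where c: "range c \<subseteq> atlas" "(\<Union>n. snd (c n) ` fst (c n)) = topspace X"
    using countable_atlas by auto
  define A where "A = disjointed (\<lambda>n. snd (c n) ` fst (c n))"
  have cn: "c n \<in> atlas" for n using c(1) by auto
  have img: "snd (c n) ` fst (c n) \<in> sets surf_borel" for n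
    using cn[of n] chart_image_openin[of "fst (c n)" "snd (c n)"] by (auto intro: openin_sets_surf_borel)
  then have A_sets: "A n \<in> sets surf_borel" for n
    using sets.range_disjointed_sets[of "\<lambda>n. snd (c n) ` fst (c n)" surf_borel] by (auto simp: A_def)
  have A_disj: "disjoint_family A" unfolding A_def by (rule disjoint_family_disjointed)
  have A_un: "(\<Union>n. A n) = topspace X" unfolding A_def using c(2) by (simp add: UN_disjointed_eq)
  have A_sub: "A n \<subseteq> snd (c n) ` fst (c n)" for n unfolding A_def by (rule disjointed_subset)
  define m where "m S = (\<Sum>n. chart_area (c n) (S \<inter> A n))" for S
  have decomp: "S = (\<Union>n. S \<inter> A n)" if "S \<in> sets surf_borel" for S
    using sets.sets_into_space[OF that] A_un by auto
  have piece: "range (\<lambda>n. S \<inter> A n) \<subseteq> sets surf_borel" "disjoint_family (\<lambda>n. S \<inter> A n)" if "S \<in> sets surf_borel" for S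
    using that A_sets A_disj by (auto simp: disjoint_family_on_def)
  have formula: "emeasure \<mu> S = m S" if \<mu>: "is_area_measure \<mu>" and S: "S \<in> sets surf_borel" for \<mu> S
  proof -
    have "sets \<mu> = sets surf_borel" using \<mu> by (simp add: is_area_measure_def sets_surf_borel)
    then have "emeasure \<mu> S = (\<Sum>n. emeasure \<mu> (S \<inter> A n))"
      using suminf_emeasure[of "\<lambda>n. S \<inter> A n" \<mu>] piece[OF S] decomp[OF S] by simp
    also have "\<dots> = m S"
      unfolding m_def using is_area_measure_emeasure[OF \<mu> cn] S A_sets A_sub by (intro suminf_cong) blast
    finally show ?thesis .
  qed
  define \<mu> where "\<mu> = measure_of (topspace X) {U. openin X U} m"
  have sub: "{U. openin X U} \<subseteq> Pow (topspace X)" using openin_subset by auto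
  have sp: "space \<mu> = topspace X" and st: "sets \<mu> = sets surf_borel"
    using sub by (auto simp: \<mu>_def sets_surf_borel)
  have area0: "chart_area d {} = 0" for d by (cases d) (simp add: chart_area_def)
  have em: "emeasure \<mu> S = m S" if "S \<in> sets surf_borel" for S
  proof (rule emeasure_measure_of[OF \<mu>_def sub])
    show "S \<in> sets \<mu>" using that st by simp
    show "positive (sets \<mu>) m" by (auto simp: positive_def m_def area0)
    show "countably_additive (sets \<mu>) m"
      unfolding st
    proof (rule countably_additiveI)
      fix S :: "nat \<Rightarrow> 'a set" assume S: "range S \<subseteq> sets surf_borel" "disjoint_family S"
      have 1: "(\<Sum>i. chart_area (c n) (S i \<inter> A n)) = chart_area (c n) ((\<Union>i. S i) \<inter> A n)" for n
      proof -
        have "range (\<lambda>i. S i \<inter> A n) \<subseteq> sets surf_borel" "disjoint_family (\<lambda>i. S i \<inter> A n)"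
          using S A_sets by (auto simp: disjoint_family_on_def)
        from chart_area_suminf[OF _ this, of "fst (c n)" "snd (c n)"] cn[of n] show ?thesis by simp
      qed
      \<comment> \<open>Countable additivity is an interchange of two series of nonnegative terms,
        carried out by viewing one of them as an integral over the counting measure.\<close>
      have "(\<Sum>i. m (S i)) = (\<Sum>i. \<integral>\<^sup>+n. chart_area (c n) (S i \<inter> A n) \<partial>count_space UNIV)"
        by (simp add: m_def nn_integral_count_space_nat)
      also have "\<dots> = (\<integral>\<^sup>+n. (\<Sum>i. chart_area (c n) (S i \<inter> A n)) \<partial>count_space UNIV)"
        by (rule nn_integral_suminf[symmetric]) simp
      also have "\<dots> = m (\<Union>i. S i)"
        by (simp add: 1 m_def nn_integral_count_space_nat)
      finally show "(\<Sum>i. m (S i)) = m (\<Union>i. S i)" .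
    qed
  qed
  have "is_area_measure \<mu>"
    unfolding is_area_measure_def
  proof (intro conjI ballI impI; clarify?)
    show "space \<mu> = surf_points M" "sets \<mu> = sigma_sets (surf_points M) {U. openin (surf_topology M) U}"
      using sp st by (simp_all add: sets_surf_borel)
    fix V \<phi> B assume V: "(V, \<phi>) \<in> atlas" and B: "B \<in> sets borel" "B \<subseteq> V"
    let ?S = "\<phi> ` B"
    have S: "?S \<in> sets surf_borel" by (rule chart_image_sets[OF V B])
    \<comment> \<open>Each piece lies in both chart images, so the selected chart may be traded for
      an arbitrary one; this gives the density formula in the whole atlas.\<close>
    have "chart_area (c n) (?S \<inter> A n) = chart_area (V, \<phi>) (?S \<inter> A n)" for n
      using chart_area_compatible[of "fst (c n)" "snd (c n)" V \<phi> "?S \<inter> A n"] V cn[of n] S A_sets[of n] A_sub[of n] B(2)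
      by (simp add: le_infI2) (meson image_mono le_infI1)
    then have "emeasure \<mu> ?S = (\<Sum>n. chart_area (V, \<phi>) (?S \<inter> A n))"
      using em[OF S] by (simp add: m_def)
    also have "\<dots> = chart_area (V, \<phi>) ?S"
      using chart_area_suminf[OF V piece[OF S]] decomp[OF S] by simp
    also have "\<dots> = (\<integral>\<^sup>+x\<in>B. ennreal (area_density (immersion M \<circ> \<phi>) x) \<partial>lborel)"
      using chart_area_eq[OF V B] chart_vimage_image[OF V B(2)] by (simp add: chart_area_def)
    finally show "emeasure \<mu> (\<phi> ` B) = (\<integral>\<^sup>+x\<in>B. ennreal (area_density (immersion M \<circ> \<phi>) x) \<partial>lborel)" .
  qed
  moreover have "\<nu> = \<mu>" if "is_area_measure \<nu>" for \<nu>
  proof (rule measure_eqI)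
    have sn: "sets \<nu> = sets surf_borel" using that by (simp add: is_area_measure_def sets_surf_borel)
    then show "sets \<nu> = sets \<mu>" using st by simp
    show "emeasure \<nu> S = emeasure \<mu> S" if "S \<in> sets \<nu>" for S
      using that formula[OF \<open>is_area_measure \<nu>\<close>] em sn by simp
  qed
  ultimately show ?thesis by (rule ex1I)
qed

abbreviation area where "area \<equiv> area_measure M"

lemma is_area_measure_area: "is_area_measure area"
  using theI'[OF is_area_measure_ex1] unfolding is_area_measure_def area_measure_def .

lemma space_area [simp]: "space area = topspace X"
  and sets_area [simp]: "sets area = sets surf_borel"
  using is_area_measure_area by (simp_all add: is_area_measure_def sets_surf_borel)

lemma chart_measurable_area:
  assumes "(V, \<phi>) \<in> atlas"
  shows "\<phi> \<in> measurable (restrict_space (chart_measure (V, \<phi>)) V) (restrict_space area (\<phi> ` V))"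
proof (rule measurableI)
  have V: "V \<in> sets borel" using chart_open[OF assms] by simp
  have sp: "space (chart_measure (V, \<phi>)) = UNIV" by (simp add: chart_measure_def)
  show "\<phi> x \<in> space (restrict_space area (\<phi> ` V))" if "x \<in> space (restrict_space (chart_measure (V, \<phi>)) V)" for x
    using that chart_in_topspace[OF assms] by (auto simp: space_restrict_space)
  fix S assume "S \<in> sets (restrict_space area (\<phi> ` V))"
  then obtain T where T: "T \<in> sets surf_borel" "S = \<phi> ` V \<inter> T" by (auto simp: sets_restrict_space)
  have "\<phi> -` S \<inter> space (restrict_space (chart_measure (V, \<phi>)) V) = {x\<in>V. \<phi> x \<in> T}"
    using T by (auto simp: space_restrict_space sp)
  then show "\<phi> -` S \<inter> space (restrict_space (chart_measure (V, \<phi>)) V) \<in> sets (restrict_space (chart_measure (V, \<phi>)) V)"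
    using chart_measurable[OF assms T(1)] V by (auto simp: sets_restrict_space_iff sp)
qed

text \<open>Turns surface integrals into plane integrals. Both sides are restricted because \<phi>
  is a chart only on \<open>V\<close>.\<close>

lemma distr_chart_measure:
  assumes "(V, \<phi>) \<in> atlas"
  shows "distr (restrict_space (chart_measure (V, \<phi>)) V) (restrict_space area (\<phi> ` V)) \<phi> = restrict_space area (\<phi> ` V)"
proof (rule measure_eqI)
  let ?N = "restrict_space (chart_measure (V, \<phi>)) V" and ?R = "restrict_space area (\<phi> ` V)"
  have V: "V \<in> sets borel" using chart_open[OF assms] by simp
  have img: "\<phi> ` V \<in> sets surf_borel" by (rule openin_sets_surf_borel[OF chart_image_openin[OF assms]])
  have img': "\<phi> ` V \<inter> topspace X = \<phi> ` V" using chart_in_topspace[OF assms] by auto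
  fix S assume "S \<in> sets (distr ?N ?R \<phi>)"
  then have S': "S \<in> sets ?R" by simp
  then have S: "S \<in> sets surf_borel" "S \<subseteq> \<phi> ` V" using img img' by (auto simp: sets_restrict_space_iff)
  have "emeasure (distr ?N ?R \<phi>) S = emeasure ?N (\<phi> -` S \<inter> space ?N)"
    by (rule emeasure_distr[OF chart_measurable_area[OF assms] S'])
  also have "\<phi> -` S \<inter> space ?N = {x\<in>V. \<phi> x \<in> S}"
    by (auto simp: space_restrict_space chart_measure_def)
  also have "emeasure ?N \<dots> = chart_area (V, \<phi>) S"
    unfolding chart_area_def using V by (subst emeasure_restrict_space) (auto simp: chart_measure_def)
  also have "\<dots> = emeasure area S"
    using is_area_measure_emeasure[OF is_area_measure_area assms S(1)] S(2) by simp
  also have "\<dots> = emeasure ?R S"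
    using img img' S(2) by (subst emeasure_restrict_space) auto
  finally show "emeasure (distr ?N ?R \<phi>) S = emeasure ?R S" .
qed simp

lemma
  fixes g :: "'a \<Rightarrow> real"
  assumes V: "(V, \<phi>) \<in> atlas" and g: "g \<in> borel_measurable area" "\<And>p. p \<in> topspace X - \<phi> ` V \<Longrightarrow> g p = 0"
  shows integrable_area_chart:
      "integrable area g \<longleftrightarrow> integrable lborel (\<lambda>x. indicator V x * (area_density (im \<circ> \<phi>) x * g (\<phi> x)))"
    and integral_area_chart:
      "(\<integral>p. g p \<partial>area) = (\<integral>x. indicator V x * (area_density (im \<circ> \<phi>) x * g (\<phi> x)) \<partial>lborel)"
proof -
  let ?C = "chart_measure (V, \<phi>)" and ?R = "restrict_space area (\<phi> ` V)"
  let ?N = "restrict_space ?C V" and ?W = "\<lambda>x. indicator V x * area_density (im \<circ> \<phi>) x"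
  have Vb: "V \<in> sets borel" using chart_open[OF V] by simp
  have Vc: "V \<inter> space ?C \<in> sets ?C" using Vb by (simp add: chart_measure_def)
  have img: "\<phi> ` V \<inter> space area \<in> sets area"
    using openin_sets_surf_borel[OF chart_image_openin[OF V]] chart_in_topspace[OF V] by (simp add: image_subset_iff Int_absorb2)
  have gR: "g \<in> borel_measurable ?R" using g(1) by (rule measurable_restrict_space1)
  have W: "?W \<in> borel_measurable lborel" using area_density_measurable[OF V Vb] by simp
  have nn: "AE x in lborel. 0 \<le> ?W x" by (simp add: area_density_eq_norm_cross3 indicator_def)
  have g\<phi>: "(\<lambda>x. indicator V x *\<^sub>R g (\<phi> x)) \<in> borel_measurable lborel"
  proof -
    have "(\<lambda>x. g (\<phi> x)) \<in> borel_measurable ?N"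
      by (rule measurable_compose[OF chart_measurable_area[OF V] gR])
    then have "(\<lambda>x. indicator V x *\<^sub>R g (\<phi> x)) \<in> borel_measurable ?C"
      unfolding borel_measurable_restrict_space_iff[OF Vc] .
    then show ?thesis by (simp cong: measurable_cong_sets)
  qed
  have C: "?C = density lborel ?W" by (simp add: chart_measure_def)
  have ind: "?W x *\<^sub>R (indicator V x *\<^sub>R g (\<phi> x)) = indicator V x * (area_density (im \<circ> \<phi>) x * g (\<phi> x))" for x
    by (auto simp: indicator_def)
  have eqR: "integrable area g \<longleftrightarrow> integrable ?R g" "(\<integral>p. g p \<partial>area) = (\<integral>p. g p \<partial>?R)"
  proof -
    have "g p = indicator (\<phi> ` V) p *\<^sub>R g p" if "p \<in> space area" for p
      using g(2)[of p] that by (auto simp: indicator_def)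
    then show "integrable area g \<longleftrightarrow> integrable ?R g" "(\<integral>p. g p \<partial>area) = (\<integral>p. g p \<partial>?R)"
      unfolding integrable_restrict_space[OF img] integral_restrict_space[OF img]
      by (auto intro!: Bochner_Integration.integrable_cong Bochner_Integration.integral_cong)
  qed
  have "integrable ?R g \<longleftrightarrow> integrable ?N (\<lambda>x. g (\<phi> x))"
    using integrable_distr_eq[OF chart_measurable_area[OF V] gR] by (simp only: distr_chart_measure[OF V])
  also have "\<dots> \<longleftrightarrow> integrable lborel (\<lambda>x. ?W x *\<^sub>R (indicator V x *\<^sub>R g (\<phi> x)))"
    unfolding integrable_restrict_space[OF Vc] unfolding C by (rule integrable_density[OF g\<phi> W nn])
  finally show "integrable area g \<longleftrightarrow> integrable lborel (\<lambda>x. indicator V x * (area_density (im \<circ> \<phi>) x * g (\<phi> x)))"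
    unfolding eqR ind .
  have "(\<integral>p. g p \<partial>?R) = (\<integral>x. g (\<phi> x) \<partial>?N)"
    using integral_distr[OF chart_measurable_area[OF V] gR] by (simp only: distr_chart_measure[OF V])
  also have "\<dots> = (\<integral>x. ?W x *\<^sub>R (indicator V x *\<^sub>R g (\<phi> x)) \<partial>lborel)"
    unfolding integral_restrict_space[OF Vc] unfolding C by (rule integral_density[OF g\<phi> W nn])
  finally show "(\<integral>p. g p \<partial>area) = (\<integral>x. indicator V x * (area_density (im \<circ> \<phi>) x * g (\<phi> x)) \<partial>lborel)"
    unfolding eqR ind .
qed

end

section \<open>Compactly supported functions on a surface\<close>

lemma chart_grad_inner:
  assumes "regular_on V u" "x \<in> V" "Ck_on 1 V p"
  shows "chart_grad u p x \<bullet> frechet_derivative u (at x) v = frechet_derivative p (at x) v"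
proof -
  have "linear (frechet_derivative u (at x))" "linear (frechet_derivative p (at x))"
    using Ck_on_1_has_derivative[OF regular_on_Ck_on_1[OF assms(1)] assms(2)]
      Ck_on_1_has_derivative[OF assms(3,2)] has_derivative_linear by blast+
  from this[THEN linear_real2_eq, of v] show ?thesis
    using chart_grad_inner_pd[OF assms(1,2), of p 1] chart_grad_inner_pd[OF assms(1,2), of p 2]
    by (simp add: inner_add_right flip: pd_def)
qed

text \<open>Expanding the triple products b \<times> (a \<times> b) and (a \<times> b) \<times> a
  shows that the cofields are combinations of the tangent vectors a and b.\<close>

lemma chart_grad_in_range:
  assumes "regular_on V u" "x \<in> V"
  shows "chart_grad u p x \<in> range (frechet_derivative u (at x))"
proof -
  let ?a = "pd 1 u x" and ?b = "pd 2 u x" and ?W = "area_density u x"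
  have lin: "linear (frechet_derivative u (at x))"
    using Ck_on_1_has_derivative[OF regular_on_Ck_on_1[OF assms(1)] assms(2)] has_derivative_linear by blast
  have sub: "subspace (range (frechet_derivative u (at x)))"
    using linear_subspace_image[OF lin subspace_UNIV] .
  have pd: "pd i u x \<in> range (frechet_derivative u (at x))" for i by (simp add: pd_def)
  have W: "0 < ?W" by (rule regular_on_pos[OF assms])
  have n: "unit_normal u x = (1 / ?W) *\<^sub>R cross3 ?a ?b"
    using W by (simp flip: unit_normal_scaleR)
  have "cofield u 1 x = (1 / ?W) *\<^sub>R ((?b \<bullet> ?b) *\<^sub>R ?a - (?b \<bullet> ?a) *\<^sub>R ?b)"
    unfolding cofield_def n by (simp add: cross_mult_right) (simp add: cross3_simps vec_eq_iff forall_3)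
  moreover have "cofield u 2 x = (1 / ?W) *\<^sub>R ((?a \<bullet> ?a) *\<^sub>R ?b - (?a \<bullet> ?b) *\<^sub>R ?a)"
    unfolding cofield_def n by (simp add: cross_mult_left) (simp add: cross3_simps vec_eq_iff forall_3)
  ultimately show ?thesis
    unfolding chart_grad_def by (simp only:)
      (intro subspace_scale[OF sub] subspace_add[OF sub] subspace_diff[OF sub] pd)
qed

text \<open>Such a z may differ from the gradient of q by a normal vector, which tangent vectors do
  not see. It will be used for z = 2 (im p - a), the ambient gradient of the squared
  distance.\<close>

lemma chart_grad_tangent_inner:
  assumes "regular_on V u" "x \<in> V" "Ck_on 1 V q" "\<And>v. z \<bullet> frechet_derivative u (at x) v = frechet_derivative q (at x) v"
  shows "chart_grad u p x \<bullet> z = chart_grad u p x \<bullet> chart_grad u q x"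
proof -
  obtain v where "chart_grad u p x = frechet_derivative u (at x) v"
    using chart_grad_in_range[OF assms(1,2)] by blast
  then show ?thesis
    using assms(4)[of v] chart_grad_inner[OF assms(1-3), of v] by (simp add: inner_commute)
qed

text \<open>Young's inequality with weight e. The leading factor tends to 1 with e, so no constant
  is lost when passing to the completion.\<close>

lemma power2_norm_perturb:
  fixes a b :: "'b::real_inner"
  assumes "0 < e"
  shows "(norm a)\<^sup>2 \<le> (1 + e) * (norm b)\<^sup>2 + (1 + 1 / e) * (norm (a - b))\<^sup>2"
proof -
  have "norm a \<le> norm b + norm (a - b)" by (metis add.commute diff_add_cancel norm_triangle_ineq)
  then have "(norm a)\<^sup>2 \<le> (norm b + norm (a - b))\<^sup>2" by (intro power_mono) auto
  also have "\<dots> \<le> (1 + e) * (norm b)\<^sup>2 + (1 + 1 / e) * (norm (a - b))\<^sup>2"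
  proof -
    have "0 \<le> (e * norm b - norm (a - b))\<^sup>2 / e" using assms by simp
    also have "\<dots> = e * (norm b)\<^sup>2 - 2 * norm b * norm (a - b) + (norm (a - b))\<^sup>2 / e"
      using assms by (simp add: power2_eq_square field_simps)
    finally show ?thesis by (simp add: power2_eq_square algebra_simps)
  qed
  finally show ?thesis .
qed

lemma integral_power2_norm_perturb:
  fixes F G :: "'c \<Rightarrow> 'b::euclidean_space"
  assumes m: "F \<in> borel_measurable N" "G \<in> borel_measurable N"
    and i: "integrable N (\<lambda>p. (norm (F p))\<^sup>2)" "integrable N (\<lambda>p. (norm (G p))\<^sup>2)"
    and "0 < e"
  shows "(\<integral>p. (norm (F p))\<^sup>2 \<partial>N) \<le>
      (1 + e) * (\<integral>p. (norm (G p))\<^sup>2 \<partial>N) + (1 + 1 / e) * (\<integral>p. (norm (F p - G p))\<^sup>2 \<partial>N)"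
proof -
  have d: "integrable N (\<lambda>p. (norm (F p - G p))\<^sup>2)"
  proof (rule Bochner_Integration.integrable_bound)
    show "integrable N (\<lambda>p. 2 * (norm (F p))\<^sup>2 + 2 * (norm (G p))\<^sup>2)" using i by simp
    show "(\<lambda>p. (norm (F p - G p))\<^sup>2) \<in> borel_measurable N" using m by measurable
    have "(norm (F p - G p))\<^sup>2 \<le> 2 * (norm (F p))\<^sup>2 + 2 * (norm (G p))\<^sup>2" for p
      using power2_norm_perturb[of 1 "F p - G p" "F p"] by simp
    then show "AE p in N. norm ((norm (F p - G p))\<^sup>2) \<le> norm (2 * (norm (F p))\<^sup>2 + 2 * (norm (G p))\<^sup>2)"
      by simp
  qed
  have "(\<integral>p. (norm (F p))\<^sup>2 \<partial>N) \<le> (\<integral>p. (1 + e) * (norm (G p))\<^sup>2 + (1 + 1 / e) * (norm (F p - G p))\<^sup>2 \<partial>N)"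
    using i d \<open>0 < e\<close> by (intro integral_mono power2_norm_perturb) auto
  then show "(\<integral>p. (norm (F p))\<^sup>2 \<partial>N) \<le>
      (1 + e) * (\<integral>p. (norm (G p))\<^sup>2 \<partial>N) + (1 + 1 / e) * (\<integral>p. (norm (F p - G p))\<^sup>2 \<partial>N)"
    using i d by simp
qed

context immersed begin

definition surf_Ck :: "nat \<Rightarrow> ('a \<Rightarrow> real) \<Rightarrow> bool" where
  "surf_Ck k f \<longleftrightarrow> (\<forall>(V, \<phi>)\<in>atlas. Ck_on k V (f \<circ> \<phi>))"

text \<open>Finite orders are kept because k = 0 is used for integrands such as the squared
  gradient, for which only continuity is established, and k = 1 for the functions tested in Barta's
  argument.\<close>

definition surf_Ckc :: "nat \<Rightarrow> ('a \<Rightarrow> real) \<Rightarrow> bool" where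
  "surf_Ckc k f \<longleftrightarrow> surf_Ck k f \<and> (\<exists>K. compactin X K \<and> (\<forall>p\<in>topspace X - K. f p = 0))"

lemma surf_CkD: "surf_Ck k f \<Longrightarrow> (V, \<phi>) \<in> atlas \<Longrightarrow> Ck_on k V (f \<circ> \<phi>)"
  by (auto simp: surf_Ck_def)

lemma topspaceE:
  assumes "p \<in> topspace X"
  obtains V \<phi> x where "(V, \<phi>) \<in> atlas" "x \<in> V" "p = \<phi> x"
  using assms atlas_cover by blast

lemma measurable_area_chartwise:
  fixes g :: "'a \<Rightarrow> 'b::topological_space"
  assumes "\<And>V \<phi>. (V, \<phi>) \<in> atlas \<Longrightarrow> continuous_on V (g \<circ> \<phi>)"
  shows "g \<in> borel_measurable area"
proof (rule borel_measurableI)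
  fix U :: "'b set" assume U: "open U"
  have "g -` U \<inter> topspace X = (\<Union>(V, \<phi>)\<in>atlas. \<phi> ` {x\<in>V. g (\<phi> x) \<in> U})"
    unfolding atlas_cover[symmetric] by auto
  moreover have "openin X (\<phi> ` {x\<in>V. g (\<phi> x) \<in> U})" if "(V, \<phi>) \<in> atlas" for V \<phi>
  proof (rule chart_openin_image[OF that])
    have "open ((g \<circ> \<phi>) -` U \<inter> V)"
      using continuous_open_preimage[OF assms[OF that] chart_open[OF that] U] by (simp add: Int_commute)
    moreover have "(g \<circ> \<phi>) -` U \<inter> V = {x\<in>V. g (\<phi> x) \<in> U}" by auto
    ultimately show "open {x\<in>V. g (\<phi> x) \<in> U}" by simp
  qed auto
  ultimately have "openin X (g -` U \<inter> topspace X)" by auto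
  then show "g -` U \<inter> space area \<in> sets area" using openin_sets_surf_borel by simp
qed

lemma surf_Ck_measurable: "surf_Ck k g \<Longrightarrow> g \<in> borel_measurable area"
  using surf_CkD Ck_on_imp_continuous_on by (blast intro: measurable_area_chartwise)

text \<open>\<open>surf_grad\<close> quantifies over all charts through the point, so the vector
  computed in one chart has to be checked in every other. Uniqueness holds because the difference of
  two candidates is tangent and orthogonal to the tangent plane.\<close>

lemma surf_grad_chart:
  assumes f: "surf_Ck 1 f" and V: "(V, \<phi>) \<in> atlas" "x \<in> V"
  shows "surf_grad M f (\<phi> x) = chart_grad (im \<circ> \<phi>) (f \<circ> \<phi>) x"
  unfolding surf_grad_def
proof (rule the_equality)
  let ?w = "chart_grad (im \<circ> \<phi>) (f \<circ> \<phi>) x"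
  note inner = chart_grad_inner[OF chart_regular[OF V(1)] V(2) surf_CkD[OF f V(1)]]
  note range = chart_grad_in_range[OF chart_regular[OF V(1)] V(2)]
  have diff: "(im \<circ> \<psi>) differentiable (at y)" "(f \<circ> \<psi>) differentiable (at y)"
    if "(W, \<psi>) \<in> atlas" "y \<in> W" for W \<psi> y
    using Ck_on_1_has_derivative[OF regular_on_Ck_on_1[OF chart_regular[OF that(1)]] that(2)]
      Ck_on_1_has_derivative[OF surf_CkD[OF f that(1)] that(2)] by (auto simp: differentiable_def)
  show "\<forall>(W, \<psi>)\<in>atlas. \<forall>y\<in>W. \<psi> y = \<phi> x \<longrightarrow>
       ?w \<in> range (frechet_derivative (im \<circ> \<psi>) (at y)) \<and>
       (\<forall>v. ?w \<bullet> frechet_derivative (im \<circ> \<psi>) (at y) v = frechet_derivative (f \<circ> \<psi>) (at y) v)"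
  proof (intro ballI impI allI; clarify)
    fix W \<psi> y assume W: "(W, \<psi>) \<in> atlas" "y \<in> W" and eq: "\<psi> y = \<phi> x"
    \<comment> \<open>Both directions are used: tangency follows from the transition from
      \<open>V\<close> to \<open>W\<close>, the inner products from the one back.\<close>
    have ov: "x \<in> overlap V \<phi> W \<psi>" "y \<in> overlap W \<psi> V \<phi>"
      using V(2) W(2) eq by (auto simp: overlap_def image_iff) metis+
    have tr: "transition \<phi> W \<psi> x = y" "transition \<psi> V \<phi> y = x"
      using transition_eq[OF W(1), of y \<phi> x] transition_eq[OF V(1), of x \<psi> y] V(2) W(2) eq by auto
    have "?w \<in> range (frechet_derivative (im \<circ> \<psi>) (at y))"
      using range diff(1)[OF W] frechet_derivative_transition[OF V(1) W(1) ov(1), of im] by (auto simp: tr)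
    moreover have "?w \<bullet> frechet_derivative (im \<circ> \<psi>) (at y) v = frechet_derivative (f \<circ> \<psi>) (at y) v" for v
      using inner diff[OF V] frechet_derivative_transition[OF W(1) V(1) ov(2), of im]
        frechet_derivative_transition[OF W(1) V(1) ov(2), of f] by (simp add: tr)
    ultimately show "?w \<in> range (frechet_derivative (im \<circ> \<psi>) (at y)) \<and>
       (\<forall>v. ?w \<bullet> frechet_derivative (im \<circ> \<psi>) (at y) v = frechet_derivative (f \<circ> \<psi>) (at y) v)" by blast
  qed
  fix w
  assume "\<forall>(W, \<psi>)\<in>atlas. \<forall>y\<in>W. \<psi> y = \<phi> x \<longrightarrow>
       w \<in> range (frechet_derivative (im \<circ> \<psi>) (at y)) \<and>
       (\<forall>v. w \<bullet> frechet_derivative (im \<circ> \<psi>) (at y) v = frechet_derivative (f \<circ> \<psi>) (at y) v)"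
  then have w: "w \<in> range (frechet_derivative (im \<circ> \<phi>) (at x))"
    "w \<bullet> frechet_derivative (im \<circ> \<phi>) (at x) v = frechet_derivative (f \<circ> \<phi>) (at x) v" for v
    using V by blast+
  have "subspace (range (frechet_derivative (im \<circ> \<phi>) (at x)))"
    by (rule linear_subspace_image[OF linear_frechet_derivative[OF diff(1)[OF V]] subspace_UNIV])
  then have "w - ?w \<in> range (frechet_derivative (im \<circ> \<phi>) (at x))"
    using w(1) range by (rule subspace_diff)
  then obtain v where v: "w - ?w = frechet_derivative (im \<circ> \<phi>) (at x) v" by blast
  have "(w - ?w) \<bullet> (w - ?w) = (w - ?w) \<bullet> frechet_derivative (im \<circ> \<phi>) (at x) v" using v by (rule arg_cong)
  also have "\<dots> = 0" using w(2)[of v] inner[of v] by (simp add: inner_diff_left)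
  finally show "w = ?w" by simp
qed

lemma continuous_on_surf_grad:
  assumes "surf_Ck 1 f" "(V, \<phi>) \<in> atlas"
  shows "continuous_on V (\<lambda>x. surf_grad M f (\<phi> x))"
  using continuous_on_chart_grad[OF chart_regular[OF assms(2)] surf_CkD[OF assms]]
  by (rule continuous_on_eq) (simp add: surf_grad_chart[OF assms])

lemma surf_grad_eq_0:
  assumes f: "surf_Ck 1 f" and K: "compactin X K" "\<And>p. p \<in> topspace X - K \<Longrightarrow> f p = 0"
    and p: "p \<in> topspace X - K"
  shows "surf_grad M f p = 0"
proof -
  obtain V \<phi> x where V: "(V, \<phi>) \<in> atlas" "x \<in> V" "p = \<phi> x" using p topspaceE by blast
  let ?T = "{x\<in>V. \<phi> x \<in> topspace X - K}"
  have T: "open ?T"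
    using compactin_imp_closedin[OF Hausdorff K(1)] by (intro chart_open_preimage[OF V(1)]) blast
  have "pd i (f \<circ> \<phi>) x = pd i (\<lambda>_. 0) x" for i
    by (rule pd_cong_open[OF T]) (use K(2) V p in auto)
  then have "chart_grad (im \<circ> \<phi>) (f \<circ> \<phi>) x = 0" by (simp add: chart_grad_def pd_def)
  then show ?thesis using surf_grad_chart[OF f V(1,2)] V(3) by simp
qed

section \<open>Bump functions and partitions of unity on the surface\<close>

lemma surf_Ck_mult: "surf_Ck k f \<Longrightarrow> surf_Ck k g \<Longrightarrow> surf_Ck k (\<lambda>p. f p * g p)"
  unfolding surf_Ck_def by (auto intro!: Ck_on_mult chart_open simp: o_def)

lemma surf_Ck_sum: "(\<And>i. i \<in> I \<Longrightarrow> surf_Ck k (f i)) \<Longrightarrow> surf_Ck k (\<lambda>p. \<Sum>i\<in>I. f i p)"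
  unfolding surf_Ck_def by (auto intro!: Ck_on_sum chart_open simp: o_def)

text \<open>The support is prescribed by a compact set of the plane, because integration by parts
  takes place there.\<close>

definition chart_supported :: "('a \<Rightarrow> real) \<Rightarrow> bool" where
  "chart_supported f \<longleftrightarrow> (\<exists>V \<phi> C. (V, \<phi>) \<in> atlas \<and> compact C \<and> C \<subseteq> V \<and> (\<forall>p\<in>topspace X - \<phi> ` C. f p = 0))"

lemma chart_compact_image:
  assumes "(V, \<phi>) \<in> atlas" "compact C" "C \<subseteq> V"
  shows "compactin X (\<phi> ` C)"
  by (rule image_compactin[OF _ chart_continuous_map[OF assms(1)]])
    (use assms in \<open>simp add: compactin_subtopology compactin_euclidean_iff\<close>)

lemma chart_supported_Ckc: "surf_Ck k f \<Longrightarrow> chart_supported f \<Longrightarrow> surf_Ckc k f"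
  unfolding chart_supported_def surf_Ckc_def using chart_compact_image by meson

definition surf_bump :: "(real^2) set \<Rightarrow> (real^2 \<Rightarrow> 'a) \<Rightarrow> real^2 \<Rightarrow> real \<Rightarrow> 'a \<Rightarrow> real" where
  "surf_bump V \<phi> x e p = (if p \<in> \<phi> ` V then bump x e (inv_into V \<phi> p) else 0)"

context
  fixes V \<phi> x and e :: real
  assumes V: "(V, \<phi>) \<in> atlas" and e: "0 < e" "cball x e \<subseteq> V"
begin

lemma surf_bump_chart: "y \<in> V \<Longrightarrow> surf_bump V \<phi> x e (\<phi> y) = bump x e y"
  using chart_inj[OF V] by (simp add: surf_bump_def inv_into_f_f)

lemma surf_bump_eq_0: "p \<notin> \<phi> ` ball x e \<Longrightarrow> surf_bump V \<phi> x e p = 0"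
proof (cases "p \<in> \<phi> ` V")
  case True
  then obtain y where y: "y \<in> V" "p = \<phi> y" by blast
  assume "p \<notin> \<phi> ` ball x e"
  then have "y \<notin> ball x e" using y(2) by blast
  then show ?thesis using surf_bump_chart[OF y(1)] bump_eq_0[OF e(1)] y(2) by simp
qed (simp add: surf_bump_def)

lemma surf_bump_pos: "p \<in> \<phi> ` ball x e \<Longrightarrow> 0 < surf_bump V \<phi> x e p"
proof -
  assume "p \<in> \<phi> ` ball x e"
  then obtain y where "y \<in> ball x e" "p = \<phi> y" by blast
  moreover have "y \<in> V" using calculation(1) e(2) by auto
  ultimately show ?thesis using surf_bump_chart bump_pos_iff[OF e(1), of x] by simp
qed

lemma surf_bump_nonneg: "0 \<le> surf_bump V \<phi> x e p"
  by (simp add: surf_bump_def bump_nonneg)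

lemma surf_bump_supported: "chart_supported (surf_bump V \<phi> x e)"
  unfolding chart_supported_def
  using V e surf_bump_eq_0 image_mono[OF ball_subset_cball] by (meson DiffD2 compact_cball subsetD)

text \<open>Extension by 0 is smooth since the image of the closed ball is compact, hence closed in
  a Hausdorff surface: every point outside the chart image has a neighbourhood on which the bump
  vanishes.\<close>

lemma surf_Ck_bump: "surf_Ck k (surf_bump V \<phi> x e)"
  unfolding surf_Ck_def
proof (clarify)
  fix W \<psi> assume W: "(W, \<psi>) \<in> atlas"
  show "Ck_on k W (surf_bump V \<phi> x e \<circ> \<psi>)"
  proof (rule Ck_on_local)
    fix y assume y: "y \<in> W"
    show "\<exists>T. open T \<and> y \<in> T \<and> Ck_on k T (surf_bump V \<phi> x e \<circ> \<psi>)"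
    proof (cases "\<psi> y \<in> \<phi> ` V")
      case True
      let ?T = "overlap W \<psi> V \<phi>"
      have T: "open ?T" by (rule open_overlap[OF W V])
      have "Ck_on k ?T (\<lambda>y. bump x e (transition \<psi> V \<phi> y))"
        by (rule Ck_on_compose[OF T open_UNIV _ Ck_on_transition[OF W V] Ck_on_bump]) simp
      then have "Ck_on k ?T (surf_bump V \<phi> x e \<circ> \<psi>)"
        by (subst Ck_on_cong[OF T, where g="\<lambda>y. bump x e (transition \<psi> V \<phi> y)"])
          (auto simp: surf_bump_def overlap_def transition_def)
      then show ?thesis using T y True by (auto simp: overlap_def)
    next
      case False
      let ?T = "{y\<in>W. \<psi> y \<in> topspace X - \<phi> ` cball x e}"
      have "closedin X (\<phi> ` cball x e)"
        using chart_compact_image[OF V compact_cball e(2)] compactin_imp_closedin[OF Hausdorff] by blast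
      then have T: "open ?T" by (intro chart_open_preimage[OF W]) blast
      have "\<phi> ` ball x e \<subseteq> \<phi> ` cball x e" by (rule image_mono[OF ball_subset_cball])
      then have "(surf_bump V \<phi> x e \<circ> \<psi>) y = 0" if "y \<in> ?T" for y
        using that by (auto intro!: surf_bump_eq_0 simp del: mem_ball mem_cball)
      then have "Ck_on k ?T (surf_bump V \<phi> x e \<circ> \<psi>)"
        using Ck_on_cong[OF T, of _ "\<lambda>_. 0"] Ck_on_const by blast
      moreover have "y \<in> ?T" using False y e(2) chart_in_topspace[OF W y] by auto
      ultimately show ?thesis using T by blast
    qed
  qed
qed

end

text \<open>Finitely many images of coordinate balls cover \<open>K\<close>, and bumps are
  nonnegative, so one positive bump at each point suffices. Normalisation is postponed.\<close>

lemma bump_family: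
  assumes "compactin X K"
  obtains I where "finite I" "\<And>\<beta> k. \<beta> \<in> I \<Longrightarrow> surf_Ck k \<beta>" "\<And>\<beta>. \<beta> \<in> I \<Longrightarrow> chart_supported \<beta>"
    "\<And>p. p \<in> K \<Longrightarrow> 0 < (\<Sum>\<beta>\<in>I. \<beta> p)"
proof -
  define J where "J = {(V, \<phi>, x, e). (V, \<phi>) \<in> atlas \<and> 0 < e \<and> cball x e \<subseteq> V}"
  let ?U = "\<lambda>(V, \<phi>, x, e). \<phi> ` ball x e :: 'a set"
  let ?\<beta> = "\<lambda>(V, \<phi>, x, e). surf_bump V \<phi> x e"
  have "\<exists>j\<in>J. p \<in> ?U j" if p: "p \<in> topspace X" for p
  proof -
    obtain V \<phi> x where V: "(V, \<phi>) \<in> atlas" "x \<in> V" "p = \<phi> x" using topspaceE[OF p] .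
    obtain e where "0 < e" "cball x e \<subseteq> V" using chart_open[OF V(1)] V(2) open_contains_cball by blast
    then show ?thesis using V by (intro bexI[of _ "(V, \<phi>, x, e)"]) (auto simp: J_def)
  qed
  then have "K \<subseteq> \<Union>(?U ` J)" using compactin_subset_topspace[OF assms] by blast
  moreover have "openin X (?U j)" if "j \<in> J" for j
    using that ball_subset_cball by (auto simp: J_def intro!: chart_openin_image)
  then have "openin X U" if "U \<in> ?U ` J" for U using that by blast
  ultimately obtain F where F: "finite F" "F \<subseteq> ?U ` J" "K \<subseteq> \<Union>F"
    using compactinD[OF assms, of "?U ` J"] by meson
  then obtain J' where J': "finite J'" "J' \<subseteq> J" "F = ?U ` J'"
    using finite_subset_image[OF F(1,2)] by blast
  have nn: "0 \<le> \<beta> p" if "\<beta> \<in> ?\<beta> ` J'" for \<beta> p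
    using that J'(2) by (auto simp: J_def intro!: surf_bump_nonneg)
  show ?thesis
  proof
    show "finite (?\<beta> ` J')" using J'(1) by simp
    show "surf_Ck k \<beta>" if "\<beta> \<in> ?\<beta> ` J'" for \<beta> k
      using that J'(2) by (auto simp: J_def intro!: surf_Ck_bump)
    show "chart_supported \<beta>" if "\<beta> \<in> ?\<beta> ` J'" for \<beta>
      using that J'(2) by (auto simp: J_def intro!: surf_bump_supported)
    fix p assume "p \<in> K"
    then obtain j where j: "j \<in> J'" "p \<in> ?U j" using F(3) J'(3) by auto
    obtain V \<phi> x e where jj: "j = (V, \<phi>, x, e)" by (cases j)
    have "0 < ?\<beta> j p"
      using j J'(2) surf_bump_pos[of V \<phi> e x p] unfolding jj by (auto simp: J_def)
    then show "0 < (\<Sum>\<beta>\<in>?\<beta> ` J'. \<beta> p)"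
      using j(1) J'(1) nn by (intro sum_pos2[of _ "?\<beta> j"]) auto
  qed
qed

text \<open>Partition of unity as an induction principle: \<open>f\<close> is the sum of the chart supported
  functions \<open>f \<beta> / B\<close>, where \<open>B\<close> is the sum of finitely many bumps \<open>\<beta>\<close> and is positive on the
  support of \<open>f\<close>.\<close>

lemma compact_support_induct [consumes 1, case_names zero add chart cong]:
  assumes f: "surf_Ckc k f"
    and zero: "P (\<lambda>_. 0)"
    and add: "\<And>f g. surf_Ckc k f \<Longrightarrow> surf_Ckc k g \<Longrightarrow> P f \<Longrightarrow> P g \<Longrightarrow> P (\<lambda>p. f p + g p)"
    and chart: "\<And>f. surf_Ck k f \<Longrightarrow> chart_supported f \<Longrightarrow> P f"
    and cong: "\<And>f g. (\<And>p. p \<in> topspace X \<Longrightarrow> f p = g p) \<Longrightarrow> P f \<Longrightarrow> P g"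
  shows "P f"
proof -
  obtain K where K: "compactin X K" "\<And>p. p \<in> topspace X - K \<Longrightarrow> f p = 0"
    using f unfolding surf_Ckc_def by blast
  have closed: "closedin X K" by (rule compactin_imp_closedin[OF Hausdorff K(1)])
  obtain I where I: "finite I" "\<And>\<beta> k. \<beta> \<in> I \<Longrightarrow> surf_Ck k \<beta>" "\<And>\<beta>. \<beta> \<in> I \<Longrightarrow> chart_supported \<beta>"
    "\<And>p. p \<in> K \<Longrightarrow> 0 < (\<Sum>\<beta>\<in>I. \<beta> p)"
    using bump_family[OF K(1)] by blast
  define B where "B p = (\<Sum>\<beta>\<in>I. \<beta> p)" for p
  \<comment> \<open>The case distinction avoids 1/B where B may vanish. Near a point of
    \<open>K\<close> this is f/B, also off \<open>K\<close> since f is 0 there; on the complement of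
    \<open>K\<close> it is 0.\<close>
  define h where "h p = f p * (if p \<in> K then 1 / B p else 0)" for p
  have fk: "surf_Ck k f" using f by (simp add: surf_Ckc_def)
  have B: "surf_Ck k B" unfolding B_def using I(2) by (rule surf_Ck_sum)
  have h: "surf_Ck k h"
    unfolding surf_Ck_def
  proof clarify
    fix W \<psi> assume W: "(W, \<psi>) \<in> atlas"
    show "Ck_on k W (h \<circ> \<psi>)"
    proof (rule Ck_on_local)
      fix y assume y: "y \<in> W"
      show "\<exists>T. open T \<and> y \<in> T \<and> Ck_on k T (h \<circ> \<psi>)"
      proof (cases "\<psi> y \<in> K")
        case True
        let ?T = "(B \<circ> \<psi>) -` {0<..} \<inter> W"
        have T: "open ?T"
          using continuous_open_preimage[OF Ck_on_imp_continuous_on[OF surf_CkD[OF B W]] chart_open[OF W] open_greaterThan]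
          by (simp add: Int_commute)
        have "Ck_on k ?T (\<lambda>z. (f \<circ> \<psi>) z * (1 / (B \<circ> \<psi>) z))"
          by (rule Ck_on_mult[OF T Ck_on_subset[OF surf_CkD[OF fk W] Int_lower2]
              Ck_on_inverse_pos[OF T Ck_on_subset[OF surf_CkD[OF B W] Int_lower2]]]) simp
        moreover have "(h \<circ> \<psi>) z = (f \<circ> \<psi>) z * (1 / (B \<circ> \<psi>) z)" if "z \<in> ?T" for z
          using K(2) chart_in_topspace[OF W] that by (auto simp: h_def)
        ultimately have "Ck_on k ?T (h \<circ> \<psi>)"
          using Ck_on_cong[OF T, of "h \<circ> \<psi>" "\<lambda>z. (f \<circ> \<psi>) z * (1 / (B \<circ> \<psi>) z)" k] by blast
        moreover have "y \<in> ?T" using I(4)[OF True] y by (simp add: B_def)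
        ultimately show ?thesis using T by blast
      next
        case False
        let ?T = "{y\<in>W. \<psi> y \<in> topspace X - K}"
        have T: "open ?T" using closed by (intro chart_open_preimage[OF W]) blast
        have "Ck_on k ?T (h \<circ> \<psi>)"
          by (subst Ck_on_cong[OF T, where g="\<lambda>_. 0"]) (auto simp: h_def Ck_on_const)
        then show ?thesis using T False y chart_in_topspace[OF W y] by blast
      qed
    qed
  qed
  define g where "g \<beta> p = h p * \<beta> p" for \<beta> p
  have gk: "surf_Ck k (g \<beta>)" if "\<beta> \<in> I" for \<beta>
    unfolding g_def using h I(2)[OF that] by (rule surf_Ck_mult)
  have gs: "chart_supported (g \<beta>)" if "\<beta> \<in> I" for \<beta>
    using I(3)[OF that] unfolding chart_supported_def g_def by (metis mult_zero_right)
  have "surf_Ckc k (\<lambda>p. \<Sum>\<beta>\<in>J. g \<beta> p) \<and> P (\<lambda>p. \<Sum>\<beta>\<in>J. g \<beta> p)" if "J \<subseteq> I" for J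
    using finite_subset[OF that I(1)] that
  proof (induction J rule: finite_induct)
    case empty
    have "surf_Ckc k (\<lambda>_. 0)"
      unfolding surf_Ckc_def surf_Ck_def by (auto simp: o_def Ck_on_const intro: exI[of _ "{}"])
    then show ?case using zero by simp
  next
    case (insert \<beta> J)
    have g1: "surf_Ckc k (g \<beta>)" "P (g \<beta>)"
      using gk[of \<beta>] gs[of \<beta>] insert.prems chart chart_supported_Ckc by auto
    have "surf_Ckc k (\<lambda>p. \<Sum>\<beta>\<in>insert \<beta> J. g \<beta> p)"
      unfolding surf_Ckc_def
    proof
      show "surf_Ck k (\<lambda>p. \<Sum>\<beta>\<in>insert \<beta> J. g \<beta> p)"
        by (rule surf_Ck_sum) (use gk insert.prems in auto)
      show "\<exists>K. compactin X K \<and> (\<forall>p\<in>topspace X - K. (\<Sum>\<beta>\<in>insert \<beta> J. g \<beta> p) = 0)"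
        using K(1) by (intro exI[of _ K]) (auto simp: g_def h_def)
    qed
    moreover have "P (\<lambda>p. g \<beta> p + (\<Sum>\<beta>\<in>J. g \<beta> p))"
      using insert.IH insert.prems g1 by (intro add) auto
    ultimately show ?case using insert.hyps by simp
  qed
  then have P: "P (\<lambda>p. \<Sum>\<beta>\<in>I. g \<beta> p)" by blast
  have eq: "(\<Sum>\<beta>\<in>I. g \<beta> p) = f p" if "p \<in> topspace X" for p
  proof (cases "p \<in> K")
    case True
    then have "B p \<noteq> 0" using I(4)[OF True] by (simp add: B_def)
    moreover have "(\<Sum>\<beta>\<in>I. g \<beta> p) = h p * B p" by (simp only: g_def B_def sum_distrib_left)
    ultimately show ?thesis using True by (simp add: h_def)
  next
    case False
    then show ?thesis using K(2)[of p] that by (simp add: g_def h_def)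
  qed
  \<comment> \<open>Off the surface the values of f are arbitrary, so the sum is known to agree with
    f only on \<open>topspace X\<close>; hence the case \<open>cong\<close>.\<close>
  show ?thesis by (rule cong[OF eq P])
qed

lemma integrable_compact_support_area:
  assumes "surf_Ckc 0 g" shows "integrable area g"
  using assms
proof (induction rule: compact_support_induct)
  case zero
  then show ?case by simp
next
  case (add f g)
  then show ?case by simp
next
  case (cong f g)
  then show ?case by (subst Bochner_Integration.integrable_cong[of _ area _ f]) auto
next
  case (chart f)
  then obtain V \<phi> C where V: "(V, \<phi>) \<in> atlas" and C: "compact C" "C \<subseteq> V" "\<And>p. p \<in> topspace X - \<phi> ` C \<Longrightarrow> f p = 0"
    unfolding chart_supported_def by blast
  have f0: "f (\<phi> x) = 0" if "x \<in> V - C" for x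
    using C(3)[of "\<phi> x"] that chart_in_topspace[OF V] inj_on_image_mem_iff[OF chart_inj[OF V] _ C(2), of x] by auto
  let ?h = "\<lambda>x. area_density (im \<circ> \<phi>) x * f (\<phi> x)"
  have "continuous_on V ?h"
    using regular_on_continuous_area_density[OF chart_regular[OF V]] surf_CkD[OF chart(1) V]
    by (auto intro!: continuous_on_mult simp: o_def)
  then have "continuous_on UNIV (\<lambda>x. if x \<in> V then ?h x else 0)"
    using Ck_on_extend_0[OF chart_open[OF V] compact_imp_closed[OF C(1)] C(2), of 0 ?h] f0 by auto
  then have "integrable lborel (\<lambda>x. if x \<in> V then ?h x else 0)"
    by (rule integrable_compact_support[OF C(1)]) (use f0 in auto)
  moreover have "(\<lambda>x. if x \<in> V then ?h x else 0) = (\<lambda>x. indicator V x * ?h x)"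
    by (auto simp: indicator_def)
  moreover have "integrable area f \<longleftrightarrow> integrable lborel (\<lambda>x. indicator V x * ?h x)"
    by (rule integrable_area_chart[OF V surf_Ck_measurable[OF chart(1)]]) (use C(2,3) in blast)
  ultimately show ?case by simp
qed

section \<open>The weak Laplacian of functions of the squared distance\<close>

definition sqdist :: "real^3 \<Rightarrow> 'a \<Rightarrow> real" where
  "sqdist a p = (im p - a) \<bullet> (im p - a)"

lemma Ck_on_im: "(V, \<phi>) \<in> atlas \<Longrightarrow> Ck_on 1 V (\<lambda>x. im (\<phi> x))"
  using regular_on_Ck_on_1[OF chart_regular] by (simp only: o_def)

lemma surf_Ck_sqdist: "surf_Ck 1 (sqdist a)"
  unfolding surf_Ck_def sqdist_def o_def
  by (clarify, intro Ck_on_inner Ck_on_diff Ck_on_im Ck_on_const chart_open)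

text \<open>Stands for f \<Delta>(\<phi> o s) + grad f . grad (\<phi> o s), where s =
  \<open>sqdist a\<close>. The gradient of s is replaced by the ambient vector
  \<open>2 *\<^sub>R (im p - a)\<close>, whose tangential part it is, and \<Delta> s by its value 4
  on minimal surfaces, so only first derivatives on the surface occur.\<close>

definition weak_laplacian :: "(real \<Rightarrow> real) \<Rightarrow> (real \<Rightarrow> real) \<Rightarrow> real^3 \<Rightarrow> ('a \<Rightarrow> real) \<Rightarrow> 'a \<Rightarrow> real" where
  "weak_laplacian \<phi>' \<phi>'' a f p =
    \<phi>' (sqdist a p) * (surf_grad M f p \<bullet> (2 *\<^sub>R (im p - a))) +
      f p * (\<phi>'' (sqdist a p) * (surf_grad M (sqdist a) p \<bullet> (2 *\<^sub>R (im p - a))) + 4 * \<phi>' (sqdist a p))"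

lemma surf_Ckc_weak_laplacian:
  assumes f: "surf_Ckc 1 f" and c: "continuous_on UNIV \<phi>'" "continuous_on UNIV \<phi>''"
  shows "surf_Ckc 0 (weak_laplacian \<phi>' \<phi>'' a f)"
proof -
  have f1: "surf_Ck 1 f" using f by (simp add: surf_Ckc_def)
  obtain K where K: "compactin X K" "\<And>p. p \<in> topspace X - K \<Longrightarrow> f p = 0" using f unfolding surf_Ckc_def by blast
  have "continuous_on V (\<lambda>x. weak_laplacian \<phi>' \<phi>'' a f (\<phi> x))" if V: "(V, \<phi>) \<in> atlas" for V \<phi>
  proof -
    have "continuous_on V (\<lambda>x. im (\<phi> x))" by (rule Ck_on_imp_continuous_on[OF Ck_on_im[OF V]])
    moreover have s: "continuous_on V (\<lambda>x. sqdist a (\<phi> x))" "continuous_on V (\<lambda>x. f (\<phi> x))"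
      using Ck_on_imp_continuous_on[OF surf_CkD[OF surf_Ck_sqdist V]] Ck_on_imp_continuous_on[OF surf_CkD[OF f1 V]]
      by (auto simp: o_def)
    moreover have "continuous_on V (\<lambda>x. \<phi>' (sqdist a (\<phi> x)))" "continuous_on V (\<lambda>x. \<phi>'' (sqdist a (\<phi> x)))"
      using continuous_on_compose2[OF c(1) s(1)] continuous_on_compose2[OF c(2) s(1)] by auto
    ultimately show ?thesis
      unfolding weak_laplacian_def
      by (intro continuous_intros continuous_on_surf_grad[OF f1 V] continuous_on_surf_grad[OF surf_Ck_sqdist V])
  qed
  then have "surf_Ck 0 (weak_laplacian \<phi>' \<phi>'' a f)" by (auto simp: surf_Ck_def o_def)
  moreover have "weak_laplacian \<phi>' \<phi>'' a f p = 0" if "p \<in> topspace X - K" for p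
    using surf_grad_eq_0[OF f1 K that] K(2)[OF that] by (simp add: weak_laplacian_def)
  ultimately show ?thesis using K(1) by (auto simp: surf_Ckc_def)
qed

lemma surf_grad_add:
  assumes "surf_Ck 1 f" "surf_Ck 1 g" "p \<in> topspace X"
  shows "surf_grad M (\<lambda>p. f p + g p) p = surf_grad M f p + surf_grad M g p"
proof -
  have fg: "surf_Ck 1 (\<lambda>p. f p + g p)"
    unfolding surf_Ck_def o_def
    by (clarify, intro Ck_on_add chart_open)
      (use assms(1,2)[THEN surf_CkD, unfolded o_def] in auto)
  obtain V \<phi> x where V: "(V, \<phi>) \<in> atlas" "x \<in> V" "p = \<phi> x" using topspaceE[OF assms(3)] .
  have "pd i ((\<lambda>p. f p + g p) \<circ> \<phi>) x = pd i (f \<circ> \<phi>) x + pd i (g \<circ> \<phi>) x" for i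
    using pd_eqI[OF has_derivative_add[OF Ck_on_1_has_derivative[OF surf_CkD[OF assms(1) V(1)] V(2)]
      Ck_on_1_has_derivative[OF surf_CkD[OF assms(2) V(1)] V(2)]]] by (simp add: pd_def o_def)
  then show ?thesis
    using surf_grad_chart[OF fg V(1,2)] surf_grad_chart[OF assms(1) V(1,2)] surf_grad_chart[OF assms(2) V(1,2)] V(3)
    by (simp add: chart_grad_def algebra_simps)
qed

end

section \<open>Barta's inequality\<close>

context immersed begin

text \<open>The integrand is additive in f, so the partition of unity leaves only f supported in one
  chart, where the first variation formula applies.\<close>

lemma integral_weak_laplacian:
  assumes min: "\<And>V \<phi> x. (V, \<phi>) \<in> atlas \<Longrightarrow> x \<in> V \<Longrightarrow> mean_curvature (im \<circ> \<phi>) x = 0"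
    and \<phi>: "\<And>t. (\<phi>' has_real_derivative \<phi>'' t) (at t)" "Ck_on 1 UNIV \<phi>'" "continuous_on UNIV \<phi>''"
    and f: "surf_Ckc 1 f"
  shows "(\<integral>p. weak_laplacian \<phi>' \<phi>'' a f p \<partial>area) = 0"
  using f
proof (induction rule: compact_support_induct)
  case zero
  have "surf_Ckc 1 (\<lambda>_. 0)"
    unfolding surf_Ckc_def surf_Ck_def by (auto simp: o_def Ck_on_const simp del: One_nat_def intro: exI[of _ "{}"])
  then have "surf_grad M (\<lambda>_. 0) p = 0" if "p \<in> topspace X" for p
    using surf_grad_eq_0[of "\<lambda>_. 0" "{}" p] that by (simp add: surf_Ckc_def)
  then have "weak_laplacian \<phi>' \<phi>'' a (\<lambda>_. 0) p = 0" if "p \<in> topspace X" for p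
    using that by (simp add: weak_laplacian_def)
  then show ?case by (subst Bochner_Integration.integral_cong[of _ area _ "\<lambda>_. 0"]) auto
next
  case (add f g)
  note int = integrable_compact_support_area[OF surf_Ckc_weak_laplacian[OF _ Ck_on_imp_continuous_on[OF \<phi>(2)] \<phi>(3), of _ a]]
  have "weak_laplacian \<phi>' \<phi>'' a (\<lambda>p. f p + g p) p = weak_laplacian \<phi>' \<phi>'' a f p + weak_laplacian \<phi>' \<phi>'' a g p"
    if "p \<in> topspace X" for p
    using surf_grad_add[of f g p] add(1,2) that
    by (simp add: surf_Ckc_def weak_laplacian_def inner_add_left algebra_simps)
  then have "(\<integral>p. weak_laplacian \<phi>' \<phi>'' a (\<lambda>p. f p + g p) p \<partial>area) =
      (\<integral>p. weak_laplacian \<phi>' \<phi>'' a f p + weak_laplacian \<phi>' \<phi>'' a g p \<partial>area)"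
    by (intro Bochner_Integration.integral_cong) auto
  also have "\<dots> = 0" using int[OF add(1)] int[OF add(2)] add(3,4) by simp
  finally show ?case .
next
  case (cong f g)
  have "surf_grad M f p = surf_grad M g p" if p: "p \<in> topspace X" for p
  proof -
    have "frechet_derivative (f \<circ> \<phi>) (at x) = frechet_derivative (g \<circ> \<phi>) (at x)" if "(V, \<phi>) \<in> atlas" "x \<in> V" for V \<phi> x
      by (rule frechet_derivative_cong_open(1)[OF chart_open[OF that(1)] _ that(2)])
        (use cong(1) chart_in_topspace[OF that(1)] in simp)
    then show ?thesis
      unfolding surf_grad_def by (intro arg_cong[where f=The] ext) (auto split: prod.splits)
  qed
  then have "weak_laplacian \<phi>' \<phi>'' a f p = weak_laplacian \<phi>' \<phi>'' a g p" if "p \<in> topspace X" for p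
    using cong(1) that by (simp add: weak_laplacian_def)
  then have "(\<integral>p. weak_laplacian \<phi>' \<phi>'' a f p \<partial>area) = (\<integral>p. weak_laplacian \<phi>' \<phi>'' a g p \<partial>area)"
    by (intro Bochner_Integration.integral_cong) auto
  then show ?case using cong(2) by simp
next
  case (chart f)
  then obtain V \<psi> C where V: "(V, \<psi>) \<in> atlas" and C: "compact C" "C \<subseteq> V" "\<And>p. p \<in> topspace X - \<psi> ` C \<Longrightarrow> f p = 0"
    unfolding chart_supported_def by blast
  have f0: "(f \<circ> \<psi>) x = 0" if "x \<in> V - C" for x
    using C(3)[of "\<psi> x"] that chart_in_topspace[OF V] inj_on_image_mem_iff[OF chart_inj[OF V] _ C(2), of x] by auto
  let ?L = "weak_laplacian \<phi>' \<phi>'' a f"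
  have "surf_Ckc 1 f" by (rule chart_supported_Ckc[OF chart])
  then have Lk: "surf_Ckc 0 ?L"
    by (rule surf_Ckc_weak_laplacian[OF _ Ck_on_imp_continuous_on[OF \<phi>(2)] \<phi>(3)])
  then have Lm: "?L \<in> borel_measurable area" using surf_Ck_measurable by (auto simp: surf_Ckc_def)
  have L0: "?L p = 0" if "p \<in> topspace X - \<psi> ` V" for p
  proof -
    have p: "p \<in> topspace X - \<psi> ` C" using that C(2) by blast
    show ?thesis
      using surf_grad_eq_0[OF chart(1) chart_compact_image[OF V C(1,2)] C(3) p] C(3)[OF p]
      by (simp add: weak_laplacian_def)
  qed
  have sq: "sqdist a \<circ> \<psi> = (\<lambda>x. ((im \<circ> \<psi>) x - a) \<bullet> ((im \<circ> \<psi>) x - a))"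
    by (auto simp: sqdist_def)
  have "(\<integral>p. ?L p \<partial>area) = (\<integral>x. indicator V x * (area_density (im \<circ> \<psi>) x * ?L (\<psi> x)) \<partial>lborel)"
    by (rule integral_area_chart[OF V Lm L0])
  also have "\<dots> = (\<integral>x. indicator V x * (area_density (im \<circ> \<psi>) x *
    (\<phi>' (((im \<circ> \<psi>) x - a) \<bullet> ((im \<circ> \<psi>) x - a)) * (chart_grad (im \<circ> \<psi>) (f \<circ> \<psi>) x \<bullet> (2 *\<^sub>R ((im \<circ> \<psi>) x - a))) +
      (f \<circ> \<psi>) x * (\<phi>'' (((im \<circ> \<psi>) x - a) \<bullet> ((im \<circ> \<psi>) x - a)) *
        (chart_grad (im \<circ> \<psi>) (\<lambda>x. ((im \<circ> \<psi>) x - a) \<bullet> ((im \<circ> \<psi>) x - a)) x \<bullet> (2 *\<^sub>R ((im \<circ> \<psi>) x - a))) +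
        4 * \<phi>' (((im \<circ> \<psi>) x - a) \<bullet> ((im \<circ> \<psi>) x - a))))) \<partial>lborel)"
  proof (rule Bochner_Integration.integral_cong[OF refl])
    fix x
    show "indicator V x * (area_density (im \<circ> \<psi>) x * ?L (\<psi> x)) = indicator V x * (area_density (im \<circ> \<psi>) x *
    (\<phi>' (((im \<circ> \<psi>) x - a) \<bullet> ((im \<circ> \<psi>) x - a)) * (chart_grad (im \<circ> \<psi>) (f \<circ> \<psi>) x \<bullet> (2 *\<^sub>R ((im \<circ> \<psi>) x - a))) +
      (f \<circ> \<psi>) x * (\<phi>'' (((im \<circ> \<psi>) x - a) \<bullet> ((im \<circ> \<psi>) x - a)) *
        (chart_grad (im \<circ> \<psi>) (\<lambda>x. ((im \<circ> \<psi>) x - a) \<bullet> ((im \<circ> \<psi>) x - a)) x \<bullet> (2 *\<^sub>R ((im \<circ> \<psi>) x - a))) +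
        4 * \<phi>' (((im \<circ> \<psi>) x - a) \<bullet> ((im \<circ> \<psi>) x - a)))))"
    proof (cases "x \<in> V")
      case True
      then show ?thesis
        unfolding weak_laplacian_def surf_grad_chart[OF chart(1) V True] surf_grad_chart[OF surf_Ck_sqdist V True] sq
        by (simp add: sqdist_def)
    qed simp
  qed
  also have "\<dots> = 0"
    by (rule chart_weak_laplacian[OF chart_regular[OF V] min[OF V] surf_CkD[OF chart(1) V] C(1,2) f0 \<phi>(1,2)])
  finally show ?case .
qed

lemma surf_grad_tangent_inner:
  assumes "surf_Ck 1 f" "surf_Ck 1 g" "(V, \<phi>) \<in> atlas" "x \<in> V"
    "\<And>v. z \<bullet> frechet_derivative (im \<circ> \<phi>) (at x) v = frechet_derivative (g \<circ> \<phi>) (at x) v"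
  shows "surf_grad M f (\<phi> x) \<bullet> z = surf_grad M f (\<phi> x) \<bullet> surf_grad M g (\<phi> x)"
  unfolding surf_grad_chart[OF assms(1,3,4)] surf_grad_chart[OF assms(2,3,4)]
  by (rule chart_grad_tangent_inner[OF chart_regular[OF assms(3)] assms(4) surf_CkD[OF assms(2,3)] assms(5)])

lemma surf_grad_inner_sqdist:
  assumes "surf_Ck 1 f" "p \<in> topspace X"
  shows "surf_grad M f p \<bullet> (2 *\<^sub>R (im p - a)) = surf_grad M f p \<bullet> surf_grad M (sqdist a) p"
proof -
  obtain V \<phi> x where V: "(V, \<phi>) \<in> atlas" "x \<in> V" "p = \<phi> x" using topspaceE[OF assms(2)] .
  have d: "((im \<circ> \<phi>) has_derivative frechet_derivative (im \<circ> \<phi>) (at x)) (at x)"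
    by (rule Ck_on_1_has_derivative[OF regular_on_Ck_on_1[OF chart_regular[OF V(1)]] V(2)])
  have "(sqdist a \<circ> \<phi> has_derivative (\<lambda>v. (2 *\<^sub>R (im p - a)) \<bullet> frechet_derivative (im \<circ> \<phi>) (at x) v)) (at x)"
  proof -
    note d1 = has_derivative_diff[OF d has_derivative_const, of a]
    have "((\<lambda>x. ((im \<circ> \<phi>) x - a) \<bullet> ((im \<circ> \<phi>) x - a)) has_derivative
        (\<lambda>v. (2 *\<^sub>R (im p - a)) \<bullet> frechet_derivative (im \<circ> \<phi>) (at x) v)) (at x)"
      using has_derivative_inner[OF d1 d1] V(3) by (simp add: inner_commute)
    then show ?thesis by (simp add: sqdist_def o_def)
  qed
  then have "frechet_derivative (sqdist a \<circ> \<phi>) (at x) = (\<lambda>v. (2 *\<^sub>R (im p - a)) \<bullet> frechet_derivative (im \<circ> \<phi>) (at x) v)"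
    using frechet_derivative_at by metis
  then show ?thesis
    unfolding V(3) by (intro surf_grad_tangent_inner[OF assms(1) surf_Ck_sqdist V(1,2)]) simp
qed

text \<open>The surface gradient is the tangential part of 2 (im p - a), and orthogonal projection
  does not increase length.\<close>

lemma norm_surf_grad_sqdist:
  assumes "p \<in> topspace X"
  shows "(norm (surf_grad M (sqdist a) p))\<^sup>2 \<le> 4 * sqdist a p"
proof -
  let ?G = "surf_grad M (sqdist a) p"
  have "(norm ?G)\<^sup>2 = ?G \<bullet> (2 *\<^sub>R (im p - a))"
    using surf_grad_inner_sqdist[OF surf_Ck_sqdist assms, of a a] by (simp add: power2_norm_eq_inner)
  also have "\<dots> \<le> norm ?G * (2 * norm (im p - a))"
    using norm_cauchy_schwarz[of ?G "2 *\<^sub>R (im p - a)"] by simp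
  finally have "norm ?G * norm ?G \<le> norm ?G * (2 * norm (im p - a))" by (simp add: power2_eq_square)
  then have "norm ?G \<le> 2 * norm (im p - a)"
    by (cases "norm ?G = 0") (auto simp: mult_le_cancel_left_pos)
  then have "(norm ?G)\<^sup>2 \<le> (2 * norm (im p - a))\<^sup>2" by (intro power_mono) auto
  then show ?thesis by (simp add: sqdist_def power_mult_distrib power2_norm_eq_inner)
qed

lemma Barta:
  assumes min: "\<And>V \<phi> x. (V, \<phi>) \<in> atlas \<Longrightarrow> x \<in> V \<Longrightarrow> mean_curvature (im \<circ> \<phi>) x = 0"
    and ball: "im ` topspace X \<subseteq> ball a r" and r: "0 < r"
    and T: "T \<le> 2" "\<And>t. 0 \<le> t \<Longrightarrow> t < T \<Longrightarrow> 0 < bes 0 t" "0 < T"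
    and f: "surf_Ckc 1 f"
  shows "4 * T / r\<^sup>2 * (\<integral>p. (f p)\<^sup>2 \<partial>area) \<le> (\<integral>p. (norm (surf_grad M f p))\<^sup>2 \<partial>area)"
    and "integrable area (\<lambda>p. (f p)\<^sup>2)" "integrable area (\<lambda>p. (norm (surf_grad M f p))\<^sup>2)"
proof -
  \<comment> \<open>This is k^2/4 in the notation of the overview; inside the ball
    \<open>\<kappa> * sqdist a p\<close> stays below the first zero \<open>T\<close>.\<close>
  define \<kappa> where "\<kappa> = T / r\<^sup>2"
  define \<phi>' where "\<phi>' t = - \<kappa> * bes 1 (\<kappa> * t)" for t
  define \<phi>'' where "\<phi>'' t = \<kappa>\<^sup>2 * bes 2 (\<kappa> * t)" for t
  have \<kappa>: "0 < \<kappa>" using r T(3) by (simp add: \<kappa>_def)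
  have bes_comp: "((\<lambda>t. bes k (\<kappa> * t)) has_real_derivative - \<kappa> * bes (Suc k) (\<kappa> * t)) (at t)" for k t
    using DERIV_chain2[OF bes_deriv[of k "\<kappa> * t"] DERIV_cmult[OF DERIV_ident, of \<kappa>]] by (simp add: mult.commute)
  have Ck_bes: "Ck_on 1 UNIV (\<lambda>t. bes k (\<kappa> * t))" for k
    by (rule Ck_on_compose[OF open_UNIV open_UNIV _ _ Ck_on_bes]) (auto intro!: Ck_on_mult Ck_on_const Ck_on_ident simp del: One_nat_def)
  have \<phi>1: "(\<phi>' has_real_derivative \<phi>'' t) (at t)" for t
    unfolding \<phi>'_def \<phi>''_def using DERIV_cmult[OF bes_comp[of 1 t], of "- \<kappa>"]
    by (simp add: power2_eq_square numeral_2_eq_2 mult.assoc)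
  have \<phi>2: "Ck_on 1 UNIV \<phi>'" unfolding \<phi>'_def by (intro Ck_on_mult Ck_on_const Ck_bes open_UNIV)
  have \<phi>3: "continuous_on UNIV \<phi>''" unfolding \<phi>''_def
    by (intro Ck_on_imp_continuous_on[of 1] Ck_on_mult Ck_on_const Ck_bes open_UNIV)
  define h where "h p = bes 0 (\<kappa> * sqdist a p)" for p
  have s: "0 \<le> \<kappa> * sqdist a p" "\<kappa> * sqdist a p < T" if "p \<in> topspace X" for p
  proof -
    show "0 \<le> \<kappa> * sqdist a p" using \<kappa> by (simp add: sqdist_def)
    have "norm (im p - a) < r" using ball that by (auto simp: dist_norm norm_minus_commute)
    then have "(norm (im p - a))\<^sup>2 < r\<^sup>2" by (intro power_strict_mono) auto
    then show "\<kappa> * sqdist a p < T"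
      using r T(3) by (simp add: \<kappa>_def sqdist_def power2_norm_eq_inner field_simps)
  qed
  have h: "0 < h p" if "p \<in> topspace X" for p
    unfolding h_def using s[OF that] T(2) by blast
  have f1: "surf_Ck 1 f" using f by (simp add: surf_Ckc_def)
  obtain K where K: "compactin X K" "\<And>p. p \<in> topspace X - K \<Longrightarrow> f p = 0" using f unfolding surf_Ckc_def by blast
  have hk: "Ck_on 1 V (h \<circ> \<phi>)" if V: "(V, \<phi>) \<in> atlas" for V \<phi>
    unfolding h_def o_def
    by (rule Ck_on_compose[OF chart_open[OF V] open_UNIV _ surf_CkD[OF surf_Ck_sqdist V, unfolded o_def] Ck_bes]) simp
  define \<psi> where "\<psi> p = (f p * f p) * (1 / h p)" for p
  have ihk: "Ck_on 1 V (\<lambda>x. 1 / (h \<circ> \<phi>) x)" if V: "(V, \<phi>) \<in> atlas" for V \<phi>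
    by (rule Ck_on_inverse_pos[OF chart_open[OF V] hk[OF V]]) (use h chart_in_topspace[OF V] in simp)
  have \<psi>k: "surf_Ck 1 \<psi>"
    unfolding surf_Ck_def
  proof clarify
    fix V \<phi> assume V: "(V, \<phi>) \<in> atlas"
    have "Ck_on 1 V (\<lambda>x. ((f \<circ> \<phi>) x * (f \<circ> \<phi>) x) * (1 / (h \<circ> \<phi>) x))"
      by (intro Ck_on_mult chart_open[OF V] surf_CkD[OF f1 V] ihk[OF V])
    then show "Ck_on 1 V (\<psi> \<circ> \<phi>)" by (simp only: \<psi>_def o_def)
  qed
  have \<psi>c: "surf_Ckc 1 \<psi>" unfolding surf_Ckc_def using \<psi>k K by (auto simp: \<psi>_def)
  have grad: "surf_grad M \<psi> p = (2 * f p / h p) *\<^sub>R surf_grad M f p - ((f p)\<^sup>2 * \<phi>' (sqdist a p) / (h p)\<^sup>2) *\<^sub>R surf_grad M (sqdist a) p"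
    if p: "p \<in> topspace X" for p
  proof -
    obtain V \<phi> x where V: "(V, \<phi>) \<in> atlas" "x \<in> V" "p = \<phi> x" using topspaceE[OF p] .
    have hx: "h (\<phi> x) \<noteq> 0" using h[OF p] V(3) by simp
    note C = surf_CkD[OF f1 V(1)] surf_CkD[OF surf_Ck_sqdist V(1), of a]
    have H: "h \<circ> \<phi> = (\<lambda>x. bes 0 (\<kappa> * (sqdist a \<circ> \<phi>) x))" by (auto simp: h_def)
    have ph: "pd i (h \<circ> \<phi>) x = \<phi>' (sqdist a (\<phi> x)) * pd i (sqdist a \<circ> \<phi>) x" for i
      unfolding H using pd_real_compose[OF C(2) V(2) bes_comp[of 0], of i] by (simp add: \<phi>'_def)
    have pih: "pd i (\<lambda>x. 1 / (h \<circ> \<phi>) x) x = - (1 / (h (\<phi> x))\<^sup>2) * pd i (h \<circ> \<phi>) x" for i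
    proof (rule pd_real_compose[OF hk[OF V(1)] V(2), of "\<lambda>t. 1 / t"])
      show "((\<lambda>t. 1 / t) has_real_derivative - (1 / (h (\<phi> x))\<^sup>2)) (at ((h \<circ> \<phi>) x))"
        using hx by (auto intro!: derivative_eq_intros simp: power2_eq_square)
    qed
    have \<psi>eq: "\<psi> \<circ> \<phi> = (\<lambda>x. ((f \<circ> \<phi>) x * (f \<circ> \<phi>) x) * (1 / (h \<circ> \<phi>) x))" by (auto simp: \<psi>_def)
    have ff: "Ck_on 1 V (\<lambda>x. (f \<circ> \<phi>) x * (f \<circ> \<phi>) x)" by (intro Ck_on_mult chart_open[OF V(1)] C(1))
    have "pd i (\<psi> \<circ> \<phi>) x = (2 * f p / h p) * pd i (f \<circ> \<phi>) x - ((f p)\<^sup>2 * \<phi>' (sqdist a p) / (h p)\<^sup>2) * pd i (sqdist a \<circ> \<phi>) x" for i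
      unfolding \<psi>eq pd_mult[OF ff ihk[OF V(1)] V(2)] pd_mult[OF C(1) C(1) V(2)] pih ph V(3)
      by (simp add: power2_eq_square algebra_simps)
    then show ?thesis
      unfolding V(3) surf_grad_chart[OF \<psi>k V(1,2)] surf_grad_chart[OF f1 V(1,2)] surf_grad_chart[OF surf_Ck_sqdist V(1,2)]
      by (rule chart_grad_linear_combination)
  qed
  have fsq: "surf_Ckc 0 (\<lambda>p. (f p)\<^sup>2)"
  proof -
    have "continuous_on V (f \<circ> \<phi>)" if "(V, \<phi>) \<in> atlas" for V \<phi>
      by (rule Ck_on_imp_continuous_on[OF surf_CkD[OF f1 that]])
    then have "surf_Ck 0 (\<lambda>p. (f p)\<^sup>2)" by (auto simp: surf_Ck_def o_def intro!: continuous_on_power)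
    then show ?thesis using K by (auto simp: surf_Ckc_def)
  qed
  then show int1: "integrable area (\<lambda>p. (f p)\<^sup>2)" by (rule integrable_compact_support_area)
  have gsq: "surf_Ckc 0 (\<lambda>p. (norm (surf_grad M f p))\<^sup>2)"
  proof -
    have "surf_Ck 0 (\<lambda>p. (norm (surf_grad M f p))\<^sup>2)"
      by (auto simp: surf_Ck_def o_def intro!: continuous_on_power continuous_on_norm continuous_on_surf_grad[OF f1])
    then show ?thesis using K surf_grad_eq_0[OF f1 K] by (auto simp: surf_Ckc_def)
  qed
  then show int2: "integrable area (\<lambda>p. (norm (surf_grad M f p))\<^sup>2)" by (rule integrable_compact_support_area)
  have pw: "weak_laplacian \<phi>' \<phi>'' a \<psi> p \<le> (norm (surf_grad M f p))\<^sup>2 - 4 * \<kappa> * (f p)\<^sup>2"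
    if p: "p \<in> topspace X" for p
  proof -
    define S where "S = sqdist a p"
    define H where "H = h p"
    let ?Gf = "surf_grad M f p" and ?Gs = "surf_grad M (sqdist a) p"
    define N where "N = ?Gs \<bullet> ?Gs"
    \<comment> \<open>The vector \<open>c *\<^sub>R ?Gs\<close> is (f/h) grad h. Expanding |grad f -
      (f/h) grad h|^2 \<ge> 0 bounds the gradient part of the integrand by |grad f|^2.\<close>
    define c where "c = f p * \<phi>' S / H"
    have H: "0 < H" using h[OF p] by (simp add: H_def)
    have N: "N \<le> 4 * S" using norm_surf_grad_sqdist[OF p, of a] by (simp add: N_def S_def power2_norm_eq_inner)
    \<comment> \<open>Here \<open>T \<le> 2\<close> enters: it keeps \<kappa> S in the range where
      \<open>bes 2\<close> is nonnegative.\<close>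
    have "0 \<le> \<phi>'' S" unfolding \<phi>''_def using bes_2_nonneg[of "\<kappa> * S"] s[OF p] T(1) by (simp add: S_def)
    then have "\<phi>'' S * N \<le> \<phi>'' S * (4 * S)" using N by (intro mult_left_mono)
    then have "\<phi>'' S * N + 4 * \<phi>' S \<le> 4 * (S * \<phi>'' S + \<phi>' S)" by (simp add: algebra_simps)
    also have "S * \<phi>'' S + \<phi>' S = - \<kappa> * H"
    proof -
      have "S * \<phi>'' S + \<phi>' S = - \<kappa> * (bes 1 (\<kappa> * S) - \<kappa> * S * bes 2 (\<kappa> * S))"
        by (simp add: \<phi>'_def \<phi>''_def power2_eq_square algebra_simps)
      then show ?thesis unfolding bes_ode[of "\<kappa> * S", symmetric] by (simp only: H_def h_def S_def)
    qed
    finally have 1: "\<phi>'' S * N + 4 * \<phi>' S \<le> - 4 * \<kappa> * H" by simp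
    have "(f p)\<^sup>2 / H * (\<phi>'' S * N + 4 * \<phi>' S) \<le> (f p)\<^sup>2 / H * (- 4 * \<kappa> * H)"
      using H by (intro mult_left_mono[OF 1]) simp
    also have "\<dots> = - 4 * \<kappa> * (f p)\<^sup>2" using H by simp
    finally have 2: "(f p)\<^sup>2 / H * (\<phi>'' S * N + 4 * \<phi>' S) \<le> - 4 * \<kappa> * (f p)\<^sup>2" .
    have "0 \<le> (norm (?Gf - c *\<^sub>R ?Gs))\<^sup>2" by simp
    also have "\<dots> = (norm ?Gf)\<^sup>2 - 2 * c * (?Gf \<bullet> ?Gs) + c\<^sup>2 * N"
      unfolding power2_norm_eq_inner N_def
      by (simp add: inner_diff_left inner_diff_right inner_commute[of ?Gs ?Gf] power2_eq_square algebra_simps)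
    finally have 3: "2 * c * (?Gf \<bullet> ?Gs) - c\<^sup>2 * N \<le> (norm ?Gf)\<^sup>2" by simp
    have "\<phi>' S * (surf_grad M \<psi> p \<bullet> ?Gs) = 2 * c * (?Gf \<bullet> ?Gs) - c\<^sup>2 * N"
      unfolding grad[OF p] S_def[symmetric] H_def[symmetric]
      by (simp add: inner_diff_left N_def c_def power2_eq_square algebra_simps)
    moreover have "\<psi> p = (f p)\<^sup>2 / H" by (simp add: \<psi>_def H_def power2_eq_square)
    ultimately have "weak_laplacian \<phi>' \<phi>'' a \<psi> p =
        2 * c * (?Gf \<bullet> ?Gs) - c\<^sup>2 * N + (f p)\<^sup>2 / H * (\<phi>'' S * N + 4 * \<phi>' S)"
      unfolding weak_laplacian_def surf_grad_inner_sqdist[OF \<psi>k p] surf_grad_inner_sqdist[OF surf_Ck_sqdist p]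
      by (simp add: S_def N_def)
    then show ?thesis using 2 3 by simp
  qed
  have "0 = (\<integral>p. weak_laplacian \<phi>' \<phi>'' a \<psi> p \<partial>area)"
    using integral_weak_laplacian[OF min \<phi>1 \<phi>2 \<phi>3 \<psi>c] by simp
  also have "\<dots> \<le> (\<integral>p. (norm (surf_grad M f p))\<^sup>2 - 4 * \<kappa> * (f p)\<^sup>2 \<partial>area)"
    by (rule integral_mono[OF integrable_compact_support_area[OF surf_Ckc_weak_laplacian[OF \<psi>c Ck_on_imp_continuous_on[OF \<phi>2] \<phi>3]]])
      (use int1 int2 pw in auto)
  also have "\<dots> = (\<integral>p. (norm (surf_grad M f p))\<^sup>2 \<partial>area) - 4 * \<kappa> * (\<integral>p. (f p)\<^sup>2 \<partial>area)"
    using int1 int2 by simp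
  finally show "4 * T / r\<^sup>2 * (\<integral>p. (f p)\<^sup>2 \<partial>area) \<le> (\<integral>p. (norm (surf_grad M f p))\<^sup>2 \<partial>area)"
    by (simp add: \<kappa>_def)
qed

section \<open>From test functions to the fundamental tone\<close>

lemma test_functions_surf_Ckc: "f \<in> test_functions M \<Longrightarrow> surf_Ckc k f"
  unfolding test_functions_def surf_Ckc_def surf_Ck_def smooth_on_def by blast

text \<open>Young's inequality takes the place of the triangle inequality in L^2: it is applied to
  both integrals with the same weight e, the approximation error vanishes as n grows, and then e
  tends to 0.\<close>

lemma L2_1_0_inequality:
  assumes fG: "(f, G) \<in> L2_1_0 M" and \<mu>: "0 \<le> \<mu>"
    and test: "\<And>f. surf_Ckc 1 f \<Longrightarrow> \<mu> * (\<integral>p. (f p)\<^sup>2 \<partial>area) \<le> (\<integral>p. (norm (surf_grad M f p))\<^sup>2 \<partial>area)"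
      "\<And>f. surf_Ckc 1 f \<Longrightarrow> integrable area (\<lambda>p. (f p)\<^sup>2)"
      "\<And>f. surf_Ckc 1 f \<Longrightarrow> integrable area (\<lambda>p. (norm (surf_grad M f p))\<^sup>2)"
  shows "\<mu> * (\<integral>p. (f p)\<^sup>2 \<partial>area) \<le> (\<integral>p. (norm (G p))\<^sup>2 \<partial>area)"
proof -
  obtain \<phi> where m: "f \<in> borel_measurable area" "G \<in> borel_measurable area"
      and i: "integrable area (\<lambda>p. (f p)\<^sup>2)" "integrable area (\<lambda>p. (norm (G p))\<^sup>2)"
      and \<phi>: "\<And>n. \<phi> n \<in> test_functions M"
      and lim: "(\<lambda>n. (\<integral>p. (\<phi> n p - f p)\<^sup>2 \<partial>area) + (\<integral>p. (norm (surf_grad M (\<phi> n) p - G p))\<^sup>2 \<partial>area)) \<longlonglongrightarrow> 0"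
    using fG unfolding L2_1_0_def by auto
  define I where "I n = (\<integral>p. (\<phi> n p - f p)\<^sup>2 \<partial>area)" for n
  define J where "J n = (\<integral>p. (norm (surf_grad M (\<phi> n) p - G p))\<^sup>2 \<partial>area)" for n
  let ?a = "\<integral>p. (f p)\<^sup>2 \<partial>area" and ?b = "\<integral>p. (norm (G p))\<^sup>2 \<partial>area"
  have IJ: "0 \<le> I n" "0 \<le> J n" for n by (simp_all add: I_def J_def)
  have I0: "I \<longlonglongrightarrow> 0"
    by (rule tendsto_sandwich[OF _ _ tendsto_const lim[folded I_def J_def]]) (use IJ in auto)
  have J0: "J \<longlonglongrightarrow> 0"
    by (rule tendsto_sandwich[OF _ _ tendsto_const lim[folded I_def J_def]]) (use IJ in auto)
  have bound: "\<mu> * ?a \<le> (1 + e) * ((1 + e) * ?b + (1 + 1 / e) * J n) + \<mu> * (1 + 1 / e) * I n" if e: "0 < e" for e n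
  proof -
    have c: "surf_Ckc 1 (\<phi> n)" by (rule test_functions_surf_Ckc[OF \<phi>])
    then have k: "surf_Ck 1 (\<phi> n)" by (simp add: surf_Ckc_def)
    have mg: "surf_grad M (\<phi> n) \<in> borel_measurable area"
      using continuous_on_surf_grad[OF k] by (intro measurable_area_chartwise) (auto simp: o_def)
    have "?a \<le> (1 + e) * (\<integral>p. (\<phi> n p)\<^sup>2 \<partial>area) + (1 + 1 / e) * I n"
      using integral_power2_norm_perturb[OF m(1) surf_Ck_measurable[OF k] _ _ e] i(1) test(2)[OF c]
      by (simp add: I_def power2_commute[of "f _"])
    then have "\<mu> * ?a \<le> \<mu> * ((1 + e) * (\<integral>p. (\<phi> n p)\<^sup>2 \<partial>area) + (1 + 1 / e) * I n)"
      using \<mu> by (rule mult_left_mono)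
    also have "\<dots> = (1 + e) * (\<mu> * (\<integral>p. (\<phi> n p)\<^sup>2 \<partial>area)) + \<mu> * (1 + 1 / e) * I n"
      by (simp add: algebra_simps)
    also have "\<mu> * (\<integral>p. (\<phi> n p)\<^sup>2 \<partial>area) \<le> (1 + e) * ?b + (1 + 1 / e) * J n"
    proof -
      have "(\<integral>p. (norm (surf_grad M (\<phi> n) p))\<^sup>2 \<partial>area) \<le> (1 + e) * ?b + (1 + 1 / e) * J n"
        unfolding J_def by (rule integral_power2_norm_perturb[OF mg m(2) test(3)[OF c] i(2) e])
      then show ?thesis using test(1)[OF c] by simp
    qed
    finally show ?thesis using e by (simp add: mult_left_mono)
  qed
  have bound2: "\<mu> * ?a \<le> (1 + e)\<^sup>2 * ?b" if e: "0 < e" for e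
  proof (rule LIMSEQ_le_const)
    show "(\<lambda>n. (1 + e) * ((1 + e) * ?b + (1 + 1 / e) * J n) + \<mu> * (1 + 1 / e) * I n) \<longlonglongrightarrow> (1 + e)\<^sup>2 * ?b"
      by (rule tendsto_eq_intros I0 J0 refl)+ (simp add: power2_eq_square)
    show "\<exists>N. \<forall>n\<ge>N. \<mu> * ?a \<le> (1 + e) * ((1 + e) * ?b + (1 + 1 / e) * J n) + \<mu> * (1 + 1 / e) * I n"
      using bound[OF e] by blast
  qed
  show ?thesis
  proof (rule tendsto_lowerbound)
    show "((\<lambda>e. (1 + e)\<^sup>2 * ?b) \<longlongrightarrow> ?b) (at_right 0)"
      by (rule tendsto_eq_intros refl)+ simp
    show "\<forall>\<^sub>F e in at_right 0. \<mu> * ?a \<le> (1 + e)\<^sup>2 * ?b"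
      using bound2 by (auto simp: eventually_at_filter)
  qed simp
qed

text \<open>Ensures that the infimum in \<open>fundamental_tone\<close> is not over the empty set. A
  single bump works, since a coordinate ball has positive area: the density is positive on
  it.\<close>

lemma nonzero_test_function:
  obtains f where "f \<in> test_functions M" "\<not> (AE p in area. f p = 0)"
proof -
  have "topspace X \<noteq> {}" using immersed unfolding immersed_surface_def by blast
  then obtain V \<phi> x where V: "(V, \<phi>) \<in> atlas" "x \<in> V" using topspaceE by blast
  obtain e where e: "0 < e" "cball x e \<subseteq> V"
    using chart_open[OF V(1)] V(2) open_contains_cball by blast
  let ?f = "surf_bump V \<phi> x e"
  have bV: "ball x e \<subseteq> V" using e(2) ball_subset_cball by blast
  show ?thesis
  proof
    have "surf_Ckc k ?f" for k
      by (rule chart_supported_Ckc[OF surf_Ck_bump[OF V(1) e] surf_bump_supported[OF V(1) e]])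
    then show "?f \<in> test_functions M"
      unfolding test_functions_def surf_Ckc_def surf_Ck_def smooth_on_def by fastforce
    show "\<not> (AE p in area. ?f p = 0)"
    proof
      assume "AE p in area. ?f p = 0"
      moreover have "{p \<in> space area. ?f p \<noteq> 0} = \<phi> ` ball x e"
        using surf_bump_pos[OF V(1) e] surf_bump_eq_0[OF V(1) e] chart_in_topspace[OF V(1)] bV by fastforce
      moreover have "\<phi> ` ball x e \<in> sets area"
        using chart_image_sets[OF V(1) _ bV] by simp
      ultimately have "emeasure area (\<phi> ` ball x e) = 0"
        by (subst (asm) AE_iff_measurable) auto
      moreover have "emeasure area (\<phi> ` ball x e) = (\<integral>\<^sup>+y\<in>ball x e. ennreal (area_density (im \<circ> \<phi>) y) \<partial>lborel)"
        using is_area_measure_area V(1) bV unfolding is_area_measure_def by fastforce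
      moreover have "(\<lambda>y. ennreal (area_density (im \<circ> \<phi>) y) * indicator (ball x e) y) \<in> borel_measurable lborel"
      proof -
        have "(\<lambda>y. ennreal (indicator (ball x e) y * area_density (im \<circ> \<phi>) y)) \<in> borel_measurable lborel"
          using area_density_measurable[OF V(1) _ bV] by simp
        moreover have "(\<lambda>y. ennreal (indicator (ball x e) y * area_density (im \<circ> \<phi>) y)) =
            (\<lambda>y. ennreal (area_density (im \<circ> \<phi>) y) * indicator (ball x e) y)"
          by (auto simp: indicator_def fun_eq_iff)
        ultimately show ?thesis by simp
      qed
      ultimately have 0: "AE y in lborel. ennreal (area_density (im \<circ> \<phi>) y) * indicator (ball x e) y = 0"
        by (simp add: nn_integral_0_iff_AE)
      have pos: "0 < area_density (im \<circ> \<phi>) y" if "y \<in> ball x e" for y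
        using regular_on_pos[OF chart_regular[OF V(1)]] that bV by blast
      have "AE y in lborel. y \<notin> ball x e"
        using 0
      proof (rule eventually_mono)
        fix y assume "ennreal (area_density (im \<circ> \<phi>) y) * indicator (ball x e) y = 0"
        then show "y \<notin> ball x e" using pos[of y] by (auto simp: indicator_def split: if_splits)
      qed
      then have "emeasure lborel (ball x e) = 0"
        by (subst (asm) AE_iff_measurable[where N="ball x e"]) auto
      then have "negligible (ball x e)" by (simp add: negligible_iff_null_sets null_sets_completionI null_setsI)
      then show False using open_not_negligible[of "ball x e"] e(1) by simp
    qed
  qed
qed

lemma fundamental_tone_ge:
  assumes \<mu>: "0 \<le> \<mu>"
    and test: "\<And>f. surf_Ckc 1 f \<Longrightarrow> \<mu> * (\<integral>p. (f p)\<^sup>2 \<partial>area) \<le> (\<integral>p. (norm (surf_grad M f p))\<^sup>2 \<partial>area)"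
      "\<And>f. surf_Ckc 1 f \<Longrightarrow> integrable area (\<lambda>p. (f p)\<^sup>2)"
      "\<And>f. surf_Ckc 1 f \<Longrightarrow> integrable area (\<lambda>p. (norm (surf_grad M f p))\<^sup>2)"
  shows "\<mu> \<le> fundamental_tone M"
  unfolding fundamental_tone_def
proof (rule cInf_greatest)
  obtain f where f: "f \<in> test_functions M" "\<not> (AE p in area. f p = 0)" by (rule nonzero_test_function)
  have c: "surf_Ckc 1 f" by (rule test_functions_surf_Ckc[OF f(1)])
  then have k: "surf_Ck 1 f" by (simp add: surf_Ckc_def)
  have "surf_grad M f \<in> borel_measurable area"
    using continuous_on_surf_grad[OF k] by (intro measurable_area_chartwise) (auto simp: o_def)
  then have "(f, surf_grad M f) \<in> L2_1_0 M"
    unfolding L2_1_0_def using surf_Ck_measurable[OF k] test(2,3)[OF c] f(1) by (auto intro!: exI[of _ "\<lambda>_. f"])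
  then show "{(\<integral>p. (norm (G p))\<^sup>2 \<partial>area) / (\<integral>p. (f p)\<^sup>2 \<partial>area) |f G.
      (f, G) \<in> L2_1_0 M \<and> \<not> (AE p in area. f p = 0)} \<noteq> {}" using f(2) by blast
next
  fix q assume "q \<in> {(\<integral>p. (norm (G p))\<^sup>2 \<partial>area) / (\<integral>p. (f p)\<^sup>2 \<partial>area) |f G.
      (f, G) \<in> L2_1_0 M \<and> \<not> (AE p in area. f p = 0)}"
  then obtain f G where q: "q = (\<integral>p. (norm (G p))\<^sup>2 \<partial>area) / (\<integral>p. (f p)\<^sup>2 \<partial>area)"
    and fG: "(f, G) \<in> L2_1_0 M" and nz: "\<not> (AE p in area. f p = 0)" by blast
  have "integrable area (\<lambda>p. (f p)\<^sup>2)" using fG by (simp add: L2_1_0_def)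
  \<comment> \<open>A zero denominator would turn the quotient into 0 and spoil the bound;
    \<open>nz\<close> excludes it.\<close>
  then have "(\<integral>p. (f p)\<^sup>2 \<partial>area) \<noteq> 0" using nz integral_nonneg_eq_0_iff_AE[of area "\<lambda>p. (f p)\<^sup>2"] by auto
  then have "0 < (\<integral>p. (f p)\<^sup>2 \<partial>area)" by (simp add: less_le)
  then show "\<mu> \<le> q" using L2_1_0_inequality[OF fG \<mu> test] by (simp add: q le_divide_eq)
qed

end

theorem corollary1p11:
  shows "\<exists>c>0. \<forall>r>0.
    first_dirichlet_eigenvalue (ball 0 r) = c / r\<^sup>2 \<and>
    (\<forall>(M :: 'a surface) a. minimal_surface M \<longrightarrow> complete_surface M \<longrightarrow>
        immersion M ` surf_points M \<subseteq> ball a r \<longrightarrow>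
        fundamental_tone M \<ge> first_dirichlet_eigenvalue (ball 0 r))"
proof -
  obtain T where T: "0 < T" "T \<le> 2" "bes 0 T = 0" "\<And>t. 0 \<le> t \<Longrightarrow> t < T \<Longrightarrow> 0 < bes 0 t"
    using bes_0_first_zero by blast
  show ?thesis
  \<comment> \<open>With T = j^2/4 for the first zero j of J_0, this constant is j^2.\<close>
  proof (intro exI[of _ "4 * T"] conjI allI impI)
    show "0 < 4 * T" using T(1) by simp
    fix r :: real assume r: "0 < r"
    show eq: "first_dirichlet_eigenvalue (ball 0 r) = 4 * T / r\<^sup>2"
      by (rule first_dirichlet_eigenvalue_disc[OF r T(3,4,1)])
    fix M :: "'a surface" and a
    assume M: "minimal_surface M" and ball: "immersion M ` surf_points M \<subseteq> ball a r"
    interpret immersed M using M by unfold_locales (simp add: minimal_surface_def)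
    have min: "mean_curvature (immersion M \<circ> \<phi>) x = 0" if "(V, \<phi>) \<in> parametrizations M" "x \<in> V" for V \<phi> x
      using M that by (auto simp: minimal_surface_def)
    show "first_dirichlet_eigenvalue (ball 0 r) \<le> fundamental_tone M"
      unfolding eq
      by (rule fundamental_tone_ge) (use Barta[OF min ball r T(2,4,1)] T(1) in auto)
  qed
qed

end
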